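(* Let $k$ be a natural number and let $\varphi$ be a formula of $\mathsf{HA}$ (possibly containing free variables). (1) If $\varphi \in \mathrm{E}_k^+$, then there exists $\varphi' \in \Sigma_k$ with $\mathrm{FV}(\varphi)=\mathrm{FV}(\varphi')$ and $\mathsf{HA} + \mathrm{DNE}(\Sigma_k) + \mathrm{DNS}(\mathrm{U}_k^+) \vdash \varphi \leftrightarrow \varphi'$. (2) If $\varphi \in \mathrm{U}_k^+$, then there exists $\varphi' \in \Pi_k$ with $\mathrm{FV}(\varphi)=\mathrm{FV}(\varphi')$ and $\mathsf{HA} + \mathrm{DNE}(\Pi_k \lor \Pi_k) \vdash \varphi \leftrightarrow \varphi'$.
   Context: $\mathsf{HA}$ is intuitionistic (Heyting) arithmetic in the language with function symbols for all primitive recursive functions and logical constants $\forall,\exists,\to,\land,\lor,\perp$; $\neg\varphi$ abbreviates $\varphi\to\perp$. For a theory $T$ and a schema $\mathrm{P}$, $T+\mathrm{P}$ is $T$ with all instances of $\mathrm{P}$ added as axioms, and $T\vdash \mathrm{P}$ means every instance of $\mathrm{P}$ is provable in $T$. $\mathrm{FV}(\varphi)$ is the set of free variables of $\varphi$. Arithmetical classes: $\Sigma_0=\Pi_0$ is the class of quantifier-free formulas; $\Pi_{k+1}$ consists of formulas $Q_1\bar x_1\cdots Q_{k+1}\bar x_{k+1}\,\varphi_{qf}$ with $\varphi_{qf}$ quantifier-free, $Q_i=\forall$ for odd $i$ and $\exists$ for even $i$; $\Sigma_{k+1}$ likewise with $Q_i=\exists$ for odd $i$ and $\forall$ for even $i$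 (blocks of like quantifiers; by the convention of the paper blocks may be empty, so $\Sigma_k\cup\Pi_k\subseteq\Sigma_{k'}\cap\Pi_{k'}$ for $k<k'$). For a class $\Gamma$, $\Gamma(\bar x)$ is the set of formulas in $\Gamma$ whose free variables are among $\bar x$. Principles: $\mathrm{DNE}(\Gamma)$: $\forall x(\neg\neg\varphi(x)\to\varphi(x))$ for $\varphi(x)\in\Gamma(x)$; $\mathrm{DNE}(\Gamma\lor\Gamma')$: $\forall x(\neg\neg(\varphi(x)\lor\psi(x))\to\varphi(x)\lor\psi(x))$ for $\varphi(x)\in\Gamma(x)$, $\psi(x)\in\Gamma'(x)$; $\mathrm{DNS}(\Gamma)$: $\forall x(\forall y\neg\neg\varphi(x,y)\to\neg\neg\forall y\varphi(x,y))$ for $\varphi(x,y)\in\Gamma(x,y)$. Alternation paths: finite sequences of $+$ and $-$ in which $+$ and $-$ alternate. For such $s$, $i(s)$ is its first symbol ($\times$ if $s$ is empty), $s^\perp$ swaps $+$ and $-$, and $l(s)$ is the length. The set $\mathrm{Alt}(\varphi)$: if $\varphi$ is quantifier-free, $\mathrm{Alt}(\varphi)=\{\langle\rangle\}$; otherwise inductively: $\mathrm{Alt}(\neg\varphi_1)=\{s^\perp: s\in\mathrm{Alt}(\varphi_1)\}$; $\mathrm{Alt}(\varphi_1\land\varphi_2)=\mathrm{Alt}(\varphi_1\lor\varphi_2)=\mathrm{Alt}(\varphi_1)\cup\mathrm{Alt}(\varphi_2)$; $\mathrm{Alt}(\varphi_1\to\varphi_2)=\{s^\perp:s\in\mathrm{Alt}(\varphi_1)\}\cup\mathrm{Alt}(\varphi_2)$;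 $\mathrm{Alt}(\forall x\varphi_1)=\{s\in\mathrm{Alt}(\varphi_1): i(s)=-\}\cup\{-s: s\in\mathrm{Alt}(\varphi_1), i(s)\neq -\}$; $\mathrm{Alt}(\exists x\varphi_1)=\{s\in\mathrm{Alt}(\varphi_1): i(s)=+\}\cup\{+s: s\in\mathrm{Alt}(\varphi_1), i(s)\neq +\}$. The degree is $\deg(\varphi)=\max\{l(s):s\in\mathrm{Alt}(\varphi)\}$. Classes: $\mathrm{F}_k=\{\varphi:\deg(\varphi)=k\}$; $\mathrm{U}_0=\mathrm{E}_0=\mathrm{F}_0$; $\mathrm{U}_{k+1}=\{\varphi\in\mathrm{F}_{k+1}: i(s)=-\text{ for all } s\in\mathrm{Alt}(\varphi)\text{ with } l(s)=k+1\}$; $\mathrm{E}_{k+1}$ likewise with $i(s)=+$; $\mathrm{U}_k^+=\mathrm{U}_k\cup\bigcup_{i<k}\mathrm{F}_i$; $\mathrm{E}_k^+=\mathrm{E}_k\cup\bigcup_{i<k}\mathrm{F}_i$. *)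

theory Defs
  imports Main
begin

section \<open>The language of Heyting arithmetic\<close>

text \<open>Function symbols are primitive recursive definitions. The number carried by \<open>Comp\<close> is the
  arity of the composed function, which is not determined by the arguments when the list is empty.
  In \<open>Rec f g\<close> the recursion argument comes first.\<close>

datatype fsym = Zero | Succ | Proj nat nat | Comp nat fsym "fsym list" | Rec fsym fsym

fun arity :: "fsym \<Rightarrow> nat" where
  "arity Zero = 0"
| "arity Succ = 1"
| "arity (Proj n i) = n"
| "arity (Comp n f gs) = n"
| "arity (Rec f g) = Suc (arity f)"

fun wf_sym :: "fsym \<Rightarrow> bool" where
  "wf_sym Zero \<longleftrightarrow> True"
| "wf_sym Succ \<longleftrightarrow> True"
| "wf_sym (Proj n i) \<longleftrightarrow> i < n"
| "wf_sym (Comp n f gs) \<longleftrightarrow> wf_sym f \<and> arity f = length gs \<and> (\<forall>g\<in>set gs. wf_sym g \<and> arity g = n)"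
| "wf_sym (Rec f g) \<longleftrightarrow> wf_sym f \<and> wf_sym g \<and> arity g = Suc (Suc (arity f))"

text \<open>Variables are de Bruijn indices: index 0 is bound by the innermost enclosing quantifier, and
  an index pointing beyond all enclosing quantifiers is a free variable.\<close>

datatype tm = Var nat | App fsym "tm list"

datatype fm =
    Eq tm tm
  | Fls
  | Conj fm fm
  | Disj fm fm
  | Imp fm fm
  | Forall fm
  | Exists fm

abbreviation Neg :: "fm \<Rightarrow> fm" where
  "Neg \<phi> \<equiv> Imp \<phi> Fls"

abbreviation Iff :: "fm \<Rightarrow> fm \<Rightarrow> fm" where
  "Iff \<phi> \<psi> \<equiv> Conj (Imp \<phi> \<psi>) (Imp \<psi> \<phi>)"

abbreviation zero :: tm where
  "zero \<equiv> App Zero []"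

abbreviation succ :: "tm \<Rightarrow> tm" where
  "succ t \<equiv> App Succ [t]"

fun wf_tm :: "tm \<Rightarrow> bool" where
  "wf_tm (Var n) \<longleftrightarrow> True"
| "wf_tm (App f ts) \<longleftrightarrow> wf_sym f \<and> arity f = length ts \<and> (\<forall>t\<in>set ts. wf_tm t)"

fun wf_fm :: "fm \<Rightarrow> bool" where
  "wf_fm (Eq s t) \<longleftrightarrow> wf_tm s \<and> wf_tm t"
| "wf_fm Fls \<longleftrightarrow> True"
| "wf_fm (Conj \<phi> \<psi>) \<longleftrightarrow> wf_fm \<phi> \<and> wf_fm \<psi>"
| "wf_fm (Disj \<phi> \<psi>) \<longleftrightarrow> wf_fm \<phi> \<and> wf_fm \<psi>"
| "wf_fm (Imp \<phi> \<psi>) \<longleftrightarrow> wf_fm \<phi> \<and> wf_fm \<psi>"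
| "wf_fm (Forall \<phi>) \<longleftrightarrow> wf_fm \<phi>"
| "wf_fm (Exists \<phi>) \<longleftrightarrow> wf_fm \<phi>"

fun FV_tm :: "tm \<Rightarrow> nat set" where
  "FV_tm (Var n) = {n}"
| "FV_tm (App f ts) = (\<Union>t\<in>set ts. FV_tm t)"

fun FV :: "fm \<Rightarrow> nat set" where
  "FV (Eq s t) = FV_tm s \<union> FV_tm t"
| "FV Fls = {}"
| "FV (Conj \<phi> \<psi>) = FV \<phi> \<union> FV \<psi>"
| "FV (Disj \<phi> \<psi>) = FV \<phi> \<union> FV \<psi>"
| "FV (Imp \<phi> \<psi>) = FV \<phi> \<union> FV \<psi>"
| "FV (Forall \<phi>) = {n. Suc n \<in> FV \<phi>}"
| "FV (Exists \<phi>) = {n. Suc n \<in> FV \<phi>}"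

fun subst_tm :: "(nat \<Rightarrow> tm) \<Rightarrow> tm \<Rightarrow> tm" where
  "subst_tm \<sigma> (Var n) = \<sigma> n"
| "subst_tm \<sigma> (App f ts) = App f (map (subst_tm \<sigma>) ts)"

definition up :: "(nat \<Rightarrow> tm) \<Rightarrow> nat \<Rightarrow> tm" where
  "up \<sigma> = case_nat (Var 0) (\<lambda>n. subst_tm (\<lambda>m. Var (Suc m)) (\<sigma> n))"

fun subst :: "(nat \<Rightarrow> tm) \<Rightarrow> fm \<Rightarrow> fm" where
  "subst \<sigma> (Eq s t) = Eq (subst_tm \<sigma> s) (subst_tm \<sigma> t)"
| "subst \<sigma> Fls = Fls"
| "subst \<sigma> (Conj \<phi> \<psi>) = Conj (subst \<sigma> \<phi>) (subst \<sigma> \<psi>)"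
| "subst \<sigma> (Disj \<phi> \<psi>) = Disj (subst \<sigma> \<phi>) (subst \<sigma> \<psi>)"
| "subst \<sigma> (Imp \<phi> \<psi>) = Imp (subst \<sigma> \<phi>) (subst \<sigma> \<psi>)"
| "subst \<sigma> (Forall \<phi>) = Forall (subst (up \<sigma>) \<phi>)"
| "subst \<sigma> (Exists \<phi>) = Exists (subst (up \<sigma>) \<phi>)"

definition lift :: "fm \<Rightarrow> fm" where
  "lift = subst (\<lambda>n. Var (Suc n))"

text \<open>\<open>inst t \<phi>\<close> removes the variable 0 of \<open>\<phi>\<close>, replacing it by \<open>t\<close> and decrementing the others.\<close>

definition inst :: "tm \<Rightarrow> fm \<Rightarrow> fm" where
  "inst t = subst (case_nat t Var)"

section \<open>Intuitionistic provability\<close>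

text \<open>Natural deduction for intuitionistic logic with equality over a set \<open>T\<close> of non-logical
  axioms. Free variables of a member of \<open>T\<close> are read as universally quantified: unlike the
  hypotheses \<open>\<Gamma>\<close>, the axioms are not lifted when a quantifier is introduced.\<close>

inductive deriv :: "fm set \<Rightarrow> fm list \<Rightarrow> fm \<Rightarrow> bool" for T :: "fm set" where
  Ax: "\<phi> \<in> T \<Longrightarrow> deriv T \<Gamma> \<phi>"
| Hyp: "\<phi> \<in> set \<Gamma> \<Longrightarrow> deriv T \<Gamma> \<phi>"
| FlsE: "deriv T \<Gamma> Fls \<Longrightarrow> wf_fm \<phi> \<Longrightarrow> deriv T \<Gamma> \<phi>"
| ConjI: "deriv T \<Gamma> \<phi> \<Longrightarrow> deriv T \<Gamma> \<psi> \<Longrightarrow> deriv T \<Gamma> (Conj \<phi> \<psi>)"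
| ConjE1: "deriv T \<Gamma> (Conj \<phi> \<psi>) \<Longrightarrow> deriv T \<Gamma> \<phi>"
| ConjE2: "deriv T \<Gamma> (Conj \<phi> \<psi>) \<Longrightarrow> deriv T \<Gamma> \<psi>"
| DisjI1: "deriv T \<Gamma> \<phi> \<Longrightarrow> wf_fm \<psi> \<Longrightarrow> deriv T \<Gamma> (Disj \<phi> \<psi>)"
| DisjI2: "deriv T \<Gamma> \<psi> \<Longrightarrow> wf_fm \<phi> \<Longrightarrow> deriv T \<Gamma> (Disj \<phi> \<psi>)"
| DisjE: "deriv T \<Gamma> (Disj \<phi> \<psi>) \<Longrightarrow> deriv T (\<phi> # \<Gamma>) \<chi> \<Longrightarrow> deriv T (\<psi> # \<Gamma>) \<chi> \<Longrightarrow> deriv T \<Gamma> \<chi>"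
| ImpI: "deriv T (\<phi> # \<Gamma>) \<psi> \<Longrightarrow> wf_fm \<phi> \<Longrightarrow> deriv T \<Gamma> (Imp \<phi> \<psi>)"
| ImpE: "deriv T \<Gamma> (Imp \<phi> \<psi>) \<Longrightarrow> deriv T \<Gamma> \<phi> \<Longrightarrow> deriv T \<Gamma> \<psi>"
| ForallI: "deriv T (map lift \<Gamma>) \<phi> \<Longrightarrow> deriv T \<Gamma> (Forall \<phi>)"
| ForallE: "deriv T \<Gamma> (Forall \<phi>) \<Longrightarrow> wf_tm t \<Longrightarrow> deriv T \<Gamma> (inst t \<phi>)"
| ExistsI: "deriv T \<Gamma> (inst t \<phi>) \<Longrightarrow> wf_tm t \<Longrightarrow> wf_fm \<phi> \<Longrightarrow> deriv T \<Gamma> (Exists \<phi>)"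
| ExistsE: "deriv T \<Gamma> (Exists \<phi>) \<Longrightarrow> deriv T (\<phi> # map lift \<Gamma>) (lift \<chi>) \<Longrightarrow> wf_fm \<chi> \<Longrightarrow> deriv T \<Gamma> \<chi>"
| EqI: "wf_tm t \<Longrightarrow> deriv T \<Gamma> (Eq t t)"
| EqE: "deriv T \<Gamma> (Eq s t) \<Longrightarrow> deriv T \<Gamma> (inst s \<phi>) \<Longrightarrow> wf_fm \<phi> \<Longrightarrow> deriv T \<Gamma> (inst t \<phi>)"

definition proves :: "fm set \<Rightarrow> fm \<Rightarrow> bool"  (infix \<open>\<turnstile>\<close> 50) where
  "T \<turnstile> \<phi> \<longleftrightarrow> deriv T [] \<phi>"

text \<open>In the induction axiom, the step substitutes the successor of variable 0 for variable 0,
  leaving the other variables alone.\<close>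

inductive_set HA :: "fm set" where
  Succ_not_zero: "wf_tm t \<Longrightarrow> Neg (Eq (succ t) zero) \<in> HA"
| Succ_inj: "wf_tm s \<Longrightarrow> wf_tm t \<Longrightarrow> Imp (Eq (succ s) (succ t)) (Eq s t) \<in> HA"
| Proj: "wf_tm (App (Proj n i) ts) \<Longrightarrow> Eq (App (Proj n i) ts) (ts ! i) \<in> HA"
| Comp: "wf_tm (App (Comp n f gs) ts) \<Longrightarrow>
    Eq (App (Comp n f gs) ts) (App f (map (\<lambda>g. App g ts) gs)) \<in> HA"
| Rec_zero: "wf_tm (App (Rec f g) (zero # ts)) \<Longrightarrow>
    Eq (App (Rec f g) (zero # ts)) (App f ts) \<in> HA"
| Rec_succ: "wf_tm (App (Rec f g) (succ t # ts)) \<Longrightarrow>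
    Eq (App (Rec f g) (succ t # ts)) (App g (t # App (Rec f g) (t # ts) # ts)) \<in> HA"
| Induction: "wf_fm \<phi> \<Longrightarrow>
    Imp (Conj (inst zero \<phi>)
          (Forall (Imp \<phi> (subst (case_nat (succ (Var 0)) (\<lambda>n. Var (Suc n))) \<phi>))))
        (Forall \<phi>) \<in> HA"

section \<open>Arithmetical classes and principles\<close>

fun qf :: "fm \<Rightarrow> bool" where
  "qf (Eq s t) \<longleftrightarrow> True"
| "qf Fls \<longleftrightarrow> True"
| "qf (Conj \<phi> \<psi>) \<longleftrightarrow> qf \<phi> \<and> qf \<psi>"
| "qf (Disj \<phi> \<psi>) \<longleftrightarrow> qf \<phi> \<and> qf \<psi>"
| "qf (Imp \<phi> \<psi>) \<longleftrightarrow> qf \<phi> \<and> qf \<psi>"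
| "qf (Forall \<phi>) \<longleftrightarrow> False"
| "qf (Exists \<phi>) \<longleftrightarrow> False"

text \<open>\<open>(Exists ^^ n) \<phi>\<close> is \<open>\<phi>\<close> prefixed by a block of \<open>n\<close> quantifiers; blocks may be empty.\<close>

fun Sigma_cls :: "nat \<Rightarrow> fm set" and Pi_cls :: "nat \<Rightarrow> fm set" where
  "Sigma_cls 0 = {\<phi>. wf_fm \<phi> \<and> qf \<phi>}"
| "Sigma_cls (Suc k) = {(Exists ^^ n) \<phi> | n \<phi>. \<phi> \<in> Pi_cls k}"
| "Pi_cls 0 = {\<phi>. wf_fm \<phi> \<and> qf \<phi>}"
| "Pi_cls (Suc k) = {(Forall ^^ n) \<phi> | n \<phi>. \<phi> \<in> Sigma_cls k}"

definition DNE :: "fm set \<Rightarrow> fm set" where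
  "DNE \<Gamma> = {Forall (Imp (Neg (Neg \<phi>)) \<phi>) | \<phi>. \<phi> \<in> \<Gamma> \<and> FV \<phi> \<subseteq> {0}}"

definition DNE_disj :: "fm set \<Rightarrow> fm set \<Rightarrow> fm set" where
  "DNE_disj \<Gamma> \<Gamma>' = {Forall (Imp (Neg (Neg (Disj \<phi> \<psi>))) (Disj \<phi> \<psi>)) | \<phi> \<psi>.
     \<phi> \<in> \<Gamma> \<and> FV \<phi> \<subseteq> {0} \<and> \<psi> \<in> \<Gamma>' \<and> FV \<psi> \<subseteq> {0}}"

text \<open>In \<open>\<phi>(x,y)\<close> the variable \<open>y\<close> has index 0 and \<open>x\<close> has index 1.\<close>

definition DNS :: "fm set \<Rightarrow> fm set" where
  "DNS \<Gamma> = {Forall (Imp (Forall (Neg (Neg \<phi>))) (Neg (Neg (Forall \<phi>)))) | \<phi>.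
     \<phi> \<in> \<Gamma> \<and> FV \<phi> \<subseteq> {0, 1}}"

section \<open>Alternation paths and degrees\<close>

datatype sign = Plus | Minus

fun flip :: "sign \<Rightarrow> sign" where
  "flip Plus = Minus"
| "flip Minus = Plus"

text \<open>The first symbol of a path; \<open>None\<close> stands for the symbol \<open>\<times>\<close>.\<close>

definition first :: "sign list \<Rightarrow> sign option" where
  "first s = (if s = [] then None else Some (hd s))"

definition perp :: "sign list \<Rightarrow> sign list" where
  "perp s = map flip s"

text \<open>The equation for \<open>Imp\<close> merges the clause for implication with the separate one for negation,
  in which \<open>Fls\<close> contributes no path.\<close>

fun Alt :: "fm \<Rightarrow> sign list set" where
  "Alt (Eq s t) = {[]}"
| "Alt Fls = {[]}"
| "Alt (Conj \<phi> \<psi>) = (if qf (Conj \<phi> \<psi>) then {[]} else Alt \<phi> \<union> Alt \<psi>)"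
| "Alt (Disj \<phi> \<psi>) = (if qf (Disj \<phi> \<psi>) then {[]} else Alt \<phi> \<union> Alt \<psi>)"
| "Alt (Imp \<phi> \<psi>) =
    (if qf (Imp \<phi> \<psi>) then {[]}
     else if \<psi> = Fls then perp ` Alt \<phi>
     else perp ` Alt \<phi> \<union> Alt \<psi>)"
| "Alt (Forall \<phi>) =
    {s \<in> Alt \<phi>. first s = Some Minus} \<union> {Minus # s | s. s \<in> Alt \<phi> \<and> first s \<noteq> Some Minus}"
| "Alt (Exists \<phi>) =
    {s \<in> Alt \<phi>. first s = Some Plus} \<union> {Plus # s | s. s \<in> Alt \<phi> \<and> first s \<noteq> Some Plus}"

definition deg :: "fm \<Rightarrow> nat" where
  "deg \<phi> = Max (length ` Alt \<phi>)"

definition F_cls :: "nat \<Rightarrow> fm set" where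
  "F_cls k = {\<phi>. wf_fm \<phi> \<and> deg \<phi> = k}"

fun U_cls :: "nat \<Rightarrow> fm set" where
  "U_cls 0 = F_cls 0"
| "U_cls (Suc k) =
    {\<phi> \<in> F_cls (Suc k). \<forall>s\<in>Alt \<phi>. length s = Suc k \<longrightarrow> first s = Some Minus}"

fun E_cls :: "nat \<Rightarrow> fm set" where
  "E_cls 0 = F_cls 0"
| "E_cls (Suc k) =
    {\<phi> \<in> F_cls (Suc k). \<forall>s\<in>Alt \<phi>. length s = Suc k \<longrightarrow> first s = Some Plus}"

definition U_plus :: "nat \<Rightarrow> fm set" where
  "U_plus k = U_cls k \<union> (\<Union>i<k. F_cls i)"

definition E_plus :: "nat \<Rightarrow> fm set" where
  "E_plus k = E_cls k \<union> (\<Union>i<k. F_cls i)"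

end

theory Submission
  imports Defs
begin

text \<open>
  Call two formulas weakly equivalent if their negations are equivalent. Weak equivalence is a
  congruence for all connectives except \<open>\<forall>\<close>, and DNS is exactly what is needed for \<open>\<forall>\<close>. Over a theory
  with DNE for \<open>\<Sigma>\<^sub>k\<close>, negation therefore exchanges the formulas weakly equivalent to \<open>\<Sigma>\<^sub>k\<^sub>+\<^sub>1\<close> and to
  \<open>\<Pi>\<^sub>k\<^sub>+\<^sub>1\<close> formulas, and both classes are closed under the connectives as soon as they are closed under
  conjunction. By induction on \<open>k\<close> and on the formula, part (1) is proved together with the statement
  that \<open>U\<^sub>k\<^sup>+\<close> formulas are weakly equivalent to \<open>\<Pi>\<^sub>k\<close> formulas, and part (2) together with the dual
  statement; an equivalence is recovered from a weak one whenever both sides are stable under double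
  negation. A quantifier of the wrong kind lowers the degree, and the theory of part (1) at \<open>k\<close> is
  contained in that of part (2) at \<open>k + 1\<close>, and vice versa. The principles are stated for one parameter
  only; a primitive recursive pairing function, verified in HA, provides the others.
\<close>

section \<open>Substitution\<close>

text \<open>A disjunction of stable formulas need not be stable, so a normal form of it up to
  \<open>\<sim>\<close> cannot simply be upgraded to one up to \<open>\<approx>\<close>. Part (1)
  converts such a disjunction exactly: it says that some x satisfies both "if x = 0 then the first"
  and "if x is not 0 then the second". Part (2) takes the stability from its own axioms for
  disjunctions. The dual statement may stay weak because it serves only premises of implications,
  where polarity flips, and an implication is stable as soon as its conclusion is. The same
  conversion makes a disjunction of two \<open>Pi_cls k\<close> formulas a
  \<open>Sigma_cls (Suc k)\<close> formula, so DNE for the latter gives the disjunctive principle at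
  k. In the other direction, a \<open>Sigma_cls k\<close> formula is equivalent to its disjunction
  with itself and lies in \<open>Pi_cls (Suc k)\<close>, which gives DNE; and DNS for
  \<open>U_plus k\<close> becomes trivial because part (2) at k makes those formulas equivalent to
  stable ones.\<close>

abbreviation wk :: "nat \<Rightarrow> tm" where
  "wk n \<equiv> Var (Suc n)"

lemma up_simps [simp]: "up \<sigma> 0 = Var 0" "up \<sigma> (Suc n) = subst_tm wk (\<sigma> n)"
  by (simp_all add: up_def)

lemma subst_tm_subst_tm [simp]: "subst_tm \<sigma> (subst_tm \<tau> t) = subst_tm (\<lambda>n. subst_tm \<sigma> (\<tau> n)) t"
  by (induction t) auto

lemma subst_tm_cong: "(\<And>n. n \<in> FV_tm t \<Longrightarrow> \<sigma> n = \<tau> n) \<Longrightarrow> subst_tm \<sigma> t = subst_tm \<tau> t"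
  by (induction t) auto

lemma subst_cong: "(\<And>n. n \<in> FV \<phi> \<Longrightarrow> \<sigma> n = \<tau> n) \<Longrightarrow> subst \<sigma> \<phi> = subst \<tau> \<phi>"
proof (induction \<phi> arbitrary: \<sigma> \<tau>)
  case (Forall \<phi>)
  have "up \<sigma> n = up \<tau> n" if "n \<in> FV \<phi>" for n
    using Forall.prems that by (cases n) auto
  then show ?case using Forall.IH[of "up \<sigma>" "up \<tau>"] by simp
next
  case (Exists \<phi>)
  have "up \<sigma> n = up \<tau> n" if "n \<in> FV \<phi>" for n
    using Exists.prems that by (cases n) auto
  then show ?case using Exists.IH[of "up \<sigma>" "up \<tau>"] by simp
next
  case (Eq s t)
  then show ?case by (auto intro!: subst_tm_cong)
next
  case (Conj \<phi> \<psi>)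
  show ?case using Conj.IH[of \<sigma> \<tau>] Conj.prems by simp
next
  case (Disj \<phi> \<psi>)
  show ?case using Disj.IH[of \<sigma> \<tau>] Disj.prems by simp
next
  case (Imp \<phi> \<psi>)
  show ?case using Imp.IH[of \<sigma> \<tau>] Imp.prems by simp
qed simp

lemma up_comp: "subst_tm (up \<sigma>) (up \<tau> n) = up (\<lambda>n. subst_tm \<sigma> (\<tau> n)) n"
  by (cases n) auto

lemma subst_subst [simp]: "subst \<sigma> (subst \<tau> \<phi>) = subst (\<lambda>n. subst_tm \<sigma> (\<tau> n)) \<phi>"
  by (induction \<phi> arbitrary: \<sigma> \<tau>) (simp_all add: up_comp)

lemma subst_tm_Var [simp]: "subst_tm Var t = t"
  by (induction t) (auto simp: map_idI)

lemma up_Var [simp]: "up Var = Var"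
  by (rule ext) (simp add: up_def split: nat.split)

lemma subst_Var [simp]: "subst Var \<phi> = \<phi>"
  by (induction \<phi>) auto

lemma wf_subst_tm: "wf_tm t \<Longrightarrow> (\<And>n. wf_tm (\<sigma> n)) \<Longrightarrow> wf_tm (subst_tm \<sigma> t)"
  by (induction t) auto

lemma wf_up: "(\<And>n. wf_tm (\<sigma> n)) \<Longrightarrow> wf_tm (up \<sigma> n)"
  by (cases n) (auto intro: wf_subst_tm)

lemma wf_subst: "wf_fm \<phi> \<Longrightarrow> (\<And>n. wf_tm (\<sigma> n)) \<Longrightarrow> wf_fm (subst \<sigma> \<phi>)"
  by (induction \<phi> arbitrary: \<sigma>) (auto simp: wf_subst_tm wf_up)

lemma wf_subst_tm_wk [simp]: "wf_tm (subst_tm wk t) = wf_tm t"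
  by (induction t) auto

lemma FV_subst_tm: "FV_tm (subst_tm \<sigma> t) = (\<Union>n\<in>FV_tm t. FV_tm (\<sigma> n))"
  by (induction t) auto

lemma FV_up: "{n. Suc n \<in> (\<Union>m\<in>A. FV_tm (up \<sigma> m))} = (\<Union>n\<in>{n. Suc n \<in> A}. FV_tm (\<sigma> n))"
proof (intro set_eqI iffI)
  fix x assume "x \<in> {n. Suc n \<in> (\<Union>m\<in>A. FV_tm (up \<sigma> m))}"
  then obtain m where "m \<in> A" "Suc x \<in> FV_tm (up \<sigma> m)" by auto
  then show "x \<in> (\<Union>n\<in>{n. Suc n \<in> A}. FV_tm (\<sigma> n))"
    by (cases m) (auto simp: FV_subst_tm)
next
  fix x assume "x \<in> (\<Union>n\<in>{n. Suc n \<in> A}. FV_tm (\<sigma> n))"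
  then obtain n where n: "Suc n \<in> A" "x \<in> FV_tm (\<sigma> n)" by auto
  then have "Suc x \<in> FV_tm (up \<sigma> (Suc n))" by (auto simp: FV_subst_tm)
  with n(1) show "x \<in> {n. Suc n \<in> (\<Union>m\<in>A. FV_tm (up \<sigma> m))}" by blast
qed

lemma FV_subst: "FV (subst \<sigma> \<phi>) = (\<Union>n\<in>FV \<phi>. FV_tm (\<sigma> n))"
proof (induction \<phi> arbitrary: \<sigma>)
  case (Forall \<phi>)
  show ?case unfolding subst.simps FV.simps Forall.IH by (rule FV_up)
next
  case (Exists \<phi>)
  show ?case unfolding subst.simps FV.simps Exists.IH by (rule FV_up)
qed (auto simp: FV_subst_tm)

lemma subst_closed: "FV \<phi> = {} \<Longrightarrow> subst \<sigma> \<phi> = \<phi>"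
  using subst_cong[of \<phi> \<sigma> Var] by simp

lemma finite_FV_tm: "finite (FV_tm t)"
  by (induction t) auto

lemma finite_FV: "finite (FV \<phi>)"
proof (induction \<phi>)
  case (Forall \<phi>)
  have "{n. Suc n \<in> FV \<phi>} = Suc -` FV \<phi>" by auto
  then show ?case using Forall finite_vimageI[of "FV \<phi>" Suc] by simp
next
  case (Exists \<phi>)
  have "{n. Suc n \<in> FV \<phi>} = Suc -` FV \<phi>" by auto
  then show ?case using Exists finite_vimageI[of "FV \<phi>" Suc] by simp
qed (auto simp: finite_FV_tm)

lemma wf_lift [simp]: "wf_fm \<phi> \<Longrightarrow> wf_fm (lift \<phi>)"
  by (simp add: lift_def wf_subst)

lemma wf_inst [simp]: "wf_tm t \<Longrightarrow> wf_fm \<phi> \<Longrightarrow> wf_fm (inst t \<phi>)"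
  unfolding inst_def by (rule wf_subst) (auto split: nat.split)

lemma FV_lift [simp]: "FV (lift \<phi>) = Suc ` FV \<phi>"
  by (auto simp: lift_def FV_subst)

lemma lift_simps [simp]:
  "lift Fls = Fls"
  "lift (Conj \<phi> \<psi>) = Conj (lift \<phi>) (lift \<psi>)"
  "lift (Disj \<phi> \<psi>) = Disj (lift \<phi>) (lift \<psi>)"
  "lift (Imp \<phi> \<psi>) = Imp (lift \<phi>) (lift \<psi>)"
  by (simp_all add: lift_def)

lemma inst_simps [simp]:
  "inst t Fls = Fls"
  "inst t (Conj \<phi> \<psi>) = Conj (inst t \<phi>) (inst t \<psi>)"
  "inst t (Disj \<phi> \<psi>) = Disj (inst t \<phi>) (inst t \<psi>)"
  "inst t (Imp \<phi> \<psi>) = Imp (inst t \<phi>) (inst t \<psi>)"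
  by (simp_all add: inst_def)

lemma inst_lift [simp]: "inst t (lift \<phi>) = \<phi>"
  by (simp add: inst_def lift_def)

lemma inst_Var0_up_wk [simp]: "inst (Var 0) (subst (up wk) \<phi>) = \<phi>"
proof -
  have "subst_tm (case_nat (Var 0) Var) (up wk n) = Var n" for n
    by (cases n) auto
  then show ?thesis by (simp add: inst_def)
qed

lemma subst_up_lift: "subst (up \<sigma>) (lift \<phi>) = lift (subst \<sigma> \<phi>)"
  by (simp add: lift_def)

text \<open>Used wherever a rule or axiom mentions an instance: \<open>ForallE\<close>,
  \<open>ExistsI\<close>, \<open>EqE\<close> and the induction axiom under a substitution.\<close>

lemma subst_inst: "subst \<sigma> (inst t \<phi>) = inst (subst_tm \<sigma> t) (subst (up \<sigma>) \<phi>)"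
proof -
  have "subst_tm \<sigma> (case_nat t Var n) = subst_tm (case_nat (subst_tm \<sigma> t) Var) (up \<sigma> n)" for n
    by (cases n) auto
  then show ?thesis by (simp add: inst_def)
qed

section \<open>Derivations\<close>

text \<open>Comparing contexts as sets covers weakening, exchange and contraction at once.\<close>

lemma deriv_weaken: "deriv T \<Gamma> \<phi> \<Longrightarrow> set \<Gamma> \<subseteq> set \<Delta> \<Longrightarrow> deriv T \<Delta> \<phi>"
proof (induction arbitrary: \<Delta> rule: deriv.induct)
  case (DisjE \<Gamma> \<phi> \<psi> \<chi>)
  show ?case
    by (rule deriv.DisjE[OF DisjE.IH(1)], rule DisjE.prems, rule DisjE.IH(2), use DisjE.prems in auto,
        rule DisjE.IH(3), use DisjE.prems in auto)
next
  case (ImpI \<phi> \<Gamma> \<psi>)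
  show ?case by (rule deriv.ImpI, rule ImpI.IH) (use ImpI in auto)
next
  case (ForallI \<Gamma> \<phi>)
  show ?case by (rule deriv.ForallI, rule ForallI.IH) (use ForallI in auto)
next
  case (ExistsE \<Gamma> \<phi> \<chi>)
  have "deriv T (\<phi> # map lift \<Delta>) (lift \<chi>)"
    by (rule ExistsE.IH) (use ExistsE.prems in auto)
  then show ?case using ExistsE deriv.ExistsE by blast
next
  case (EqE \<Gamma> s t \<phi>)
  then show ?case using deriv.EqE by blast
next
  case Ax
  then show ?case by (simp add: deriv.Ax)
next
  case Hyp
  then show ?case by (auto intro: deriv.Hyp)
next
  case FlsE
  show ?case by (rule deriv.FlsE[OF FlsE.IH]) (use FlsE in blast)+
next
  case ConjI
  show ?case by (rule deriv.ConjI[OF ConjI.IH]) (use ConjI in blast)+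
next
  case ConjE1
  show ?case by (rule deriv.ConjE1[OF ConjE1.IH]) (use ConjE1 in blast)+
next
  case ConjE2
  show ?case by (rule deriv.ConjE2[OF ConjE2.IH]) (use ConjE2 in blast)+
next
  case DisjI1
  show ?case by (rule deriv.DisjI1[OF DisjI1.IH]) (use DisjI1 in blast)+
next
  case DisjI2
  show ?case by (rule deriv.DisjI2[OF DisjI2.IH]) (use DisjI2 in blast)+
next
  case ImpE
  show ?case by (rule deriv.ImpE[OF ImpE.IH]) (use ImpE in blast)+
next
  case ForallE
  show ?case by (rule deriv.ForallE[OF ForallE.IH]) (use ForallE in blast)+
next
  case ExistsI
  show ?case by (rule deriv.ExistsI[OF ExistsI.IH]) (use ExistsI in blast)+
next
  case EqI
  then show ?case by (simp add: deriv.EqI)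
qed

text \<open>The quantifier rules never lift axioms. An \<open>Ax\<close> leaf may therefore be
  replaced, at any depth, by a derivation of the axiom from the empty context, weakened to the
  context of the leaf.\<close>

lemma deriv_cut_axioms:
  assumes "\<And>\<chi>. \<chi> \<in> T \<Longrightarrow> T' \<turnstile> \<chi>"
  shows "deriv T \<Gamma> \<phi> \<Longrightarrow> deriv T' \<Gamma> \<phi>"
proof (induction rule: deriv.induct)
  case (Ax \<phi> \<Gamma>)
  then show ?case using assms deriv_weaken[of T' "[]" \<phi> \<Gamma>] by (simp add: proves_def)
next
  case (EqE \<Gamma> s t \<phi>)
  then show ?case using deriv.EqE by blast
next
  case Hyp
  then show ?case by (rule deriv.Hyp)
next
  case FlsE
  show ?case by (rule deriv.FlsE[OF FlsE.IH]) (fact FlsE.hyps)+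
next
  case ConjI
  show ?case by (rule deriv.ConjI[OF ConjI.IH])
next
  case ConjE1
  show ?case by (rule deriv.ConjE1[OF ConjE1.IH])
next
  case ConjE2
  show ?case by (rule deriv.ConjE2[OF ConjE2.IH])
next
  case DisjI1
  show ?case by (rule deriv.DisjI1[OF DisjI1.IH]) (fact DisjI1.hyps)+
next
  case DisjI2
  show ?case by (rule deriv.DisjI2[OF DisjI2.IH]) (fact DisjI2.hyps)+
next
  case DisjE
  show ?case by (rule deriv.DisjE[OF DisjE.IH])
next
  case ImpI
  show ?case by (rule deriv.ImpI[OF ImpI.IH]) (fact ImpI.hyps)+
next
  case ImpE
  show ?case by (rule deriv.ImpE[OF ImpE.IH])
next
  case ForallI
  show ?case by (rule deriv.ForallI[OF ForallI.IH])
next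
  case ForallE
  show ?case by (rule deriv.ForallE[OF ForallE.IH]) (fact ForallE.hyps)+
next
  case ExistsI
  show ?case by (rule deriv.ExistsI[OF ExistsI.IH]) (fact ExistsI.hyps)+
next
  case ExistsE
  show ?case by (rule deriv.ExistsE[OF ExistsE.IH]) (fact ExistsE.hyps)+
next
  case EqI
  then show ?case by (rule deriv.EqI)
qed

lemma deriv_wf:
  assumes "\<And>\<chi>. \<chi> \<in> T \<Longrightarrow> wf_fm \<chi>"
  shows "deriv T \<Gamma> \<phi> \<Longrightarrow> (\<And>\<chi>. \<chi> \<in> set \<Gamma> \<Longrightarrow> wf_fm \<chi>) \<Longrightarrow> wf_fm \<phi>"
proof (induction rule: deriv.induct)
  case (ForallI \<Gamma> \<phi>)
  have "wf_fm \<phi>" by (rule ForallI.IH) (use ForallI.prems in auto)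
  then show ?case by simp
next
  case (ForallE \<Gamma> \<phi> t)
  then have "wf_fm (Forall \<phi>)" by blast
  then show ?case using ForallE.hyps by simp
next
  case (EqE \<Gamma> s t \<phi>)
  then have "wf_fm (Eq s t)" by blast
  then show ?case using EqE.hyps by simp
qed (use assms in auto)

text \<open>Closure of \<open>T\<close> under substitution takes care of the \<open>Ax\<close>
  leaves. The quantifier rules pass \<open>up \<sigma>\<close> to their premises, which is why
  \<open>\<sigma>\<close> is generalised.\<close>

lemma deriv_subst:
  assumes "\<And>\<chi> \<sigma>. \<chi> \<in> T \<Longrightarrow> (\<And>n. wf_tm (\<sigma> n)) \<Longrightarrow> subst \<sigma> \<chi> \<in> T"
  shows "deriv T \<Gamma> \<phi> \<Longrightarrow> (\<And>n. wf_tm (\<sigma> n)) \<Longrightarrow> deriv T (map (subst \<sigma>) \<Gamma>) (subst \<sigma> \<phi>)"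
proof (induction arbitrary: \<sigma> rule: deriv.induct)
  case (Ax \<phi> \<Gamma>)
  then show ?case using assms by (auto intro: deriv.Ax)
next
  case (FlsE \<Gamma> \<phi>)
  show ?case
    by (rule deriv.FlsE) (use FlsE.IH[of \<sigma>] FlsE.prems FlsE.hyps in \<open>simp_all add: wf_subst\<close>)
next
  case (DisjI1 \<Gamma> \<phi> \<psi>)
  then show ?case by (auto intro!: deriv.DisjI1 wf_subst)
next
  case (DisjI2 \<Gamma> \<psi> \<phi>)
  then show ?case by (auto intro!: deriv.DisjI2 wf_subst)
next
  case (DisjE \<Gamma> \<phi> \<psi> \<chi>)
  show ?case
    by (rule deriv.DisjE[of T _ "subst \<sigma> \<phi>" "subst \<sigma> \<psi>"])
       (use DisjE.IH(1)[of \<sigma>] DisjE.IH(2)[of \<sigma>] DisjE.IH(3)[of \<sigma>] DisjE.prems in simp_all)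
next
  case (ImpI \<phi> \<Gamma> \<psi>)
  then show ?case by (auto intro!: deriv.ImpI wf_subst)
next
  case (ImpE \<Gamma> \<phi> \<psi>)
  then show ?case using deriv.ImpE[of T _ "subst \<sigma> \<phi>"] by simp
next
  case (ForallI \<Gamma> \<phi>)
  have "deriv T (map (subst (up \<sigma>)) (map lift \<Gamma>)) (subst (up \<sigma>) \<phi>)"
    by (rule ForallI.IH) (simp add: ForallI.prems wf_up)
  then show ?case by (auto intro!: deriv.ForallI simp: comp_def subst_up_lift)
next
  case (ForallE \<Gamma> \<phi> t)
  have "deriv T (map (subst \<sigma>) \<Gamma>) (Forall (subst (up \<sigma>) \<phi>))"
    using ForallE.IH[of \<sigma>] ForallE.prems by simp
  from deriv.ForallE[OF this, of "subst_tm \<sigma> t"] show ?case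
    using ForallE.hyps ForallE.prems by (simp add: subst_inst wf_subst_tm)
next
  case (ExistsI \<Gamma> t \<phi>)
  show ?case unfolding subst.simps
    by (rule deriv.ExistsI[of _ _ "subst_tm \<sigma> t"])
       (use ExistsI.IH[of \<sigma>] ExistsI.hyps ExistsI.prems in \<open>simp_all add: subst_inst wf_subst_tm wf_subst wf_up\<close>)
next
  case (ExistsE \<Gamma> \<phi> \<chi>)
  have "deriv T (map (subst (up \<sigma>)) (\<phi> # map lift \<Gamma>)) (subst (up \<sigma>) (lift \<chi>))"
    by (rule ExistsE.IH) (simp add: ExistsE.prems wf_up)
  then have "deriv T (subst (up \<sigma>) \<phi> # map lift (map (subst \<sigma>) \<Gamma>)) (lift (subst \<sigma> \<chi>))"
    by (simp add: comp_def subst_up_lift)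
  moreover have "deriv T (map (subst \<sigma>) \<Gamma>) (Exists (subst (up \<sigma>) \<phi>))"
    using ExistsE.IH(1)[of \<sigma>] ExistsE.prems by simp
  moreover have "wf_fm (subst \<sigma> \<chi>)"
    using ExistsE.hyps ExistsE.prems wf_subst by blast
  ultimately show ?case using deriv.ExistsE by blast
next
  case (EqI t \<Gamma>)
  then show ?case by (auto intro!: deriv.EqI wf_subst_tm)
next
  case (EqE \<Gamma> s t \<phi>)
  show ?case
    unfolding subst_inst
    by (rule deriv.EqE[of T _ "subst_tm \<sigma> s"])
       (use EqE.IH(1)[of \<sigma>] EqE.IH(2)[of \<sigma>] EqE.hyps EqE.prems in \<open>simp_all add: subst_inst wf_subst wf_up\<close>)
next
  case (Hyp \<phi> \<Gamma>)
  then show ?case by (auto intro: deriv.Hyp)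
next
  case (ConjI \<Gamma> \<phi> \<psi>)
  then show ?case by (auto intro: deriv.ConjI)
next
  case (ConjE1 \<Gamma> \<phi> \<psi>)
  then show ?case using deriv.ConjE1 by (metis subst.simps(3))
next
  case (ConjE2 \<Gamma> \<phi> \<psi>)
  then show ?case using deriv.ConjE2 by (metis subst.simps(3))
qed

lemma HA_wf: "\<phi> \<in> HA \<Longrightarrow> wf_fm \<phi>"
proof (induction rule: HA.induct)
  case (Induction \<phi>)
  then show ?case by (auto intro!: wf_subst split: nat.split)
qed auto

lemma HA_subst:
  assumes wf: "\<And>n. wf_tm (\<sigma> n)"
  shows "\<phi> \<in> HA \<Longrightarrow> subst \<sigma> \<phi> \<in> HA"
proof (induction rule: HA.induct)
  case (Proj n i ts)
  then show ?case
    using HA.Proj[of n i "map (subst_tm \<sigma>) ts"] by (auto simp: wf wf_subst_tm)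
next
  case (Comp n f gs ts)
  then show ?case
    using HA.Comp[of n f gs "map (subst_tm \<sigma>) ts"] by (auto simp: wf wf_subst_tm comp_def)
next
  case (Rec_zero f g ts)
  then show ?case
    using HA.Rec_zero[of f g "map (subst_tm \<sigma>) ts"] by (auto simp: wf wf_subst_tm)
next
  case (Rec_succ f g t ts)
  then show ?case
    using HA.Rec_succ[of f g "subst_tm \<sigma> t" "map (subst_tm \<sigma>) ts"] by (auto simp: wf wf_subst_tm)
next
  case (Induction \<phi>)
  let ?S = "case_nat (succ (Var 0)) wk"
  \<comment> \<open>\<open>?S\<close> changes index 0 only. \<open>up \<sigma>\<close> fixes that
    index and keeps it out of the terms put for the other indices, so the two substitutions
    commute.\<close>
  have "subst_tm (up \<sigma>) (?S n) = subst_tm ?S (up \<sigma> n)" for n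
    by (cases n) auto
  then have "subst (up \<sigma>) (subst ?S \<phi>) = subst ?S (subst (up \<sigma>) \<phi>)"
    by simp
  moreover have "wf_fm (subst (up \<sigma>) \<phi>)"
    using Induction by (simp add: wf wf_subst wf_up)
  ultimately show ?case
    using HA.Induction[of "subst (up \<sigma>) \<phi>"] by (simp add: subst_inst del: subst_subst)
next
  case (Succ_not_zero t)
  then show ?case using HA.Succ_not_zero[of "subst_tm \<sigma> t"] by (simp add: wf wf_subst_tm)
next
  case (Succ_inj s t)
  then show ?case
    using HA.Succ_inj[of "subst_tm \<sigma> s" "subst_tm \<sigma> t"] by (simp add: wf wf_subst_tm)
qed

section \<open>The entailment preorder of a theory\<close>

locale arith_theory =
  fixes T :: "fm set"
  assumes HA_sub: "HA \<subseteq> T"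
    and wf_axioms: "\<phi> \<in> T \<Longrightarrow> wf_fm \<phi>"
    and subst_axioms: "\<phi> \<in> T \<Longrightarrow> (\<And>n. wf_tm (\<sigma> n)) \<Longrightarrow> subst \<sigma> \<phi> \<in> T"
begin

text \<open>The Lindenbaum preorder of \<open>T\<close> on open formulas, whose free variables act
  as shared parameters. With \<open>wf_fm\<close> built in, later side conditions can be read off
  from entailments.\<close>

definition le :: "fm \<Rightarrow> fm \<Rightarrow> bool" (infix \<open>\<sqsubseteq>\<close> 50) where
  "\<phi> \<sqsubseteq> \<psi> \<longleftrightarrow> wf_fm \<phi> \<and> wf_fm \<psi> \<and> deriv T [\<phi>] \<psi>"

lemma le_wf: "\<phi> \<sqsubseteq> \<psi> \<Longrightarrow> wf_fm \<phi>" "\<phi> \<sqsubseteq> \<psi> \<Longrightarrow> wf_fm \<psi>"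
  by (auto simp: le_def)

lemma proves_wf: "T \<turnstile> \<phi> \<Longrightarrow> wf_fm \<phi>"
  unfolding proves_def using deriv_wf[of T "[]" \<phi>] wf_axioms by simp

lemma proves_Imp_iff: "T \<turnstile> Imp \<phi> \<psi> \<longleftrightarrow> \<phi> \<sqsubseteq> \<psi>"
proof
  assume a: "T \<turnstile> Imp \<phi> \<psi>"
  have "deriv T [\<phi>] (Imp \<phi> \<psi>)"
    using a deriv_weaken[of T "[]" _ "[\<phi>]"] by (simp add: proves_def)
  then have "deriv T [\<phi>] \<psi>" by (rule deriv.ImpE) (simp add: deriv.Hyp)
  then show "\<phi> \<sqsubseteq> \<psi>" using proves_wf[OF a] by (simp add: le_def)
qed (simp add: le_def proves_def deriv.ImpI)

lemma deriv_le:
  assumes "deriv T \<Gamma> \<phi>" "\<phi> \<sqsubseteq> \<psi>"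
  shows "deriv T \<Gamma> \<psi>"
proof -
  have "T \<turnstile> Imp \<phi> \<psi>" using assms(2) by (simp add: proves_Imp_iff)
  then have "deriv T \<Gamma> (Imp \<phi> \<psi>)" using deriv_weaken[of T "[]" _ \<Gamma>] by (simp add: proves_def)
  then show ?thesis using assms(1) by (rule deriv.ImpE)
qed

lemma le_refl: "wf_fm \<phi> \<Longrightarrow> \<phi> \<sqsubseteq> \<phi>"
  by (simp add: le_def deriv.Hyp)

lemma le_trans [trans]: "\<phi> \<sqsubseteq> \<psi> \<Longrightarrow> \<psi> \<sqsubseteq> \<chi> \<Longrightarrow> \<phi> \<sqsubseteq> \<chi>"
  using deriv_le[of "[\<phi>]" \<psi> \<chi>] by (simp add: le_def)

lemma le_proves: "T \<turnstile> \<psi> \<Longrightarrow> wf_fm \<phi> \<Longrightarrow> \<phi> \<sqsubseteq> \<psi>"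
  using proves_wf[of \<psi>] deriv_weaken[of T "[]" \<psi> "[\<phi>]"] by (simp add: le_def proves_def)

lemma Fls_le: "wf_fm \<phi> \<Longrightarrow> Fls \<sqsubseteq> \<phi>"
  by (simp add: le_def deriv.FlsE deriv.Hyp)

lemma le_Conj_iff: "\<chi> \<sqsubseteq> Conj \<phi> \<psi> \<longleftrightarrow> \<chi> \<sqsubseteq> \<phi> \<and> \<chi> \<sqsubseteq> \<psi>"
  by (auto simp: le_def intro: deriv.ConjI deriv.ConjE1 deriv.ConjE2)

lemma Conj_le: "wf_fm \<phi> \<Longrightarrow> wf_fm \<psi> \<Longrightarrow> Conj \<phi> \<psi> \<sqsubseteq> \<phi>" "wf_fm \<phi> \<Longrightarrow> wf_fm \<psi> \<Longrightarrow> Conj \<phi> \<psi> \<sqsubseteq> \<psi>"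
  using le_refl[of "Conj \<phi> \<psi>"] by (auto simp: le_Conj_iff)

lemma le_Imp_iff: "\<chi> \<sqsubseteq> Imp \<phi> \<psi> \<longleftrightarrow> Conj \<chi> \<phi> \<sqsubseteq> \<psi>"
proof
  assume a: "\<chi> \<sqsubseteq> Imp \<phi> \<psi>"
  then have wf: "wf_fm \<chi>" "wf_fm \<phi>" "wf_fm \<psi>" by (auto simp: le_def)
  have "Conj \<chi> \<phi> \<sqsubseteq> Imp \<phi> \<psi>" using le_trans[OF Conj_le(1) a] wf by simp
  then have "deriv T [Conj \<chi> \<phi>] (Imp \<phi> \<psi>)" by (simp add: le_def)
  moreover have "deriv T [Conj \<chi> \<phi>] \<phi>" using Conj_le(2)[of \<chi> \<phi>] wf by (simp add: le_def)
  ultimately show "Conj \<chi> \<phi> \<sqsubseteq> \<psi>" using wf deriv.ImpE[of T _ \<phi>] by (simp add: le_def)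
next
  assume a: "Conj \<chi> \<phi> \<sqsubseteq> \<psi>"
  have "deriv T [\<phi>, \<chi>] (Conj \<chi> \<phi>)" by (simp add: deriv.ConjI deriv.Hyp)
  from deriv_le[OF this a] have "deriv T [\<chi>] (Imp \<phi> \<psi>)"
    using le_wf(1)[OF a] by (simp add: deriv.ImpI)
  then show "\<chi> \<sqsubseteq> Imp \<phi> \<psi>" using le_wf[OF a] by (simp add: le_def)
qed

lemma Disj_le_iff: "Disj \<phi> \<psi> \<sqsubseteq> \<chi> \<longleftrightarrow> \<phi> \<sqsubseteq> \<chi> \<and> \<psi> \<sqsubseteq> \<chi>"
proof
  assume a: "Disj \<phi> \<psi> \<sqsubseteq> \<chi>"
  have "deriv T [\<phi>] (Disj \<phi> \<psi>)" "deriv T [\<psi>] (Disj \<phi> \<psi>)"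
    using le_wf[OF a] by (simp_all add: deriv.DisjI1 deriv.DisjI2 deriv.Hyp)
  then show "\<phi> \<sqsubseteq> \<chi> \<and> \<psi> \<sqsubseteq> \<chi>" using le_wf[OF a] deriv_le[OF _ a] by (simp add: le_def)
next
  assume a: "\<phi> \<sqsubseteq> \<chi> \<and> \<psi> \<sqsubseteq> \<chi>"
  have "deriv T [Disj \<phi> \<psi>] \<chi>"
  proof (rule deriv.DisjE[of T _ \<phi> \<psi>])
    show "deriv T [\<phi>, Disj \<phi> \<psi>] \<chi>" "deriv T [\<psi>, Disj \<phi> \<psi>] \<chi>"
      using a deriv_le[of _ \<phi> \<chi>] deriv_le[of _ \<psi> \<chi>] by (simp_all add: deriv.Hyp)
  qed (simp add: deriv.Hyp)
  then show "Disj \<phi> \<psi> \<sqsubseteq> \<chi>" using a by (simp add: le_def)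
qed

lemma le_Disj: "wf_fm \<phi> \<Longrightarrow> wf_fm \<psi> \<Longrightarrow> \<phi> \<sqsubseteq> Disj \<phi> \<psi>" "wf_fm \<phi> \<Longrightarrow> wf_fm \<psi> \<Longrightarrow> \<psi> \<sqsubseteq> Disj \<phi> \<psi>"
  using le_refl[of "Disj \<phi> \<psi>"] by (auto simp: Disj_le_iff)

lemma le_subst: "\<phi> \<sqsubseteq> \<psi> \<Longrightarrow> (\<And>n. wf_tm (\<sigma> n)) \<Longrightarrow> subst \<sigma> \<phi> \<sqsubseteq> subst \<sigma> \<psi>"
  using deriv_subst[of T "[\<phi>]" \<psi> \<sigma>] subst_axioms by (auto simp: le_def wf_subst)

lemma proves_subst: "T \<turnstile> \<phi> \<Longrightarrow> (\<And>n. wf_tm (\<sigma> n)) \<Longrightarrow> T \<turnstile> subst \<sigma> \<phi>"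
  using deriv_subst[of T "[]" \<phi> \<sigma>] subst_axioms by (auto simp: proves_def)

lemma le_lift: "\<phi> \<sqsubseteq> \<psi> \<Longrightarrow> lift \<phi> \<sqsubseteq> lift \<psi>"
  by (simp add: lift_def le_subst)

lemma le_inst: "\<phi> \<sqsubseteq> \<psi> \<Longrightarrow> wf_tm t \<Longrightarrow> inst t \<phi> \<sqsubseteq> inst t \<psi>"
  unfolding inst_def by (rule le_subst) (auto split: nat.split)

text \<open>Lifting frees index 0, so that the instance at \<open>Var 0\<close> is the body itself.
  This and \<open>le_lift_Exists\<close> are the counit and unit of the adjunctions that put
  \<open>Exists\<close> to the left and \<open>Forall\<close> to the right of
  \<open>lift\<close>.\<close>

lemma lift_Forall_le: "wf_fm \<phi> \<Longrightarrow> lift (Forall \<phi>) \<sqsubseteq> \<phi>"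
proof -
  assume wf: "wf_fm \<phi>"
  have "deriv T [lift (Forall \<phi>)] (Forall (subst (up wk) \<phi>))" by (simp add: deriv.Hyp lift_def)
  from deriv.ForallE[OF this, of "Var 0"] show ?thesis
    using wf wf_lift[of "Forall \<phi>"] by (simp add: le_def)
qed

lemma le_lift_Exists: "wf_fm \<phi> \<Longrightarrow> \<phi> \<sqsubseteq> lift (Exists \<phi>)"
proof -
  assume wf: "wf_fm \<phi>"
  then have "wf_fm (subst (up wk) \<phi>)" using wf_lift[of "Exists \<phi>"] by (simp add: lift_def)
  then have "deriv T [\<phi>] (Exists (subst (up wk) \<phi>))"
    by (intro deriv.ExistsI[of _ _ "Var 0"]) (simp_all add: deriv.Hyp)
  then show ?thesis using wf wf_lift[of "Exists \<phi>"] by (simp add: le_def lift_def)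
qed

lemma le_Forall_iff: "wf_fm \<phi> \<Longrightarrow> \<phi> \<sqsubseteq> Forall \<psi> \<longleftrightarrow> lift \<phi> \<sqsubseteq> \<psi>"
proof
  assume a: "\<phi> \<sqsubseteq> Forall \<psi>"
  show "lift \<phi> \<sqsubseteq> \<psi>" using le_trans[OF le_lift[OF a] lift_Forall_le] le_wf[OF a] by simp
qed (auto simp: le_def intro: deriv.ForallI)

lemma Exists_le_iff: "wf_fm \<psi> \<Longrightarrow> Exists \<phi> \<sqsubseteq> \<psi> \<longleftrightarrow> \<phi> \<sqsubseteq> lift \<psi>"
proof
  assume a: "Exists \<phi> \<sqsubseteq> \<psi>"
  show "\<phi> \<sqsubseteq> lift \<psi>" using le_trans[OF le_lift_Exists le_lift[OF a]] le_wf[OF a] by simp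
next
  assume wf: "wf_fm \<psi>" and a: "\<phi> \<sqsubseteq> lift \<psi>"
  have "deriv T (\<phi> # map lift [Exists \<phi>]) (lift \<psi>)"
    using deriv_le[OF _ a] by (simp add: deriv.Hyp)
  moreover have "deriv T [Exists \<phi>] (Exists \<phi>)" by (simp add: deriv.Hyp)
  ultimately have "deriv T [Exists \<phi>] \<psi>" using wf deriv.ExistsE by blast
  then show "Exists \<phi> \<sqsubseteq> \<psi>" using wf le_wf[OF a] by (simp add: le_def)
qed

lemma inst_le_Exists: "wf_tm t \<Longrightarrow> wf_fm \<phi> \<Longrightarrow> inst t \<phi> \<sqsubseteq> Exists \<phi>"
  using le_inst[OF le_lift_Exists, of \<phi> t] by simp

text \<open>Reading \<open>\<chi> \<sqsubseteq> \<phi>\<close> as ``the world \<open>\<chi>\<close> forces \<open>\<phi>\<close>'' turns propositional entailments into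
  first-order statements in the style of Kripke semantics.\<close>

lemma le_ImpI:
  assumes "wf_fm \<chi>" "wf_fm \<phi>" "\<And>\<omega>. \<omega> \<sqsubseteq> \<chi> \<Longrightarrow> \<omega> \<sqsubseteq> \<phi> \<Longrightarrow> \<omega> \<sqsubseteq> \<psi>"
  shows "\<chi> \<sqsubseteq> Imp \<phi> \<psi>"
  unfolding le_Imp_iff using assms Conj_le by blast

lemma le_ImpE: "\<chi> \<sqsubseteq> Imp \<phi> \<psi> \<Longrightarrow> \<chi> \<sqsubseteq> \<phi> \<Longrightarrow> \<chi> \<sqsubseteq> \<psi>"
  unfolding le_Imp_iff by (meson le_Conj_iff le_refl le_trans le_wf)

text \<open>A world that forces a disjunction need not force a disjunct, so cases are available only
  towards a goal \<open>\<rho>\<close>. Both disjuncts entail \<open>Imp \<chi> \<rho>\<close>,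
  hence so does \<open>\<chi>\<close>, which then discharges the premise.\<close>

lemma le_DisjE:
  assumes "\<chi> \<sqsubseteq> Disj \<phi> \<psi>" "wf_fm \<rho>"
    "\<And>\<omega>. \<omega> \<sqsubseteq> \<chi> \<Longrightarrow> \<omega> \<sqsubseteq> \<phi> \<Longrightarrow> \<omega> \<sqsubseteq> \<rho>" "\<And>\<omega>. \<omega> \<sqsubseteq> \<chi> \<Longrightarrow> \<omega> \<sqsubseteq> \<psi> \<Longrightarrow> \<omega> \<sqsubseteq> \<rho>"
  shows "\<chi> \<sqsubseteq> \<rho>"
proof -
  have wf: "wf_fm \<chi>" "wf_fm \<phi>" "wf_fm \<psi>" using le_wf[OF assms(1)] by auto
  have "\<phi> \<sqsubseteq> Imp \<chi> \<rho>" "\<psi> \<sqsubseteq> Imp \<chi> \<rho>"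
    using wf assms(3,4) by (auto intro!: le_ImpI)
  then have "\<chi> \<sqsubseteq> Imp \<chi> \<rho>" using assms(1) le_trans by (auto simp: Disj_le_iff)
  then show ?thesis using le_ImpE le_refl wf by blast
qed

text \<open>Negation is adjoint to itself; contraposition laws and \<open>le_NegNeg\<close> are read
  off from this.\<close>

lemma le_Neg_flip: "\<phi> \<sqsubseteq> Neg \<psi> \<Longrightarrow> \<psi> \<sqsubseteq> Neg \<phi>"
  by (rule le_ImpI) (auto dest: le_wf intro: le_ImpE le_trans)

lemma Neg_antimono: "\<phi> \<sqsubseteq> \<psi> \<Longrightarrow> Neg \<psi> \<sqsubseteq> Neg \<phi>"
  by (rule le_ImpI) (auto dest: le_wf intro: le_ImpE le_trans)

lemma le_NegNeg: "wf_fm \<phi> \<Longrightarrow> \<phi> \<sqsubseteq> Neg (Neg \<phi>)"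
  by (rule le_Neg_flip) (simp add: le_refl)

definition eqv :: "fm \<Rightarrow> fm \<Rightarrow> bool" (infix \<open>\<approx>\<close> 50) where
  "\<phi> \<approx> \<psi> \<longleftrightarrow> \<phi> \<sqsubseteq> \<psi> \<and> \<psi> \<sqsubseteq> \<phi>"

lemma proves_Iff: "T \<turnstile> Iff \<phi> \<psi> \<longleftrightarrow> \<phi> \<approx> \<psi>"
proof -
  have "T \<turnstile> Iff \<phi> \<psi> \<longleftrightarrow> T \<turnstile> Imp \<phi> \<psi> \<and> T \<turnstile> Imp \<psi> \<phi>"
    unfolding proves_def by (blast intro: deriv.ConjI deriv.ConjE1 deriv.ConjE2)
  then show ?thesis by (simp add: proves_Imp_iff eqv_def)
qed

lemma eqv_refl: "wf_fm \<phi> \<Longrightarrow> \<phi> \<approx> \<phi>"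
  by (simp add: eqv_def le_refl)

lemma eqv_trans [trans]: "\<phi> \<approx> \<psi> \<Longrightarrow> \<psi> \<approx> \<chi> \<Longrightarrow> \<phi> \<approx> \<chi>"
  using le_trans by (auto simp: eqv_def)

lemma Conj_mono: "\<phi> \<sqsubseteq> \<phi>' \<Longrightarrow> \<psi> \<sqsubseteq> \<psi>' \<Longrightarrow> Conj \<phi> \<psi> \<sqsubseteq> Conj \<phi>' \<psi>'"
  by (meson le_Conj_iff Conj_le le_trans le_wf)

lemma Disj_mono: "\<phi> \<sqsubseteq> \<phi>' \<Longrightarrow> \<psi> \<sqsubseteq> \<psi>' \<Longrightarrow> Disj \<phi> \<psi> \<sqsubseteq> Disj \<phi>' \<psi>'"
  by (meson Disj_le_iff le_Disj le_trans le_wf)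

lemma Imp_mono: "\<phi>' \<sqsubseteq> \<phi> \<Longrightarrow> \<psi> \<sqsubseteq> \<psi>' \<Longrightarrow> Imp \<phi> \<psi> \<sqsubseteq> Imp \<phi>' \<psi>'"
  by (rule le_ImpI) (auto dest: le_wf, meson le_ImpE le_trans)

lemma Forall_mono: "\<phi> \<sqsubseteq> \<psi> \<Longrightarrow> Forall \<phi> \<sqsubseteq> Forall \<psi>"
  using le_trans[OF lift_Forall_le] le_wf by (subst le_Forall_iff) auto

lemma Exists_mono: "\<phi> \<sqsubseteq> \<psi> \<Longrightarrow> Exists \<phi> \<sqsubseteq> Exists \<psi>"
  using le_trans[OF _ le_lift_Exists] le_wf by (subst Exists_le_iff) auto

lemma eqv_cong:
  "\<phi> \<approx> \<phi>' \<Longrightarrow> \<psi> \<approx> \<psi>' \<Longrightarrow> Conj \<phi> \<psi> \<approx> Conj \<phi>' \<psi>'"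
  "\<phi> \<approx> \<phi>' \<Longrightarrow> \<psi> \<approx> \<psi>' \<Longrightarrow> Disj \<phi> \<psi> \<approx> Disj \<phi>' \<psi>'"
  "\<phi> \<approx> \<phi>' \<Longrightarrow> \<psi> \<approx> \<psi>' \<Longrightarrow> Imp \<phi> \<psi> \<approx> Imp \<phi>' \<psi>'"
  "\<phi> \<approx> \<phi>' \<Longrightarrow> Forall \<phi> \<approx> Forall \<phi>'"
  "\<phi> \<approx> \<phi>' \<Longrightarrow> Exists \<phi> \<approx> Exists \<phi>'"
  by (simp_all add: eqv_def Conj_mono Disj_mono Imp_mono Forall_mono Exists_mono)

section \<open>Classical equivalence and stability\<close>

text \<open>\<open>\<phi> \<sim> \<psi>\<close> says that \<open>\<phi>\<close> and \<open>\<psi>\<close> have equivalent negations.\<close>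

definition wle :: "fm \<Rightarrow> fm \<Rightarrow> bool" (infix \<open>\<lesssim>\<close> 50) where
  "\<phi> \<lesssim> \<psi> \<longleftrightarrow> \<phi> \<sqsubseteq> Neg (Neg \<psi>)"

definition weqv :: "fm \<Rightarrow> fm \<Rightarrow> bool" (infix \<open>\<sim>\<close> 50) where
  "\<phi> \<sim> \<psi> \<longleftrightarrow> \<phi> \<lesssim> \<psi> \<and> \<psi> \<lesssim> \<phi>"

definition stable :: "fm \<Rightarrow> bool" where
  "stable \<phi> \<longleftrightarrow> Neg (Neg \<phi>) \<sqsubseteq> \<phi>"

lemma wle_wf: "\<phi> \<lesssim> \<psi> \<Longrightarrow> wf_fm \<phi>" "\<phi> \<lesssim> \<psi> \<Longrightarrow> wf_fm \<psi>"
  by (auto simp: wle_def dest: le_wf)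

lemma stable_wf: "stable \<phi> \<Longrightarrow> wf_fm \<phi>"
  by (auto simp: stable_def dest: le_wf)

lemma le_imp_wle: "\<phi> \<sqsubseteq> \<psi> \<Longrightarrow> \<phi> \<lesssim> \<psi>"
  unfolding wle_def using le_trans le_NegNeg le_wf by blast

text \<open>Links the definition by double negation to the reading by negations; transitivity is
  then immediate.\<close>

lemma wle_iff_Neg: "\<phi> \<lesssim> \<psi> \<longleftrightarrow> Neg \<psi> \<sqsubseteq> Neg \<phi>"
  unfolding wle_def using le_Neg_flip by blast

lemma wle_trans: "\<phi> \<lesssim> \<psi> \<Longrightarrow> \<psi> \<lesssim> \<chi> \<Longrightarrow> \<phi> \<lesssim> \<chi>"
  unfolding wle_iff_Neg using le_trans by blast

lemma wle_stable: "\<phi> \<lesssim> \<psi> \<Longrightarrow> stable \<psi> \<Longrightarrow> \<phi> \<sqsubseteq> \<psi>"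
  unfolding wle_def stable_def by (rule le_trans)

lemma eqv_imp_weqv: "\<phi> \<approx> \<psi> \<Longrightarrow> \<phi> \<sim> \<psi>"
  by (simp add: eqv_def weqv_def le_imp_wle)

lemma weqv_stable: "\<phi> \<sim> \<psi> \<Longrightarrow> stable \<phi> \<Longrightarrow> stable \<psi> \<Longrightarrow> \<phi> \<approx> \<psi>"
  by (simp add: eqv_def weqv_def wle_stable)

lemma weqv_refl: "wf_fm \<phi> \<Longrightarrow> \<phi> \<sim> \<phi>"
  by (simp add: eqv_imp_weqv eqv_refl)

lemma weqv_sym: "\<phi> \<sim> \<psi> \<Longrightarrow> \<psi> \<sim> \<phi>"
  by (simp add: weqv_def)

lemma weqv_trans [trans]: "\<phi> \<sim> \<psi> \<Longrightarrow> \<psi> \<sim> \<chi> \<Longrightarrow> \<phi> \<sim> \<chi>"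
  using wle_trans by (auto simp: weqv_def)

lemma stable_eqv: "\<phi> \<approx> \<psi> \<Longrightarrow> stable \<psi> \<Longrightarrow> stable \<phi>"
  unfolding eqv_def stable_def by (meson Neg_antimono le_trans)

lemma le_NegI: "wf_fm \<chi> \<Longrightarrow> wf_fm \<phi> \<Longrightarrow> (\<And>\<omega>. \<omega> \<sqsubseteq> \<chi> \<Longrightarrow> \<omega> \<sqsubseteq> \<phi> \<Longrightarrow> \<omega> \<sqsubseteq> Fls) \<Longrightarrow> \<chi> \<sqsubseteq> Neg \<phi>"
  by (rule le_ImpI)

lemma wleI: "wf_fm \<phi> \<Longrightarrow> wf_fm \<psi> \<Longrightarrow> (\<And>\<omega>. \<omega> \<sqsubseteq> \<phi> \<Longrightarrow> \<omega> \<sqsubseteq> Neg \<psi> \<Longrightarrow> \<omega> \<sqsubseteq> Fls) \<Longrightarrow> \<phi> \<lesssim> \<psi>"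
  unfolding wle_def by (rule le_ImpI) auto

text \<open>When the goal is \<open>Fls\<close>, a formula known only up to double negation may be
  used as if it held outright.\<close>

lemma wleE:
  assumes "\<phi> \<lesssim> \<psi>" "\<chi> \<sqsubseteq> \<phi>" "\<And>\<omega>. \<omega> \<sqsubseteq> \<chi> \<Longrightarrow> \<omega> \<sqsubseteq> \<psi> \<Longrightarrow> \<omega> \<sqsubseteq> Fls"
  shows "\<chi> \<sqsubseteq> Fls"
proof (rule le_ImpE)
  show "\<chi> \<sqsubseteq> Neg (Neg \<psi>)" using assms(1,2) le_trans by (auto simp: wle_def)
  show "\<chi> \<sqsubseteq> Neg \<psi>" using assms by (blast intro: le_NegI dest: le_wf wle_wf)
qed

text \<open>A doubly negated implication still turns its premise into the doubly negated conclusion,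
  so stability is a matter of the conclusion alone.\<close>

lemma stable_Imp:
  assumes "stable \<psi>" "wf_fm \<phi>"
  shows "stable (Imp \<phi> \<psi>)"
proof -
  have wf: "wf_fm \<psi>" using assms stable_wf by blast
  have "Neg (Neg (Imp \<phi> \<psi>)) \<sqsubseteq> Imp \<phi> (Neg (Neg \<psi>))"
  proof (intro le_ImpI)
    fix \<chi> \<omega>
    assume \<chi>: "\<chi> \<sqsubseteq> Neg (Neg (Imp \<phi> \<psi>))" "\<chi> \<sqsubseteq> \<phi>" and \<omega>: "\<omega> \<sqsubseteq> \<chi>" "\<omega> \<sqsubseteq> Neg \<psi>"
    have "\<omega> \<sqsubseteq> Neg (Imp \<phi> \<psi>)"
    proof (rule le_NegI)
      fix \<nu> assume "\<nu> \<sqsubseteq> \<omega>" "\<nu> \<sqsubseteq> Imp \<phi> \<psi>"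
      then show "\<nu> \<sqsubseteq> Fls" using \<chi> \<omega> by (meson le_ImpE le_trans)
    qed (use assms \<omega> wf le_wf in auto)
    then show "\<omega> \<sqsubseteq> Fls" using \<chi> \<omega> by (meson le_ImpE le_trans)
  qed (use assms wf le_wf in auto)
  also have "\<dots> \<sqsubseteq> Imp \<phi> \<psi>"
    using assms by (auto simp: stable_def intro: Imp_mono le_refl)
  finally show ?thesis by (simp add: stable_def)
qed

lemma stable_Neg: "wf_fm \<phi> \<Longrightarrow> stable (Neg \<phi>)"
proof (rule stable_Imp)
  show "stable Fls"
    unfolding stable_def by (rule le_ImpE[of _ "Neg Fls"]) (auto intro!: le_refl le_ImpI)
qed

lemma stable_Forall: "stable \<phi> \<Longrightarrow> stable (Forall \<phi>)"
proof -
  assume s: "stable \<phi>"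
  have "lift (Neg (Neg (Forall \<phi>))) \<sqsubseteq> Neg (Neg \<phi>)"
    using lift_Forall_le[of \<phi>] stable_wf[OF s] by (simp add: Neg_antimono)
  also have "\<dots> \<sqsubseteq> \<phi>" using s by (simp add: stable_def)
  finally show ?thesis using stable_wf[OF s] by (simp add: stable_def le_Forall_iff)
qed

lemma wle_Conj:
  assumes "\<phi> \<lesssim> \<phi>'" "\<psi> \<lesssim> \<psi>'"
  shows "Conj \<phi> \<psi> \<lesssim> Conj \<phi>' \<psi>'"
proof (rule wleI)
  fix \<chi> assume \<chi>: "\<chi> \<sqsubseteq> Conj \<phi> \<psi>" "\<chi> \<sqsubseteq> Neg (Conj \<phi>' \<psi>')"
  show "\<chi> \<sqsubseteq> Fls"
  proof (rule wleE[OF assms(1)])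
    fix \<omega> assume \<omega>: "\<omega> \<sqsubseteq> \<chi>" "\<omega> \<sqsubseteq> \<phi>'"
    show "\<omega> \<sqsubseteq> Fls"
    proof (rule wleE[OF assms(2)])
      fix \<nu> assume "\<nu> \<sqsubseteq> \<omega>" "\<nu> \<sqsubseteq> \<psi>'"
      then show "\<nu> \<sqsubseteq> Fls" using \<chi> \<omega> by (meson le_ImpE le_trans le_Conj_iff)
    qed (use \<chi> \<omega> le_trans in \<open>auto simp: le_Conj_iff\<close>)
  qed (use \<chi> in \<open>auto simp: le_Conj_iff\<close>)
qed (use assms wle_wf in auto)

lemma wle_Disj:
  assumes "\<phi> \<lesssim> \<phi>'" "\<psi> \<lesssim> \<psi>'"
  shows "Disj \<phi> \<psi> \<lesssim> Disj \<phi>' \<psi>'"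
proof -
  have "wf_fm \<phi>'" "wf_fm \<psi>'" using assms wle_wf by auto
  then have "\<phi>' \<lesssim> Disj \<phi>' \<psi>'" "\<psi>' \<lesssim> Disj \<phi>' \<psi>'" using le_Disj le_imp_wle by auto
  then show ?thesis using assms wle_trans unfolding wle_def[of "Disj \<phi> \<psi>"]
    by (simp add: Disj_le_iff) (meson wle_def)
qed

lemma wle_Imp:
  assumes "\<phi>' \<lesssim> \<phi>" "\<psi> \<lesssim> \<psi>'"
  shows "Imp \<phi> \<psi> \<lesssim> Imp \<phi>' \<psi>'"
proof (rule wleI)
  note wf = wle_wf[OF assms(1)] wle_wf[OF assms(2)]
  fix \<chi> assume \<chi>: "\<chi> \<sqsubseteq> Imp \<phi> \<psi>" "\<chi> \<sqsubseteq> Neg (Imp \<phi>' \<psi>')"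
  \<comment> \<open>A world below \<open>\<chi>\<close> that forces \<open>\<phi>'\<close> is
    inconsistent: up to double negation it has \<open>\<phi>\<close>, hence \<open>\<psi>\<close>,
    hence \<open>\<psi>'\<close>, hence the refuted implication. So the implication holds
    vacuously.\<close>
  have "\<chi> \<sqsubseteq> Imp \<phi>' \<psi>'"
  proof (rule le_ImpI)
    fix \<omega> assume \<omega>: "\<omega> \<sqsubseteq> \<chi>" "\<omega> \<sqsubseteq> \<phi>'"
    have "\<omega> \<sqsubseteq> Fls"
    proof (rule wleE[OF assms(1) \<omega>(2)])
      fix \<nu> assume \<nu>: "\<nu> \<sqsubseteq> \<omega>" "\<nu> \<sqsubseteq> \<phi>"
      have "\<nu> \<sqsubseteq> \<psi>" using \<nu> \<omega> \<chi> by (meson le_ImpE le_trans)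
      then show "\<nu> \<sqsubseteq> Fls"
      proof (rule wleE[OF assms(2)])
        fix \<mu> assume \<mu>: "\<mu> \<sqsubseteq> \<nu>" "\<mu> \<sqsubseteq> \<psi>'"
        have "\<mu> \<sqsubseteq> Imp \<phi>' \<psi>'" using \<mu>(2) wf le_wf(1)[OF \<mu>(1)] le_trans by (blast intro: le_ImpI)
        then show "\<mu> \<sqsubseteq> Fls" using \<mu> \<nu> \<omega> \<chi> by (meson le_ImpE le_trans)
      qed
    qed
    then show "\<omega> \<sqsubseteq> \<psi>'" using Fls_le le_trans wf by blast
  qed (use wf \<chi> le_wf in auto)
  then show "\<chi> \<sqsubseteq> Fls" using \<chi> le_ImpE by blast
qed (use assms wle_wf in auto)

text \<open>The doubly negated goal does not depend on the witness, so each witness may be treated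
  separately. For \<open>Forall\<close> the analogous step is a double negation shift.\<close>

lemma wle_Exists: "\<phi> \<lesssim> \<psi> \<Longrightarrow> Exists \<phi> \<lesssim> Exists \<psi>"
proof -
  assume a: "\<phi> \<lesssim> \<psi>"
  then have "wf_fm \<psi>" using wle_wf by auto
  then have "\<psi> \<lesssim> lift (Exists \<psi>)" using le_lift_Exists le_imp_wle by blast
  with a have "\<phi> \<lesssim> lift (Exists \<psi>)" by (rule wle_trans)
  then show ?thesis using \<open>wf_fm \<psi>\<close> by (simp add: wle_def Exists_le_iff)
qed

lemma weqv_cong:
  "\<phi> \<sim> \<phi>' \<Longrightarrow> \<psi> \<sim> \<psi>' \<Longrightarrow> Conj \<phi> \<psi> \<sim> Conj \<phi>' \<psi>'"
  "\<phi> \<sim> \<phi>' \<Longrightarrow> \<psi> \<sim> \<psi>' \<Longrightarrow> Disj \<phi> \<psi> \<sim> Disj \<phi>' \<psi>'"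
  "\<phi> \<sim> \<phi>' \<Longrightarrow> \<psi> \<sim> \<psi>' \<Longrightarrow> Imp \<phi> \<psi> \<sim> Imp \<phi>' \<psi>'"
  "\<phi> \<sim> \<phi>' \<Longrightarrow> Exists \<phi> \<sim> Exists \<phi>'"
  by (simp_all add: weqv_def wle_Conj wle_Disj wle_Imp wle_Exists)

lemma weqv_Neg: "\<phi> \<sim> \<phi>' \<Longrightarrow> Neg \<phi> \<sim> Neg \<phi>'"
  by (rule weqv_cong(3)) (simp_all add: weqv_refl)

text \<open>With \<open>Imp_weqv\<close> this reduces closure under disjunction and implication, up
  to \<open>\<sim>\<close>, to closure under conjunction and negation.\<close>

lemma Disj_weqv:
  assumes "wf_fm \<phi>" "wf_fm \<psi>"
  shows "Disj \<phi> \<psi> \<sim> Neg (Conj (Neg \<phi>) (Neg \<psi>))"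
proof -
  have "Neg (Disj \<phi> \<psi>) \<sqsubseteq> Conj (Neg \<phi>) (Neg \<psi>)"
    using assms le_Disj Neg_antimono by (auto simp: le_Conj_iff)
  then have 1: "Neg (Conj (Neg \<phi>) (Neg \<psi>)) \<lesssim> Disj \<phi> \<psi>"
    by (simp add: wle_def Neg_antimono)
  have "Disj \<phi> \<psi> \<sqsubseteq> Neg (Conj (Neg \<phi>) (Neg \<psi>))"
    unfolding Disj_le_iff using assms Conj_le[of "Neg \<phi>" "Neg \<psi>"] le_Neg_flip by simp
  with 1 show ?thesis by (simp add: weqv_def le_imp_wle)
qed

lemma Imp_weqv:
  assumes "wf_fm \<phi>" "wf_fm \<psi>"
  shows "Imp \<phi> \<psi> \<sim> Neg (Conj \<phi> (Neg \<psi>))"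
proof -
  have nn: "Neg (Neg \<psi>) \<sim> \<psi>"
    using assms le_refl le_trans[OF le_NegNeg le_NegNeg] by (simp add: weqv_def wle_def)
  have "Neg (Conj \<phi> (Neg \<psi>)) \<approx> Imp \<phi> (Neg (Neg \<psi>))"
    unfolding eqv_def
  proof (intro conjI le_ImpI)
    fix \<chi> \<omega> assume "\<chi> \<sqsubseteq> Neg (Conj \<phi> (Neg \<psi>))" "\<chi> \<sqsubseteq> \<phi>" "\<omega> \<sqsubseteq> \<chi>" "\<omega> \<sqsubseteq> Neg \<psi>"
    then show "\<omega> \<sqsubseteq> Fls" by (meson le_ImpE le_trans le_Conj_iff)
  next
    fix \<chi> assume "\<chi> \<sqsubseteq> Imp \<phi> (Neg (Neg \<psi>))" "\<chi> \<sqsubseteq> Conj \<phi> (Neg \<psi>)"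
    then show "\<chi> \<sqsubseteq> Fls" by (meson le_ImpE le_Conj_iff)
  qed (use assms le_wf in auto)
  then have "Neg (Conj \<phi> (Neg \<psi>)) \<sim> Imp \<phi> (Neg (Neg \<psi>))" by (rule eqv_imp_weqv)
  also have "\<dots> \<sim> Imp \<phi> \<psi>" using assms nn weqv_refl by (blast intro: weqv_cong)
  finally show ?thesis by (rule weqv_sym)
qed

end

section \<open>A primitive recursive pairing function\<close>

definition "add_sym = Rec (Proj 1 0) (Comp 3 Succ [Proj 3 1])"
definition "double_sym = Rec Zero (Comp 2 Succ [Comp 2 Succ [Proj 2 1]])"
definition "iszero_sym = Rec (Comp 0 Succ [Zero]) (Comp 2 Zero [])"
definition "parity_sym = Rec Zero (Comp 2 iszero_sym [Proj 2 1])"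
text \<open>\<open>incr_sym\<close> applied to \<open>b\<close> and \<open>x\<close> is \<open>x\<close> if \<open>b = 0\<close> and \<open>x + 1\<close> otherwise.\<close>
definition "incr_sym = Rec (Proj 1 0) (Comp 3 Succ [Proj 3 2])"
definition "half_sym = Rec Zero (Comp 2 incr_sym [Comp 2 parity_sym [Proj 2 0], Proj 2 1])"
definition "pred_sym = Rec Zero (Proj 2 0)"
text \<open>\<open>cond_sym\<close> applied to \<open>b\<close>, \<open>x\<close> and \<open>y\<close> is \<open>y\<close> if \<open>b = 0\<close> and \<open>x\<close> otherwise.\<close>
definition "cond_sym = Rec (Proj 2 1) (Proj 4 2)"
text \<open>\<open>step_sym\<close> fixes the odd numbers and sends \<open>2 * n + 2\<close> to \<open>n\<close>; the pair \<open>(x, y)\<close> is coded by the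
  number from which \<open>x\<close> steps lead to \<open>2 * y + 1\<close>.\<close>
definition "step_sym = Comp 1 cond_sym [parity_sym, Proj 1 0, Comp 1 pred_sym [half_sym]]"
definition "iter_sym = Rec (Proj 1 0) (Comp 3 step_sym [Proj 3 1])"
text \<open>Counts the steps that start at an even number. On the orbit of a code these are exactly
  the moves made before an odd number is reached, so the count recovers the first component.\<close>

definition "count_sym = Rec (Comp 1 Zero []) (Comp 3 incr_sym
  [Comp 3 iszero_sym [Comp 3 parity_sym [Comp 3 iter_sym [Proj 3 0, Proj 3 2]]], Proj 3 1])"
text \<open>In closed form \<open>2^x * (2 * y + 3) - 2\<close>: the code of (0, y) is 2y + 1, and
  raising x by one sends c to 2c + 2, which is what one application of \<open>step_sym\<close>
  undoes.\<close>

definition "pair_sym = Rec (Comp 1 Succ [double_sym]) (Comp 3 Succ [Comp 3 Succ [Comp 3 double_sym [Proj 3 1]]])"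
text \<open>\<open>excess_sym\<close> is the difference of a pair and its first component, so that a code bounds the
  number of steps needed to decode it.\<close>
definition "excess_sym = Rec (Comp 1 Succ [double_sym])
  (Comp 3 Succ [Comp 3 add_sym [Proj 3 1, Comp 3 pair_sym [Proj 3 0, Proj 3 2]]])"
definition "fst_sym = Comp 1 count_sym [Proj 1 0, Proj 1 0]"
definition "snd_sym = Comp 1 half_sym [Comp 1 iter_sym [Proj 1 0, Proj 1 0]]"

lemmas sym_defs = add_sym_def double_sym_def iszero_sym_def parity_sym_def incr_sym_def half_sym_def
  pred_sym_def cond_sym_def step_sym_def iter_sym_def count_sym_def pair_sym_def excess_sym_def
  fst_sym_def snd_sym_def

lemma arity_syms [simp]:
  "arity add_sym = 2" "arity double_sym = 1" "arity iszero_sym = 1" "arity parity_sym = 1"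
  "arity incr_sym = 2" "arity half_sym = 1" "arity pred_sym = 1" "arity cond_sym = 3"
  "arity step_sym = 1" "arity iter_sym = 2" "arity count_sym = 2" "arity pair_sym = 2"
  "arity excess_sym = 2" "arity fst_sym = 1" "arity snd_sym = 1"
  by (simp_all add: sym_defs)

lemma wf_syms [simp]:
  "wf_sym add_sym" "wf_sym double_sym" "wf_sym iszero_sym" "wf_sym parity_sym" "wf_sym incr_sym"
  "wf_sym half_sym" "wf_sym pred_sym" "wf_sym cond_sym" "wf_sym step_sym" "wf_sym iter_sym"
  "wf_sym count_sym" "wf_sym pair_sym" "wf_sym excess_sym" "wf_sym fst_sym" "wf_sym snd_sym"
  by (simp_all add: sym_defs)

context arith_theory
begin

lemma proves_Forall_iff: "T \<turnstile> Forall \<phi> \<longleftrightarrow> T \<turnstile> \<phi>"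
proof
  assume "T \<turnstile> Forall \<phi>"
  then have "T \<turnstile> subst wk (Forall \<phi>)" by (rule proves_subst) simp
  then have "deriv T [] (Forall (subst (up wk) \<phi>))" by (simp add: proves_def)
  from deriv.ForallE[OF this, of "Var 0"] show "T \<turnstile> \<phi>" by (simp add: proves_def)
qed (simp add: proves_def deriv.ForallI)

lemma deriv_eq_sym:
  assumes "deriv T \<Gamma> (Eq s t)" "wf_tm s"
  shows "deriv T \<Gamma> (Eq t s)"
  using deriv.EqE[OF assms(1), of "Eq (Var 0) (subst_tm wk s)"] assms(2)
  by (simp add: inst_def deriv.EqI)

lemma deriv_eq_trans:
  assumes "deriv T \<Gamma> (Eq s t)" "deriv T \<Gamma> (Eq t u)" "wf_tm s"
  shows "deriv T \<Gamma> (Eq s u)"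
  using deriv.EqE[OF assms(2), of "Eq (subst_tm wk s) (Var 0)"] assms(1,3)
  by (simp add: inst_def)

text \<open>\<open>EqE\<close> replaces one argument at a time; \<open>us\<close> collects the
  arguments already replaced.\<close>

lemma deriv_eq_App:
  assumes "list_all2 (\<lambda>s t. deriv T \<Gamma> (Eq s t)) ss ts"
    and "wf_tm (App f (us @ ss))" "list_all wf_tm ts"
  shows "deriv T \<Gamma> (Eq (App f (us @ ss)) (App f (us @ ts)))"
  using assms
proof (induction arbitrary: us rule: list_all2_induct)
  case Nil
  then show ?case by (simp add: deriv.EqI)
next
  case (Cons s ss t ts)
  have "deriv T \<Gamma> (Eq (App f (us @ s # ss)) (App f (us @ t # ss)))"
    using deriv.EqE[OF Cons.hyps(1), of "Eq (App f (map (subst_tm wk) (us @ s # ss)))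
        (App f (map (subst_tm wk) us @ Var 0 # map (subst_tm wk) ss))"] Cons.prems
      deriv.EqI[of "App f (us @ s # ss)" T \<Gamma>]
    by (simp add: inst_def comp_def ball_Un)
  moreover have "deriv T \<Gamma> (Eq (App f (us @ t # ss)) (App f (us @ t # ts)))"
    using Cons.IH[of "us @ [t]"] Cons.prems by simp
  ultimately show ?case using deriv_eq_trans Cons.prems by blast
qed

text \<open>Classes of provably equal terms turn equational reasoning in \<open>T\<close> into rewriting.\<close>

definition cl :: "fm list \<Rightarrow> tm \<Rightarrow> tm set" where
  "cl \<Gamma> t = {u. wf_tm u \<and> deriv T \<Gamma> (Eq t u)}"

definition is_cl :: "fm list \<Rightarrow> tm set \<Rightarrow> bool" where
  "is_cl \<Gamma> A \<longleftrightarrow> (\<exists>t. wf_tm t \<and> A = cl \<Gamma> t)"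

text \<open>Acts on classes through arbitrary representatives; \<open>cl_App\<close> shows that the
  choice is immaterial.\<close>

definition ap :: "fm list \<Rightarrow> fsym \<Rightarrow> tm set list \<Rightarrow> tm set" where
  "ap \<Gamma> f As = cl \<Gamma> (App f (map (\<lambda>A. SOME t. t \<in> A) As))"

text \<open>Unfolds projections and compositions inside a defining equation. The head of a
  composition and every recursion stay under \<open>ap\<close>, so that named symbols remain visible
  to the rewrite rules below.\<close>

fun ev :: "fm list \<Rightarrow> fsym \<Rightarrow> tm set list \<Rightarrow> tm set" where
  "ev \<Gamma> (Proj n i) As = As ! i"
| "ev \<Gamma> (Comp n f gs) As = ap \<Gamma> f (map (\<lambda>g. ev \<Gamma> g As) gs)"
| "ev \<Gamma> f As = ap \<Gamma> f As"

lemma cl_eqI: "deriv T \<Gamma> (Eq s t) \<Longrightarrow> wf_tm s \<Longrightarrow> wf_tm t \<Longrightarrow> cl \<Gamma> s = cl \<Gamma> t"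
  unfolding cl_def using deriv_eq_trans deriv_eq_sym by blast

lemma cl_eqD: "cl \<Gamma> s = cl \<Gamma> t \<Longrightarrow> wf_tm t \<Longrightarrow> deriv T \<Gamma> (Eq s t)"
  unfolding cl_def using deriv.EqI[of t T \<Gamma>] by blast

lemma is_cl_cl [simp]: "wf_tm t \<Longrightarrow> is_cl \<Gamma> (cl \<Gamma> t)"
  by (auto simp: is_cl_def)

lemma some_in_cl: "wf_tm t \<Longrightarrow> (SOME u. u \<in> cl \<Gamma> t) \<in> cl \<Gamma> t"
  by (rule someI[of _ t]) (simp add: cl_def deriv.EqI)

lemma cl_App: "wf_tm (App f ts) \<Longrightarrow> cl \<Gamma> (App f ts) = ap \<Gamma> f (map (cl \<Gamma>) ts)"
proof -
  assume wf: "wf_tm (App f ts)"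
  let ?us = "map (\<lambda>t. SOME u. u \<in> cl \<Gamma> t) ts"
  have *: "wf_tm (SOME u. u \<in> cl \<Gamma> t) \<and> deriv T \<Gamma> (Eq t (SOME u. u \<in> cl \<Gamma> t))" if "t \<in> set ts" for t
    using some_in_cl[of t \<Gamma>] wf that by (auto simp: cl_def)
  then have "list_all2 (\<lambda>s t. deriv T \<Gamma> (Eq s t)) ts ?us"
    by (simp add: list_all2_conv_all_nth)
  then have "deriv T \<Gamma> (Eq (App f ts) (App f ?us))"
    using deriv_eq_App[of \<Gamma> ts ?us f "[]"] wf * by (auto simp: list_all_iff)
  then show ?thesis
    using cl_eqI wf * by (auto simp: ap_def comp_def)
qed

lemma is_cl_list: "\<forall>A\<in>set As. is_cl \<Gamma> A \<Longrightarrow> \<exists>ts. As = map (cl \<Gamma>) ts \<and> (\<forall>t\<in>set ts. wf_tm t)"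
proof (induction As)
  case (Cons A As)
  then obtain ts t where "As = map (cl \<Gamma>) ts" "\<forall>t\<in>set ts. wf_tm t" "wf_tm t" "A = cl \<Gamma> t"
    by (auto simp: is_cl_def)
  then show ?case by (intro exI[of _ "t # ts"]) auto
qed auto

lemma is_cl_ap [simp]:
  "wf_sym f \<Longrightarrow> arity f = length As \<Longrightarrow> \<forall>A\<in>set As. is_cl \<Gamma> A \<Longrightarrow> is_cl \<Gamma> (ap \<Gamma> f As)"
  using is_cl_list[of As \<Gamma>] cl_App[of f _ \<Gamma>] is_cl_cl[of "App f _" \<Gamma>] by (auto simp del: is_cl_cl)

lemma cl_HA: "Eq s t \<in> HA \<Longrightarrow> cl \<Gamma> s = cl \<Gamma> t"
  using HA_sub HA_wf[of "Eq s t"] by (intro cl_eqI deriv.Ax) auto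

lemma ap_ev:
  "wf_sym f \<Longrightarrow> arity f = length As \<Longrightarrow> \<forall>A\<in>set As. is_cl \<Gamma> A \<Longrightarrow> ap \<Gamma> f As = ev \<Gamma> f As"
proof (induction \<Gamma> f As rule: ev.induct)
  case (1 \<Gamma> n i As)
  then obtain ts where ts: "As = map (cl \<Gamma>) ts" "\<forall>t\<in>set ts. wf_tm t" using is_cl_list by blast
  then have wf: "wf_tm (App (Proj n i) ts)" using 1 by auto
  show ?case using cl_App[OF wf, of \<Gamma>] cl_HA[OF HA.Proj[OF wf], of \<Gamma>] 1 ts by simp
next
  case (2 \<Gamma> n f gs As)
  then obtain ts where ts: "As = map (cl \<Gamma>) ts" "\<forall>t\<in>set ts. wf_tm t" using is_cl_list by blast
  then have wf: "wf_tm (App (Comp n f gs) ts)" using 2 by auto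
  have "cl \<Gamma> (App f (map (\<lambda>g. App g ts) gs)) = ap \<Gamma> f (map (\<lambda>g. cl \<Gamma> (App g ts)) gs)"
    using wf by (subst cl_App) (auto simp: comp_def)
  also have "map (\<lambda>g. cl \<Gamma> (App g ts)) gs = map (\<lambda>g. ev \<Gamma> g As) gs"
    using 2 ts wf by (auto simp: cl_App)
  finally show ?case using cl_App[OF wf, of \<Gamma>] cl_HA[OF HA.Comp[OF wf], of \<Gamma>] ts by simp
qed auto

text \<open>The premise \<open>h = Rec f g\<close> keeps the name \<open>h\<close> on the left of
  the resulting rewrite rule, instead of exposing the recursion scheme.\<close>

lemma ap_Rec_zero:
  assumes h: "h = Rec f g"
    and "wf_sym h" "arity h = Suc (length As)" "\<forall>A\<in>set As. is_cl \<Gamma> A"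
  shows "ap \<Gamma> h (ap \<Gamma> Zero [] # As) = ev \<Gamma> f As"
proof -
  have wfs: "wf_sym (Rec f g)" "arity (Rec f g) = Suc (length As)"
    using assms(2,3) by (simp_all add: h)
  obtain ts where ts: "As = map (cl \<Gamma>) ts" "\<forall>t\<in>set ts. wf_tm t" using assms is_cl_list by blast
  then have wf: "wf_tm (App (Rec f g) (zero # ts))" using wfs by auto
  have "cl \<Gamma> (App f ts) = ev \<Gamma> f As"
    using wf wfs assms(4) ts by (simp add: cl_App flip: ap_ev)
  moreover have "cl \<Gamma> zero = ap \<Gamma> Zero []" by (simp add: cl_App)
  ultimately show ?thesis
    using cl_App[OF wf, of \<Gamma>] cl_HA[OF HA.Rec_zero[OF wf], of \<Gamma>] ts by (simp add: h)
qed

lemma ap_Rec_succ: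
  assumes h: "h = Rec f g"
    and "wf_sym h" "arity h = Suc (length As)" "\<forall>A\<in>set As. is_cl \<Gamma> A" "is_cl \<Gamma> A"
  shows "ap \<Gamma> h (ap \<Gamma> Succ [A] # As) = ev \<Gamma> g (A # ap \<Gamma> h (A # As) # As)"
proof -
  have wfs: "wf_sym (Rec f g)" "arity (Rec f g) = Suc (length As)"
    using assms(2,3) by (simp_all add: h)
  obtain ts where ts: "As = map (cl \<Gamma>) ts" "\<forall>t\<in>set ts. wf_tm t" using assms is_cl_list by blast
  obtain t where t: "wf_tm t" "A = cl \<Gamma> t" using assms by (auto simp: is_cl_def)
  have wf: "wf_tm (App (Rec f g) (succ t # ts))" using wfs ts t by auto
  have "cl \<Gamma> (App g (t # App (Rec f g) (t # ts) # ts)) = ap \<Gamma> g (A # ap \<Gamma> (Rec f g) (A # As) # As)"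
    using wf ts t by (simp add: cl_App)
  also have "\<dots> = ev \<Gamma> g (A # ap \<Gamma> (Rec f g) (A # As) # As)"
    by (rule ap_ev) (use wfs assms(4,5) in auto)
  moreover have "cl \<Gamma> (succ t) = ap \<Gamma> Succ [A]" using t by (simp add: cl_App)
  ultimately show ?thesis
    using cl_App[OF wf, of \<Gamma>] cl_HA[OF HA.Rec_succ[OF wf], of \<Gamma>] ts by (simp add: h)
qed

text \<open>Induction on \<open>Var 0\<close> for equations. The induction hypothesis is an
  assumption of the object theory and thus an equality of classes only over an extended context,
  which is why the step quantifies over \<open>\<Delta>\<close>. Finally \<open>\<sigma>\<close>
  instantiates the induction variable and the parameters.\<close>

lemma eq_induct:
  assumes "wf_tm s" "wf_tm t"
    and "\<And>\<Delta>. cl \<Delta> (subst_tm (case_nat zero Var) s) = cl \<Delta> (subst_tm (case_nat zero Var) t)"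
    and "\<And>\<Delta>. cl \<Delta> s = cl \<Delta> t \<Longrightarrow>
      cl \<Delta> (subst_tm (case_nat (succ (Var 0)) wk) s) = cl \<Delta> (subst_tm (case_nat (succ (Var 0)) wk) t)"
    and "\<And>n. wf_tm (\<sigma> n)"
  shows "cl \<Gamma> (subst_tm \<sigma> s) = cl \<Gamma> (subst_tm \<sigma> t)"
proof -
  let ?S = "subst_tm (case_nat (succ (Var 0)) wk)" and ?\<phi> = "Eq s t"
  have wfS: "wf_tm (?S u)" if "wf_tm u" for u
    by (rule wf_subst_tm) (auto simp: that split: nat.split)
  have "wf_tm (subst_tm (case_nat zero Var) t)"
    by (rule wf_subst_tm) (auto simp: assms(2) split: nat.split)
  then have "deriv T [] (inst zero ?\<phi>)"
    using cl_eqD[OF assms(3)] by (simp add: inst_def)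
  moreover have "deriv T [?\<phi>] (Eq (?S s) (?S t))"
  proof (rule cl_eqD[OF assms(4)])
    show "cl [?\<phi>] s = cl [?\<phi>] t" using assms(1,2) by (intro cl_eqI) (auto intro: deriv.Hyp)
  qed (use wfS assms in auto)
  then have "deriv T [] (Forall (Imp ?\<phi> (subst (case_nat (succ (Var 0)) wk) ?\<phi>)))"
    using assms(1,2) by (auto intro!: deriv.ForallI deriv.ImpI)
  ultimately have "deriv T [] (Forall ?\<phi>)"
    using HA.Induction[of ?\<phi>] HA_sub assms(1,2) by (blast intro: deriv.ImpE deriv.ConjI deriv.Ax wf_fm.simps(1)[THEN iffD2])
  then have "T \<turnstile> ?\<phi>" by (simp add: proves_Forall_iff flip: proves_def)
  then have "T \<turnstile> subst \<sigma> ?\<phi>" using assms(5) by (rule proves_subst)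
  then have "deriv T \<Gamma> (Eq (subst_tm \<sigma> s) (subst_tm \<sigma> t))"
    using deriv_weaken[of T "[]"] by (simp add: proves_def)
  then show ?thesis using assms by (intro cl_eqI wf_subst_tm) auto
qed

section \<open>Recursion equations of the pairing symbols\<close>

lemma ev_syms [simp]:
  "ev \<Gamma> add_sym As = ap \<Gamma> add_sym As" "ev \<Gamma> double_sym As = ap \<Gamma> double_sym As"
  "ev \<Gamma> iszero_sym As = ap \<Gamma> iszero_sym As" "ev \<Gamma> parity_sym As = ap \<Gamma> parity_sym As"
  "ev \<Gamma> incr_sym As = ap \<Gamma> incr_sym As" "ev \<Gamma> half_sym As = ap \<Gamma> half_sym As"
  "ev \<Gamma> pred_sym As = ap \<Gamma> pred_sym As" "ev \<Gamma> cond_sym As = ap \<Gamma> cond_sym As"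
  "ev \<Gamma> iter_sym As = ap \<Gamma> iter_sym As" "ev \<Gamma> pair_sym As = ap \<Gamma> pair_sym As"
  by (simp_all add: add_sym_def double_sym_def iszero_sym_def parity_sym_def incr_sym_def half_sym_def
      pred_sym_def cond_sym_def iter_sym_def pair_sym_def)

lemma ap_zero_syms1 [simp]:
  "ap \<Gamma> double_sym [ap \<Gamma> Zero []] = ap \<Gamma> Zero []"
  "ap \<Gamma> iszero_sym [ap \<Gamma> Zero []] = ap \<Gamma> Succ [ap \<Gamma> Zero []]"
  "ap \<Gamma> parity_sym [ap \<Gamma> Zero []] = ap \<Gamma> Zero []"
  "ap \<Gamma> half_sym [ap \<Gamma> Zero []] = ap \<Gamma> Zero []"
  by (simp_all add: ap_Rec_zero[OF double_sym_def] ap_Rec_zero[OF iszero_sym_def]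
      ap_Rec_zero[OF parity_sym_def] ap_Rec_zero[OF half_sym_def])

lemma ap_succ_syms1 [simp]:
  assumes "is_cl \<Gamma> A"
  shows "ap \<Gamma> double_sym [ap \<Gamma> Succ [A]] = ap \<Gamma> Succ [ap \<Gamma> Succ [ap \<Gamma> double_sym [A]]]"
    "ap \<Gamma> iszero_sym [ap \<Gamma> Succ [A]] = ap \<Gamma> Zero []"
    "ap \<Gamma> parity_sym [ap \<Gamma> Succ [A]] = ap \<Gamma> iszero_sym [ap \<Gamma> parity_sym [A]]"
    "ap \<Gamma> half_sym [ap \<Gamma> Succ [A]] = ap \<Gamma> incr_sym [ap \<Gamma> parity_sym [A], ap \<Gamma> half_sym [A]]"
    "ap \<Gamma> pred_sym [ap \<Gamma> Succ [A]] = A"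
  using assms by (simp_all add: ap_Rec_succ[OF double_sym_def] ap_Rec_succ[OF iszero_sym_def]
      ap_Rec_succ[OF parity_sym_def] ap_Rec_succ[OF half_sym_def] ap_Rec_succ[OF pred_sym_def])

lemma ap_zero_syms2 [simp]:
  assumes "is_cl \<Gamma> B"
  shows "ap \<Gamma> add_sym [ap \<Gamma> Zero [], B] = B"
    "ap \<Gamma> incr_sym [ap \<Gamma> Zero [], B] = B"
    "ap \<Gamma> iter_sym [ap \<Gamma> Zero [], B] = B"
    "ap \<Gamma> count_sym [ap \<Gamma> Zero [], B] = ap \<Gamma> Zero []"
    "ap \<Gamma> pair_sym [ap \<Gamma> Zero [], B] = ap \<Gamma> Succ [ap \<Gamma> double_sym [B]]"
    "ap \<Gamma> excess_sym [ap \<Gamma> Zero [], B] = ap \<Gamma> Succ [ap \<Gamma> double_sym [B]]"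
  using assms by (simp_all add: ap_Rec_zero[OF add_sym_def] ap_Rec_zero[OF incr_sym_def] ap_Rec_zero[OF iter_sym_def]
      ap_Rec_zero[OF count_sym_def] ap_Rec_zero[OF pair_sym_def] ap_Rec_zero[OF excess_sym_def])

lemma ap_succ_syms2 [simp]:
  assumes "is_cl \<Gamma> A" "is_cl \<Gamma> B"
  shows "ap \<Gamma> add_sym [ap \<Gamma> Succ [A], B] = ap \<Gamma> Succ [ap \<Gamma> add_sym [A, B]]"
    "ap \<Gamma> incr_sym [ap \<Gamma> Succ [A], B] = ap \<Gamma> Succ [B]"
    "ap \<Gamma> iter_sym [ap \<Gamma> Succ [A], B] = ap \<Gamma> step_sym [ap \<Gamma> iter_sym [A, B]]"
    "ap \<Gamma> count_sym [ap \<Gamma> Succ [A], B] = ap \<Gamma> incr_sym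
       [ap \<Gamma> iszero_sym [ap \<Gamma> parity_sym [ap \<Gamma> iter_sym [A, B]]], ap \<Gamma> count_sym [A, B]]"
    "ap \<Gamma> pair_sym [ap \<Gamma> Succ [A], B] = ap \<Gamma> Succ [ap \<Gamma> Succ [ap \<Gamma> double_sym [ap \<Gamma> pair_sym [A, B]]]]"
    "ap \<Gamma> excess_sym [ap \<Gamma> Succ [A], B] =
       ap \<Gamma> Succ [ap \<Gamma> add_sym [ap \<Gamma> excess_sym [A, B], ap \<Gamma> pair_sym [A, B]]]"
  using assms by (simp_all add: ap_Rec_succ[OF add_sym_def] ap_Rec_succ[OF incr_sym_def] ap_Rec_succ[OF iter_sym_def]
      ap_Rec_succ[OF count_sym_def] ap_Rec_succ[OF pair_sym_def] ap_Rec_succ[OF excess_sym_def])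

lemma ap_cond_sym_zero [simp]:
  assumes "is_cl \<Gamma> B" "is_cl \<Gamma> C"
  shows "ap \<Gamma> cond_sym [ap \<Gamma> Zero [], B, C] = C"
  using assms by (simp add: ap_Rec_zero[OF cond_sym_def])

lemma ap_cond_sym_succ [simp]:
  assumes "is_cl \<Gamma> A" "is_cl \<Gamma> B" "is_cl \<Gamma> C"
  shows "ap \<Gamma> cond_sym [ap \<Gamma> Succ [A], B, C] = B"
  using assms by (simp add: ap_Rec_succ[OF cond_sym_def])

lemma ap_comp_syms:
  assumes "is_cl \<Gamma> A"
  shows "ap \<Gamma> step_sym [A] =
      ap \<Gamma> cond_sym [ap \<Gamma> parity_sym [A], A, ap \<Gamma> pred_sym [ap \<Gamma> half_sym [A]]]"
    "ap \<Gamma> fst_sym [A] = ap \<Gamma> count_sym [A, A]"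
    "ap \<Gamma> snd_sym [A] = ap \<Gamma> half_sym [ap \<Gamma> iter_sym [A, A]]"
proof -
  have *: "ap \<Gamma> f [A] = ev \<Gamma> (Comp 1 g hs) [A]" if "f = Comp 1 g hs" "wf_sym f" for f g hs
    using that assms ap_ev[of f "[A]" \<Gamma>] by simp
  show "ap \<Gamma> step_sym [A] =
      ap \<Gamma> cond_sym [ap \<Gamma> parity_sym [A], A, ap \<Gamma> pred_sym [ap \<Gamma> half_sym [A]]]"
    using *[OF step_sym_def] by simp
  show "ap \<Gamma> fst_sym [A] = ap \<Gamma> count_sym [A, A]"
    using *[OF fst_sym_def] by simp
  show "ap \<Gamma> snd_sym [A] = ap \<Gamma> half_sym [ap \<Gamma> iter_sym [A, A]]"
    using *[OF snd_sym_def] by simp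
qed

section \<open>Identities of the pairing symbols proved by induction\<close>

lemma ap_add_Succ [simp]:
  assumes "is_cl \<Gamma> A" "is_cl \<Gamma> B"
  shows "ap \<Gamma> add_sym [A, ap \<Gamma> Succ [B]] = ap \<Gamma> Succ [ap \<Gamma> add_sym [A, B]]"
proof -
  obtain a b where ab: "wf_tm a" "wf_tm b" "A = cl \<Gamma> a" "B = cl \<Gamma> b"
    using assms by (auto simp: is_cl_def)
  \<comment> \<open>Representatives turn the equation between classes into a substitution instance
    of an equation between terms, with \<open>Var 0\<close> as induction variable. The proofs below
    follow the same pattern.\<close>
  have "cl \<Gamma> (subst_tm (case_nat a (\<lambda>_. b)) (App add_sym [Var 0, succ (Var 1)])) =
    cl \<Gamma> (subst_tm (case_nat a (\<lambda>_. b)) (succ (App add_sym [Var 0, Var 1])))"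
    by (rule eq_induct) (use ab in \<open>simp_all add: cl_App split: nat.split\<close>)
  then show ?thesis using ab by (simp add: cl_App)
qed

lemma ap_add_assoc:
  assumes "is_cl \<Gamma> A" "is_cl \<Gamma> B" "is_cl \<Gamma> C"
  shows "ap \<Gamma> add_sym [ap \<Gamma> add_sym [A, B], C] = ap \<Gamma> add_sym [A, ap \<Gamma> add_sym [B, C]]"
proof -
  obtain a b c where abc: "wf_tm a" "wf_tm b" "wf_tm c" "A = cl \<Gamma> a" "B = cl \<Gamma> b" "C = cl \<Gamma> c"
    using assms by (auto simp: is_cl_def)
  have "cl \<Gamma> (subst_tm (case_nat a (case_nat b (\<lambda>_. c)))
      (App add_sym [App add_sym [Var 0, Var 1], Var 2])) =
    cl \<Gamma> (subst_tm (case_nat a (case_nat b (\<lambda>_. c)))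
      (App add_sym [Var 0, App add_sym [Var 1, Var 2]]))"
    by (rule eq_induct) (use abc in \<open>simp_all add: cl_App numeral_2_eq_2 split: nat.split\<close>)
  then show ?thesis using abc by (simp add: cl_App numeral_2_eq_2)
qed

lemma ap_double:
  assumes "is_cl \<Gamma> A"
  shows "ap \<Gamma> double_sym [A] = ap \<Gamma> add_sym [A, A]"
proof -
  obtain a where a: "wf_tm a" "A = cl \<Gamma> a" using assms by (auto simp: is_cl_def)
  have "cl \<Gamma> (subst_tm (\<lambda>_. a) (App double_sym [Var 0])) =
    cl \<Gamma> (subst_tm (\<lambda>_. a) (App add_sym [Var 0, Var 0]))"
    by (rule eq_induct) (use a in \<open>simp_all add: cl_App split: nat.split\<close>)
  then show ?thesis using a by (simp add: cl_App)
qed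

lemma ap_parity_double [simp]:
  assumes "is_cl \<Gamma> A"
  shows "ap \<Gamma> parity_sym [ap \<Gamma> double_sym [A]] = ap \<Gamma> Zero []"
proof -
  obtain a where a: "wf_tm a" "A = cl \<Gamma> a" using assms by (auto simp: is_cl_def)
  have "cl \<Gamma> (subst_tm (\<lambda>_. a) (App parity_sym [App double_sym [Var 0]])) =
    cl \<Gamma> (subst_tm (\<lambda>_. a) zero)"
    by (rule eq_induct) (use a in \<open>simp_all add: cl_App split: nat.split\<close>)
  then show ?thesis using a by (simp add: cl_App)
qed

lemma ap_half_double [simp]:
  assumes "is_cl \<Gamma> A"
  shows "ap \<Gamma> half_sym [ap \<Gamma> double_sym [A]] = A"
proof -
  obtain a where a: "wf_tm a" "A = cl \<Gamma> a" using assms by (auto simp: is_cl_def)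
  have "cl \<Gamma> (subst_tm (\<lambda>_. a) (App half_sym [App double_sym [Var 0]])) =
    cl \<Gamma> (subst_tm (\<lambda>_. a) (Var 0))"
    by (rule eq_induct) (use a in \<open>simp_all add: cl_App split: nat.split\<close>)
  then show ?thesis using a by (simp add: cl_App)
qed

text \<open>Induction serves as a case distinction on the first argument; both cases
  compute.\<close>

lemma ap_incr_Succ [simp]:
  assumes "is_cl \<Gamma> A" "is_cl \<Gamma> B"
  shows "ap \<Gamma> incr_sym [A, ap \<Gamma> Succ [B]] = ap \<Gamma> Succ [ap \<Gamma> incr_sym [A, B]]"
proof -
  obtain a b where ab: "wf_tm a" "wf_tm b" "A = cl \<Gamma> a" "B = cl \<Gamma> b"
    using assms by (auto simp: is_cl_def)
  have "cl \<Gamma> (subst_tm (case_nat a (\<lambda>_. b)) (App incr_sym [Var 0, succ (Var 1)])) =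
    cl \<Gamma> (subst_tm (case_nat a (\<lambda>_. b)) (succ (App incr_sym [Var 0, Var 1])))"
    by (rule eq_induct) (use ab in \<open>simp_all add: cl_App split: nat.split\<close>)
  then show ?thesis using ab by (simp add: cl_App)
qed

lemma ap_step [simp]:
  assumes "is_cl \<Gamma> A"
  shows "ap \<Gamma> step_sym [ap \<Gamma> Succ [ap \<Gamma> double_sym [A]]] = ap \<Gamma> Succ [ap \<Gamma> double_sym [A]]"
    "ap \<Gamma> step_sym [ap \<Gamma> Succ [ap \<Gamma> Succ [ap \<Gamma> double_sym [A]]]] = A"
  using assms by (simp_all add: ap_comp_syms)

lemma ap_iter_odd [simp]:
  assumes "is_cl \<Gamma> A" "is_cl \<Gamma> B"
  shows "ap \<Gamma> iter_sym [A, ap \<Gamma> Succ [ap \<Gamma> double_sym [B]]] = ap \<Gamma> Succ [ap \<Gamma> double_sym [B]]"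
proof -
  obtain a b where ab: "wf_tm a" "wf_tm b" "A = cl \<Gamma> a" "B = cl \<Gamma> b"
    using assms by (auto simp: is_cl_def)
  have "cl \<Gamma> (subst_tm (case_nat a (\<lambda>_. b)) (App iter_sym [Var 0, succ (App double_sym [Var 1])])) =
    cl \<Gamma> (subst_tm (case_nat a (\<lambda>_. b)) (succ (App double_sym [Var 1])))"
    by (rule eq_induct) (use ab in \<open>simp_all add: cl_App split: nat.split\<close>)
  then show ?thesis using ab by (simp add: cl_App)
qed

lemma ap_count_odd [simp]:
  assumes "is_cl \<Gamma> A" "is_cl \<Gamma> B"
  shows "ap \<Gamma> count_sym [A, ap \<Gamma> Succ [ap \<Gamma> double_sym [B]]] = ap \<Gamma> Zero []"
proof -
  obtain a b where ab: "wf_tm a" "wf_tm b" "A = cl \<Gamma> a" "B = cl \<Gamma> b"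
    using assms by (auto simp: is_cl_def)
  have "cl \<Gamma> (subst_tm (case_nat a (\<lambda>_. b)) (App count_sym [Var 0, succ (App double_sym [Var 1])])) =
    cl \<Gamma> (subst_tm (case_nat a (\<lambda>_. b)) zero)"
    by (rule eq_induct) (use ab in \<open>simp_all add: cl_App split: nat.split\<close>)
  then show ?thesis using ab by (simp add: cl_App)
qed

text \<open>\<open>iter_sym\<close> adds steps at the end, whereas an even code is taken apart by
  its first step. Moving that step to the front takes an induction.\<close>

lemma ap_iter_even:
  assumes "is_cl \<Gamma> A" "is_cl \<Gamma> B"
  shows "ap \<Gamma> step_sym [ap \<Gamma> iter_sym [A, ap \<Gamma> Succ [ap \<Gamma> Succ [ap \<Gamma> double_sym [B]]]]] =
    ap \<Gamma> iter_sym [A, B]"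
proof -
  obtain a b where ab: "wf_tm a" "wf_tm b" "A = cl \<Gamma> a" "B = cl \<Gamma> b"
    using assms by (auto simp: is_cl_def)
  have "cl \<Gamma> (subst_tm (case_nat a (\<lambda>_. b))
      (App step_sym [App iter_sym [Var 0, succ (succ (App double_sym [Var 1]))]])) =
    cl \<Gamma> (subst_tm (case_nat a (\<lambda>_. b)) (App iter_sym [Var 0, Var 1]))"
    by (rule eq_induct) (use ab in \<open>simp_all add: cl_App split: nat.split\<close>)
  then show ?thesis using ab by (simp add: cl_App)
qed

text \<open>The first step leaves an even number and is counted; the remaining ones are those made
  from \<open>B\<close>.\<close>

lemma ap_count_even:
  assumes "is_cl \<Gamma> A" "is_cl \<Gamma> B"
  shows "ap \<Gamma> count_sym [ap \<Gamma> Succ [A], ap \<Gamma> Succ [ap \<Gamma> Succ [ap \<Gamma> double_sym [B]]]] =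
    ap \<Gamma> Succ [ap \<Gamma> count_sym [A, B]]"
proof -
  obtain a b where ab: "wf_tm a" "wf_tm b" "A = cl \<Gamma> a" "B = cl \<Gamma> b"
    using assms by (auto simp: is_cl_def)
  have "cl \<Gamma> (subst_tm (case_nat a (\<lambda>_. b))
      (App count_sym [succ (Var 0), succ (succ (App double_sym [Var 1]))])) =
    cl \<Gamma> (subst_tm (case_nat a (\<lambda>_. b)) (succ (App count_sym [Var 0, Var 1])))"
    by (rule eq_induct) (use ab in \<open>simp_all add: cl_App ap_iter_even split: nat.split\<close>)
  then show ?thesis using ab by (simp add: cl_App)
qed

text \<open>The \<open>C\<close> surplus steps are harmless because odd numbers are fixed. They make
  it possible to iterate as often as the code itself says, without knowing the first
  component.\<close>

lemma ap_iter_pair: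
  assumes "is_cl \<Gamma> A" "is_cl \<Gamma> B" "is_cl \<Gamma> C"
  shows "ap \<Gamma> iter_sym [ap \<Gamma> add_sym [A, C], ap \<Gamma> pair_sym [A, B]] = ap \<Gamma> Succ [ap \<Gamma> double_sym [B]]"
proof -
  obtain a b c where abc: "wf_tm a" "wf_tm b" "wf_tm c" "A = cl \<Gamma> a" "B = cl \<Gamma> b" "C = cl \<Gamma> c"
    using assms by (auto simp: is_cl_def)
  have "cl \<Gamma> (subst_tm (case_nat a (case_nat b (\<lambda>_. c)))
      (App iter_sym [App add_sym [Var 0, Var 2], App pair_sym [Var 0, Var 1]])) =
    cl \<Gamma> (subst_tm (case_nat a (case_nat b (\<lambda>_. c))) (succ (App double_sym [Var 1])))"
    by (rule eq_induct) (use abc in \<open>simp_all add: cl_App numeral_2_eq_2 ap_iter_even split: nat.split\<close>)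
  then show ?thesis using abc by (simp add: cl_App numeral_2_eq_2)
qed

lemma ap_count_pair:
  assumes "is_cl \<Gamma> A" "is_cl \<Gamma> B" "is_cl \<Gamma> C"
  shows "ap \<Gamma> count_sym [ap \<Gamma> add_sym [A, C], ap \<Gamma> pair_sym [A, B]] = A"
proof -
  obtain a b c where abc: "wf_tm a" "wf_tm b" "wf_tm c" "A = cl \<Gamma> a" "B = cl \<Gamma> b" "C = cl \<Gamma> c"
    using assms by (auto simp: is_cl_def)
  have "cl \<Gamma> (subst_tm (case_nat a (case_nat b (\<lambda>_. c)))
      (App count_sym [App add_sym [Var 0, Var 2], App pair_sym [Var 0, Var 1]])) =
    cl \<Gamma> (subst_tm (case_nat a (case_nat b (\<lambda>_. c))) (Var 0))"
    \<comment> \<open>The recursion equation of \<open>count_sym\<close> would split off the last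
      step; it is removed so that \<open>ap_count_even\<close> can split off the first.\<close>
    by (rule eq_induct)
      (use abc in \<open>simp_all add: cl_App numeral_2_eq_2 ap_count_even del: ap_succ_syms2(4) split: nat.split\<close>)
  then show ?thesis using abc by (simp add: cl_App numeral_2_eq_2)
qed

lemma ap_pair_excess:
  assumes "is_cl \<Gamma> A" "is_cl \<Gamma> B"
  shows "ap \<Gamma> pair_sym [A, B] = ap \<Gamma> add_sym [A, ap \<Gamma> excess_sym [A, B]]"
proof -
  obtain a b where ab: "wf_tm a" "wf_tm b" "A = cl \<Gamma> a" "B = cl \<Gamma> b"
    using assms by (auto simp: is_cl_def)
  have "cl \<Gamma> (subst_tm (case_nat a (\<lambda>_. b)) (App pair_sym [Var 0, Var 1])) =
    cl \<Gamma> (subst_tm (case_nat a (\<lambda>_. b)) (App add_sym [Var 0, App excess_sym [Var 0, Var 1]]))"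
    by (rule eq_induct) (use ab in \<open>simp_all add: cl_App ap_double ap_add_assoc split: nat.split\<close>)
  then show ?thesis using ab by (simp add: cl_App)
qed

lemma cl_fst_snd_pair:
  assumes "wf_tm s" "wf_tm t"
  shows "cl \<Gamma> (App fst_sym [App pair_sym [s, t]]) = cl \<Gamma> s"
    "cl \<Gamma> (App snd_sym [App pair_sym [s, t]]) = cl \<Gamma> t"
proof -
  have "ap \<Gamma> count_sym [ap \<Gamma> pair_sym [cl \<Gamma> s, cl \<Gamma> t], ap \<Gamma> pair_sym [cl \<Gamma> s, cl \<Gamma> t]] = cl \<Gamma> s"
    using ap_count_pair[of \<Gamma> "cl \<Gamma> s" "cl \<Gamma> t" "ap \<Gamma> excess_sym [cl \<Gamma> s, cl \<Gamma> t]"] assms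
    by (simp flip: ap_pair_excess)
  then show "cl \<Gamma> (App fst_sym [App pair_sym [s, t]]) = cl \<Gamma> s"
    using assms by (simp add: cl_App ap_comp_syms)
  have "ap \<Gamma> iter_sym [ap \<Gamma> pair_sym [cl \<Gamma> s, cl \<Gamma> t], ap \<Gamma> pair_sym [cl \<Gamma> s, cl \<Gamma> t]] =
      ap \<Gamma> Succ [ap \<Gamma> double_sym [cl \<Gamma> t]]"
    using ap_iter_pair[of \<Gamma> "cl \<Gamma> s" "cl \<Gamma> t" "ap \<Gamma> excess_sym [cl \<Gamma> s, cl \<Gamma> t]"] assms
    by (simp flip: ap_pair_excess)
  then show "cl \<Gamma> (App snd_sym [App pair_sym [s, t]]) = cl \<Gamma> t"
    using assms by (simp add: cl_App ap_comp_syms)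
qed

section \<open>Reduction of parameters to a single variable\<close>

definition proj_tm :: "tm \<Rightarrow> nat \<Rightarrow> tm" where
  "proj_tm t n = App fst_sym [((\<lambda>s. App snd_sym [s]) ^^ n) t]"

text \<open>The tuple of the \<open>N\<close> variables from \<open>i\<close> on, as nested pairs
  ending in zero, to be read by \<open>proj_tm\<close>.\<close>

fun code_tm :: "nat \<Rightarrow> nat \<Rightarrow> tm" where
  "code_tm 0 i = zero"
| "code_tm (Suc N) i = App pair_sym [Var i, code_tm N (Suc i)]"

lemma wf_code_tm [simp]: "wf_tm (code_tm N i)"
  by (induction N arbitrary: i) auto

lemma wf_snds [simp]: "wf_tm t \<Longrightarrow> wf_tm (((\<lambda>s. App snd_sym [s]) ^^ n) t)"
  by (induction n) auto

lemma wf_proj_tm [simp]: "wf_tm t \<Longrightarrow> wf_tm (proj_tm t n)"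
  by (simp add: proj_tm_def)

lemma FV_proj_tm: "FV_tm (proj_tm t n) = FV_tm t"
proof -
  have "FV_tm (((\<lambda>s. App snd_sym [s]) ^^ n) t) = FV_tm t" by (induction n) auto
  then show ?thesis by (simp add: proj_tm_def)
qed

lemma subst_proj_tm: "subst_tm \<sigma> (proj_tm t n) = proj_tm (subst_tm \<sigma> t) n"
proof -
  have "subst_tm \<sigma> (((\<lambda>s. App snd_sym [s]) ^^ n) t) = ((\<lambda>s. App snd_sym [s]) ^^ n) (subst_tm \<sigma> t)"
    by (induction n) auto
  then show ?thesis by (simp add: proj_tm_def)
qed

lemma cl_proj_tm_cong:
  assumes "cl \<Gamma> s = cl \<Gamma> t" "wf_tm s" "wf_tm t"
  shows "cl \<Gamma> (proj_tm s n) = cl \<Gamma> (proj_tm t n)"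
proof -
  have "cl \<Gamma> (((\<lambda>s. App snd_sym [s]) ^^ n) s) = cl \<Gamma> (((\<lambda>s. App snd_sym [s]) ^^ n) t)"
    by (induction n) (use assms in \<open>simp_all add: cl_App\<close>)
  then show ?thesis using assms by (simp add: proj_tm_def cl_App)
qed

lemma cl_proj_code: "n < N \<Longrightarrow> cl \<Gamma> (proj_tm (code_tm N i) n) = cl \<Gamma> (Var (i + n))"
proof (induction n arbitrary: N i)
  case 0
  then obtain M where "N = Suc M" by (cases N) auto
  then show ?case by (simp add: proj_tm_def cl_fst_snd_pair)
next
  case (Suc n)
  then obtain M where M: "N = Suc M" by (cases N) auto
  \<comment> \<open>Moving one \<open>snd_sym\<close> to the innermost place strips the head of the
    tuple.\<close>
  have "proj_tm (code_tm N i) (Suc n) = proj_tm (App snd_sym [code_tm N i]) n"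
    using funpow_swap1[of "\<lambda>s. App snd_sym [s]" n "code_tm N i"] by (simp add: proj_tm_def)
  also have "cl \<Gamma> \<dots> = cl \<Gamma> (proj_tm (code_tm M (Suc i)) n)"
    by (rule cl_proj_tm_cong) (simp_all add: M cl_fst_snd_pair)
  finally show ?case using Suc.IH[of M "Suc i"] Suc.prems M by simp
qed

lemma cl_subst_tm_cong:
  assumes "\<And>n. n \<in> FV_tm t \<Longrightarrow> cl \<Gamma> (\<sigma> n) = cl \<Gamma> (\<tau> n)" "wf_tm t"
    and "\<And>n. wf_tm (\<sigma> n)" "\<And>n. wf_tm (\<tau> n)"
  shows "cl \<Gamma> (subst_tm \<sigma> t) = cl \<Gamma> (subst_tm \<tau> t)"
  using assms(1,2)
proof (induction t)
  case (App f ts)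
  have "map (\<lambda>t. cl \<Gamma> (subst_tm \<sigma> t)) ts = map (\<lambda>t. cl \<Gamma> (subst_tm \<tau> t)) ts"
    using App by auto
  moreover have "wf_tm (App f (map (subst_tm \<sigma>) ts))" "wf_tm (App f (map (subst_tm \<tau>) ts))"
    using wf_subst_tm[of "App f ts" \<sigma>] wf_subst_tm[of "App f ts" \<tau>] App.prems assms(3,4) by auto
  ultimately show ?case by (simp add: cl_App comp_def cong: map_cong)
qed simp

text \<open>The equations are theorems of \<open>T\<close> rather than hypotheses, so they can be
  shifted by \<open>wk\<close> when a quantifier is crossed.\<close>

lemma subst_le_cong:
  assumes "\<And>n. n \<in> FV \<phi> \<Longrightarrow> T \<turnstile> Eq (\<sigma> n) (\<tau> n)" "wf_fm \<phi>"
    and "\<And>n. wf_tm (\<sigma> n)" "\<And>n. wf_tm (\<tau> n)"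
  shows "subst \<sigma> \<phi> \<approx> subst \<tau> \<phi>"
  using assms
proof (induction \<phi> arbitrary: \<sigma> \<tau>)
  case (Eq s t)
  have cl: "cl \<Gamma> (\<sigma> n) = cl \<Gamma> (\<tau> n)" if "n \<in> FV (Eq s t)" for n \<Gamma>
    using Eq.prems(1)[OF that] deriv_weaken[of T "[]" _ \<Gamma>] Eq.prems(3,4)
    by (intro cl_eqI) (auto simp: proves_def)
  have *: "cl \<Gamma> (subst_tm \<sigma> u) = cl \<Gamma> (subst_tm \<tau> u)" if "u = s \<or> u = t" for \<Gamma> u
    by (rule cl_subst_tm_cong[OF cl]) (use that Eq.prems in auto)
  have wf: "wf_tm (subst_tm \<sigma> s)" "wf_tm (subst_tm \<tau> s)" "wf_tm (subst_tm \<sigma> t)" "wf_tm (subst_tm \<tau> t)"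
    using Eq.prems by (auto intro!: wf_subst_tm)
  have hyp: "cl [Eq a b] a = cl [Eq a b] b" if "wf_tm a" "wf_tm b" for a b
    using that by (intro cl_eqI deriv.Hyp) auto
  show ?case
    unfolding eqv_def le_def using wf hyp[OF wf(1,3)] hyp[OF wf(2,4)] by (simp add: * cl_eqD)
next
  case (Forall \<phi>)
  have up: "T \<turnstile> Eq (up \<sigma> n) (up \<tau> n)" if "n \<in> FV \<phi>" for n
  proof (cases n)
    case (Suc m)
    then have "T \<turnstile> Eq (\<sigma> m) (\<tau> m)" using Forall.prems(1) that by simp
    from proves_subst[OF this, of wk] show ?thesis using Suc by simp
  qed (simp add: proves_def deriv.EqI)
  have "subst (up \<sigma>) \<phi> \<approx> subst (up \<tau>) \<phi>"
    by (rule Forall.IH[OF up]) (use Forall.prems in \<open>simp_all add: wf_up\<close>)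
  then show ?case by (simp add: eqv_cong)
next
  case (Exists \<phi>)
  have up: "T \<turnstile> Eq (up \<sigma> n) (up \<tau> n)" if "n \<in> FV \<phi>" for n
  proof (cases n)
    case (Suc m)
    then have "T \<turnstile> Eq (\<sigma> m) (\<tau> m)" using Exists.prems(1) that by simp
    from proves_subst[OF this, of wk] show ?thesis using Suc by simp
  qed (simp add: proves_def deriv.EqI)
  have "subst (up \<sigma>) \<phi> \<approx> subst (up \<tau>) \<phi>"
    by (rule Exists.IH[OF up]) (use Exists.prems in \<open>simp_all add: wf_up\<close>)
  then show ?case by (simp add: eqv_cong)
next
  case (Conj \<phi> \<psi>)
  have "subst \<sigma> \<phi> \<approx> subst \<tau> \<phi>" by (rule Conj.IH) (use Conj.prems in auto)
  moreover have "subst \<sigma> \<psi> \<approx> subst \<tau> \<psi>" by (rule Conj.IH) (use Conj.prems in auto)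
  ultimately show ?case by (simp add: eqv_cong)
next
  case (Disj \<phi> \<psi>)
  have "subst \<sigma> \<phi> \<approx> subst \<tau> \<phi>" by (rule Disj.IH) (use Disj.prems in auto)
  moreover have "subst \<sigma> \<psi> \<approx> subst \<tau> \<psi>" by (rule Disj.IH) (use Disj.prems in auto)
  ultimately show ?case by (simp add: eqv_cong)
next
  case (Imp \<phi> \<psi>)
  have "subst \<sigma> \<phi> \<approx> subst \<tau> \<phi>" by (rule Imp.IH) (use Imp.prems in auto)
  moreover have "subst \<sigma> \<psi> \<approx> subst \<tau> \<psi>" by (rule Imp.IH) (use Imp.prems in auto)
  ultimately show ?case by (simp add: eqv_cong)
qed (simp add: eqv_refl)

text \<open>The coded formula has \<open>Var 0\<close> as its only parameter and reads the original
  variables as projections of it. Substituting the code of the first \<open>N\<close> variables for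
  that parameter makes each projection provably equal to its variable.\<close>

lemma proves_by_coding:
  assumes "wf_fm \<phi>" "T \<turnstile> subst (proj_tm (Var 0)) \<phi>"
  shows "T \<turnstile> \<phi>"
proof -
  obtain N where N: "\<And>n. n \<in> FV \<phi> \<Longrightarrow> n < N"
    using finite_FV[of \<phi>] finite_nat_set_iff_bounded by auto
  let ?\<sigma> = "proj_tm (code_tm N 0)"
  have "T \<turnstile> subst (\<lambda>_. code_tm N 0) (subst (proj_tm (Var 0)) \<phi>)"
    by (rule proves_subst[OF assms(2)]) simp
  then have "T \<turnstile> subst ?\<sigma> \<phi>" by (simp add: subst_proj_tm)
  moreover have "subst ?\<sigma> \<phi> \<approx> subst Var \<phi>"
  proof (rule subst_le_cong)
    fix n assume "n \<in> FV \<phi>"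
    then show "T \<turnstile> Eq (?\<sigma> n) (Var n)"
      unfolding proves_def using cl_proj_code[OF N, of n "[]" 0] by (intro cl_eqD) auto
  qed (use assms in auto)
  ultimately show ?thesis
    unfolding proves_def eqv_def using deriv_le[of "[]" "subst ?\<sigma> \<phi>" \<phi>] by simp
qed

lemma FV_subst_proj: "FV (subst (proj_tm (Var 0)) \<phi>) \<subseteq> {0}"
  by (auto simp: FV_subst FV_proj_tm)

text \<open>Frees the principle from its restriction to one parameter, for formulas whose coded form
  stays in the class.\<close>

lemma stable_of_DNE:
  assumes "\<And>\<chi>. \<chi> \<in> DNE C \<Longrightarrow> T \<turnstile> \<chi>" "wf_fm \<phi>"
    and "subst (proj_tm (Var 0)) \<phi> \<in> C"
  shows "stable \<phi>"
proof -
  have "T \<turnstile> Forall (subst (proj_tm (Var 0)) (Imp (Neg (Neg \<phi>)) \<phi>))"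
    by (rule assms(1)) (use assms(3) FV_subst_proj in \<open>auto simp: DNE_def\<close>)
  then show ?thesis unfolding proves_Forall_iff
    using proves_by_coding[of "Imp (Neg (Neg \<phi>)) \<phi>"] assms(2) by (simp add: stable_def proves_Imp_iff)
qed

lemma stable_of_DNE_disj:
  assumes "\<And>\<chi>. \<chi> \<in> DNE_disj C D \<Longrightarrow> T \<turnstile> \<chi>" "wf_fm \<phi>" "wf_fm \<psi>"
    and "subst (proj_tm (Var 0)) \<phi> \<in> C" "subst (proj_tm (Var 0)) \<psi> \<in> D"
  shows "stable (Disj \<phi> \<psi>)"
proof -
  have "T \<turnstile> Forall (subst (proj_tm (Var 0)) (Imp (Neg (Neg (Disj \<phi> \<psi>))) (Disj \<phi> \<psi>)))"
    by (rule assms(1)) (use assms(4,5) FV_subst_proj in \<open>auto simp: DNE_disj_def\<close>)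
  then show ?thesis unfolding proves_Forall_iff
    using proves_by_coding[of "Imp (Neg (Neg (Disj \<phi> \<psi>))) (Disj \<phi> \<psi>)"] assms(2,3)
    by (simp add: stable_def proves_Imp_iff)
qed

text \<open>Only the parameters are coded: \<open>up\<close> protects the variable bound by the
  shifted quantifier.\<close>

lemma DNS_open:
  assumes "\<And>\<chi>. \<chi> \<in> DNS C \<Longrightarrow> T \<turnstile> \<chi>" "wf_fm \<phi>"
    and "subst (up (proj_tm (Var 0))) \<phi> \<in> C"
  shows "Forall (Neg (Neg \<phi>)) \<sqsubseteq> Neg (Neg (Forall \<phi>))"
proof -
  have "FV_tm (up (proj_tm (Var 0)) n) \<subseteq> {0, 1}" for n
    by (cases n) (auto simp: FV_subst_tm FV_proj_tm)
  then have "FV (subst (up (proj_tm (Var 0))) \<phi>) \<subseteq> {0, 1}"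
    unfolding FV_subst by blast
  then have "T \<turnstile> Forall (subst (proj_tm (Var 0)) (Imp (Forall (Neg (Neg \<phi>))) (Neg (Neg (Forall \<phi>)))))"
    by (intro assms(1)) (use assms(3) in \<open>auto simp: DNS_def\<close>)
  then show ?thesis unfolding proves_Forall_iff
    using proves_by_coding[of "Imp (Forall (Neg (Neg \<phi>))) (Neg (Neg (Forall \<phi>)))"] assms(2)
    by (simp add: proves_Imp_iff)
qed

end

section \<open>Prenex formulas\<close>

lemma Sigma_Pi_wf: "(\<phi> \<in> Sigma_cls k \<longrightarrow> wf_fm \<phi>) \<and> (\<phi> \<in> Pi_cls k \<longrightarrow> wf_fm \<phi>)"
proof (induction k arbitrary: \<phi>)
  case (Suc k)
  have "wf_fm ((Exists ^^ n) \<psi>) = wf_fm \<psi>" "wf_fm ((Forall ^^ n) \<psi>) = wf_fm \<psi>" for n \<psi>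
    by (induction n) auto
  then show ?case using Suc by auto
qed auto

lemma Sigma_wf: "\<phi> \<in> Sigma_cls k \<Longrightarrow> wf_fm \<phi>" and Pi_wf: "\<phi> \<in> Pi_cls k \<Longrightarrow> wf_fm \<phi>"
  using Sigma_Pi_wf by auto

lemma Pi_sub_Sigma: "\<phi> \<in> Pi_cls k \<Longrightarrow> \<phi> \<in> Sigma_cls (Suc k)"
  by (auto intro!: exI[of _ 0])

lemma Sigma_sub_Pi: "\<phi> \<in> Sigma_cls k \<Longrightarrow> \<phi> \<in> Pi_cls (Suc k)"
  by (auto intro!: exI[of _ 0])

lemma Exists_in_Sigma: "\<phi> \<in> Sigma_cls (Suc k) \<Longrightarrow> Exists \<phi> \<in> Sigma_cls (Suc k)"
  by simp (metis comp_apply funpow.simps(2))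

lemma Forall_in_Pi: "\<phi> \<in> Pi_cls (Suc k) \<Longrightarrow> Forall \<phi> \<in> Pi_cls (Suc k)"
  by simp (metis comp_apply funpow.simps(2))

text \<open>Replaces induction on the length of the outer block, so that each step moves a single
  quantifier.\<close>

lemma Sigma_Suc_induct [consumes 1, case_names Pi Exists]:
  assumes "\<phi> \<in> Sigma_cls (Suc k)" "\<And>\<phi>. \<phi> \<in> Pi_cls k \<Longrightarrow> P \<phi>"
    and "\<And>\<phi>. \<phi> \<in> Sigma_cls (Suc k) \<Longrightarrow> P \<phi> \<Longrightarrow> P (Exists \<phi>)"
  shows "P \<phi>"
proof -
  obtain n \<psi> where \<phi>: "\<phi> = (Exists ^^ n) \<psi>" "\<psi> \<in> Pi_cls k" using assms(1) by auto
  have "(Exists ^^ n) \<psi> \<in> Sigma_cls (Suc k) \<and> P ((Exists ^^ n) \<psi>)"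
  proof (induction n)
    case 0
    then show ?case using \<phi>(2) assms(2) Pi_sub_Sigma by auto
  next
    case (Suc n)
    then show ?case using assms(3) Exists_in_Sigma by (simp del: Sigma_cls.simps)
  qed
  then show ?thesis using \<phi>(1) by simp
qed

lemma Pi_Suc_induct [consumes 1, case_names Sigma Forall]:
  assumes "\<phi> \<in> Pi_cls (Suc k)" "\<And>\<phi>. \<phi> \<in> Sigma_cls k \<Longrightarrow> P \<phi>"
    and "\<And>\<phi>. \<phi> \<in> Pi_cls (Suc k) \<Longrightarrow> P \<phi> \<Longrightarrow> P (Forall \<phi>)"
  shows "P \<phi>"
proof -
  obtain n \<psi> where \<phi>: "\<phi> = (Forall ^^ n) \<psi>" "\<psi> \<in> Sigma_cls k" using assms(1) by auto
  have "(Forall ^^ n) \<psi> \<in> Pi_cls (Suc k) \<and> P ((Forall ^^ n) \<psi>)"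
  proof (induction n)
    case 0
    then show ?case using \<phi>(2) assms(2) Sigma_sub_Pi by auto
  next
    case (Suc n)
    then show ?case using assms(3) Forall_in_Pi by (simp del: Pi_cls.simps)
  qed
  then show ?thesis using \<phi>(1) by simp
qed

declare Sigma_cls.simps(2) [simp del] Pi_cls.simps(2) [simp del]

lemma Sigma_Pi_mono:
  "(\<phi> \<in> Sigma_cls k \<longrightarrow> \<phi> \<in> Sigma_cls (Suc k)) \<and> (\<phi> \<in> Pi_cls k \<longrightarrow> \<phi> \<in> Pi_cls (Suc k))"
proof (induction k arbitrary: \<phi>)
  case 0
  then show ?case using Pi_sub_Sigma[of \<phi> 0] Sigma_sub_Pi[of \<phi> 0] by simp
next
  case (Suc k)
  have "\<phi> \<in> Sigma_cls (Suc (Suc k))" if "\<phi> \<in> Sigma_cls (Suc k)"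
    using that by (induction rule: Sigma_Suc_induct) (use Suc Pi_sub_Sigma Exists_in_Sigma in blast)+
  moreover have "\<phi> \<in> Pi_cls (Suc (Suc k))" if "\<phi> \<in> Pi_cls (Suc k)"
    using that by (induction rule: Pi_Suc_induct) (use Suc Sigma_sub_Pi Forall_in_Pi in blast)+
  ultimately show ?case by blast
qed

lemma Sigma_mono: "\<phi> \<in> Sigma_cls k \<Longrightarrow> \<phi> \<in> Sigma_cls (Suc k)"
  and Pi_mono: "\<phi> \<in> Pi_cls k \<Longrightarrow> \<phi> \<in> Pi_cls (Suc k)"
  using Sigma_Pi_mono by auto

lemma qf_subst [simp]: "qf (subst \<sigma> \<phi>) = qf \<phi>"
  by (induction \<phi> arbitrary: \<sigma>) auto

lemma qf_in_Sigma_Pi: "wf_fm \<phi> \<Longrightarrow> qf \<phi> \<Longrightarrow> \<phi> \<in> Sigma_cls k \<and> \<phi> \<in> Pi_cls k"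
  by (induction k) (auto intro: Sigma_mono Pi_mono)

lemma Sigma_Pi_subst:
  assumes "\<And>n. wf_tm (\<sigma> n)"
  shows "(\<phi> \<in> Sigma_cls k \<longrightarrow> subst \<sigma> \<phi> \<in> Sigma_cls k) \<and> (\<phi> \<in> Pi_cls k \<longrightarrow> subst \<sigma> \<phi> \<in> Pi_cls k)"
  using assms
proof (induction k arbitrary: \<phi> \<sigma>)
  case 0
  then show ?case by (simp add: wf_subst)
next
  case (Suc k)
  have "subst \<sigma> \<phi> \<in> Sigma_cls (Suc k)" if "\<phi> \<in> Sigma_cls (Suc k)"
    using that Suc.prems
  proof (induction arbitrary: \<sigma> rule: Sigma_Suc_induct)
    case (Pi \<phi>)
    then show ?case using Suc.IH Pi_sub_Sigma by blast
  next
    case (Exists \<phi>)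
    then show ?case by (simp add: Exists_in_Sigma wf_up)
  qed
  moreover have "subst \<sigma> \<phi> \<in> Pi_cls (Suc k)" if "\<phi> \<in> Pi_cls (Suc k)"
    using that Suc.prems
  proof (induction arbitrary: \<sigma> rule: Pi_Suc_induct)
    case (Sigma \<phi>)
    then show ?case using Suc.IH Sigma_sub_Pi by blast
  next
    case (Forall \<phi>)
    then show ?case by (simp add: Forall_in_Pi wf_up)
  qed
  ultimately show ?case by blast
qed

lemma Sigma_subst: "\<phi> \<in> Sigma_cls k \<Longrightarrow> (\<And>n. wf_tm (\<sigma> n)) \<Longrightarrow> subst \<sigma> \<phi> \<in> Sigma_cls k"
  and Pi_subst: "\<phi> \<in> Pi_cls k \<Longrightarrow> (\<And>n. wf_tm (\<sigma> n)) \<Longrightarrow> subst \<sigma> \<phi> \<in> Pi_cls k"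
  using Sigma_Pi_subst by auto

lemma Sigma_lift: "\<phi> \<in> Sigma_cls k \<Longrightarrow> lift \<phi> \<in> Sigma_cls k"
  and Pi_lift: "\<phi> \<in> Pi_cls k \<Longrightarrow> lift \<phi> \<in> Pi_cls k"
  by (simp_all add: lift_def Sigma_subst Pi_subst)

section \<open>Quantifier shifts, normal forms and closure under conjunction\<close>

context arith_theory
begin

text \<open>Currying moves \<open>\<psi>\<close> to the right, so that the existential formula
  stands alone on the left and can be eliminated.\<close>

lemma Exists_Conj_lift:
  assumes "wf_fm \<phi>" "wf_fm \<psi>"
  shows "Conj (Exists \<phi>) \<psi> \<approx> Exists (Conj \<phi> (lift \<psi>))"
proof -
  let ?\<chi> = "Exists (Conj \<phi> (lift \<psi>))"
  have "Conj \<phi> (lift \<psi>) \<sqsubseteq> lift ?\<chi>" using assms by (intro le_lift_Exists) simp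
  then have "\<phi> \<sqsubseteq> lift (Imp \<psi> ?\<chi>)" by (simp add: le_Imp_iff)
  then have "Exists \<phi> \<sqsubseteq> Imp \<psi> ?\<chi>" using assms by (subst Exists_le_iff) simp_all
  then have "Conj (Exists \<phi>) \<psi> \<sqsubseteq> ?\<chi>" by (simp only: le_Imp_iff)
  moreover have "Conj \<phi> (lift \<psi>) \<sqsubseteq> lift (Conj (Exists \<phi>) \<psi>)"
    using assms by (simp add: Conj_mono le_lift_Exists le_refl)
  ultimately show ?thesis using assms by (simp add: eqv_def Exists_le_iff)
qed

lemma Forall_Conj_lift:
  assumes "wf_fm \<phi>" "wf_fm \<psi>"
  shows "Conj (Forall \<phi>) \<psi> \<approx> Forall (Conj \<phi> (lift \<psi>))"
proof -
  let ?\<chi> = "Forall (Conj \<phi> (lift \<psi>))"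
  have "lift (Conj (Forall \<phi>) \<psi>) \<sqsubseteq> Conj \<phi> (lift \<psi>)"
    using assms by (simp add: Conj_mono lift_Forall_le le_refl)
  moreover have "lift ?\<chi> \<sqsubseteq> Conj \<phi> (lift \<psi>)" using assms by (intro lift_Forall_le) simp
  then have "?\<chi> \<sqsubseteq> Forall \<phi>" using assms by (simp add: le_Forall_iff le_Conj_iff)
  moreover have "?\<chi> \<sqsubseteq> \<psi>"
  proof -
    \<comment> \<open>The domain is inhabited: instantiating the dummy variable by zero extracts
      \<open>\<psi>\<close> from the universal formula.\<close>
    have "inst zero (lift ?\<chi>) \<sqsubseteq> inst zero (lift \<psi>)"
      using \<open>lift ?\<chi> \<sqsubseteq> Conj \<phi> (lift \<psi>)\<close> by (intro le_inst) (auto simp: le_Conj_iff)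
    then show ?thesis by simp
  qed
  ultimately show ?thesis using assms by (simp add: eqv_def le_Conj_iff le_Forall_iff)
qed

text \<open>Shifting \<open>Forall\<close> out of a disjunction in this way is not
  intuitionistically valid. Disjunctions of \<open>Pi_cls\<close> formulas are therefore treated by
  De Morgan and stability.\<close>

lemma Exists_Disj_lift:
  assumes "wf_fm \<phi>" "wf_fm \<psi>"
  shows "Disj (Exists \<phi>) \<psi> \<approx> Exists (Disj \<phi> (lift \<psi>))"
proof -
  let ?\<chi> = "Exists (Disj \<phi> (lift \<psi>))"
  have *: "Disj \<phi> (lift \<psi>) \<sqsubseteq> lift ?\<chi>" using assms by (intro le_lift_Exists) simp
  then have "inst zero (lift \<psi>) \<sqsubseteq> inst zero (lift ?\<chi>)"
    by (intro le_inst) (auto simp: Disj_le_iff)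
  moreover have "Exists \<phi> \<sqsubseteq> ?\<chi>" using * assms by (simp add: Disj_le_iff Exists_le_iff)
  moreover have "Disj \<phi> (lift \<psi>) \<sqsubseteq> lift (Disj (Exists \<phi>) \<psi>)"
    using assms by (simp add: Disj_mono le_lift_Exists le_refl)
  ultimately show ?thesis using assms by (simp add: eqv_def Disj_le_iff Exists_le_iff)
qed

lemma Conj_commute: "wf_fm \<phi> \<Longrightarrow> wf_fm \<psi> \<Longrightarrow> Conj \<phi> \<psi> \<approx> Conj \<psi> \<phi>"
  by (simp add: eqv_def le_Conj_iff Conj_le)

lemma Disj_commute: "wf_fm \<phi> \<Longrightarrow> wf_fm \<psi> \<Longrightarrow> Disj \<phi> \<psi> \<approx> Disj \<psi> \<phi>"
  by (simp add: eqv_def Disj_le_iff le_Disj)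

text \<open>The prefix \<open>w\<close> marks normal forms up to \<open>\<sim>\<close> only.\<close>

definition to_Sigma :: "nat \<Rightarrow> fm \<Rightarrow> bool" where
  "to_Sigma k \<phi> \<longleftrightarrow> (\<exists>\<phi>'\<in>Sigma_cls k. FV \<phi> = FV \<phi>' \<and> \<phi> \<approx> \<phi>')"

definition to_Pi :: "nat \<Rightarrow> fm \<Rightarrow> bool" where
  "to_Pi k \<phi> \<longleftrightarrow> (\<exists>\<phi>'\<in>Pi_cls k. FV \<phi> = FV \<phi>' \<and> \<phi> \<approx> \<phi>')"

definition wto_Sigma :: "nat \<Rightarrow> fm \<Rightarrow> bool" where
  "wto_Sigma k \<phi> \<longleftrightarrow> (\<exists>\<phi>'\<in>Sigma_cls k. FV \<phi> = FV \<phi>' \<and> \<phi> \<sim> \<phi>')"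

definition wto_Pi :: "nat \<Rightarrow> fm \<Rightarrow> bool" where
  "wto_Pi k \<phi> \<longleftrightarrow> (\<exists>\<phi>'\<in>Pi_cls k. FV \<phi> = FV \<phi>' \<and> \<phi> \<sim> \<phi>')"

lemma to_Sigma_eqv: "to_Sigma k \<psi> \<Longrightarrow> \<phi> \<approx> \<psi> \<Longrightarrow> FV \<phi> = FV \<psi> \<Longrightarrow> to_Sigma k \<phi>"
  unfolding to_Sigma_def using eqv_trans by metis

lemma to_Pi_eqv: "to_Pi k \<psi> \<Longrightarrow> \<phi> \<approx> \<psi> \<Longrightarrow> FV \<phi> = FV \<psi> \<Longrightarrow> to_Pi k \<phi>"
  unfolding to_Pi_def using eqv_trans by metis

lemma wto_Sigma_weqv: "wto_Sigma k \<psi> \<Longrightarrow> \<phi> \<sim> \<psi> \<Longrightarrow> FV \<phi> = FV \<psi> \<Longrightarrow> wto_Sigma k \<phi>"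
  unfolding wto_Sigma_def using weqv_trans by metis

lemma wto_Pi_weqv: "wto_Pi k \<psi> \<Longrightarrow> \<phi> \<sim> \<psi> \<Longrightarrow> FV \<phi> = FV \<psi> \<Longrightarrow> wto_Pi k \<phi>"
  unfolding wto_Pi_def using weqv_trans by metis

lemma to_Sigma_Sigma: "\<phi> \<in> Sigma_cls k \<Longrightarrow> to_Sigma k \<phi>"
  unfolding to_Sigma_def using Sigma_wf eqv_refl by blast

lemma to_Pi_Pi: "\<phi> \<in> Pi_cls k \<Longrightarrow> to_Pi k \<phi>"
  unfolding to_Pi_def using Pi_wf eqv_refl by blast

lemma to_Sigma_imp_wto_Sigma: "to_Sigma k \<phi> \<Longrightarrow> wto_Sigma k \<phi>"
  unfolding to_Sigma_def wto_Sigma_def using eqv_imp_weqv by blast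

lemma to_Pi_imp_wto_Pi: "to_Pi k \<phi> \<Longrightarrow> wto_Pi k \<phi>"
  unfolding to_Pi_def wto_Pi_def using eqv_imp_weqv by blast

lemma to_Pi_imp_to_Sigma_Suc: "to_Pi k \<phi> \<Longrightarrow> to_Sigma (Suc k) \<phi>"
  unfolding to_Pi_def to_Sigma_def using Pi_sub_Sigma by blast

lemma to_Sigma_imp_to_Pi_Suc: "to_Sigma k \<phi> \<Longrightarrow> to_Pi (Suc k) \<phi>"
  unfolding to_Pi_def to_Sigma_def using Sigma_sub_Pi by blast

lemma wto_Pi_imp_wto_Sigma_Suc: "wto_Pi k \<phi> \<Longrightarrow> wto_Sigma (Suc k) \<phi>"
  unfolding wto_Pi_def wto_Sigma_def using Pi_sub_Sigma by blast

lemma wto_Sigma_imp_wto_Pi_Suc: "wto_Sigma k \<phi> \<Longrightarrow> wto_Pi (Suc k) \<phi>"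
  unfolding wto_Pi_def wto_Sigma_def using Sigma_sub_Pi by blast

lemma wto_Sigma_wf: "wto_Sigma k \<phi> \<Longrightarrow> wf_fm \<phi>" and wto_Pi_wf: "wto_Pi k \<phi> \<Longrightarrow> wf_fm \<phi>"
  by (auto simp: wto_Sigma_def wto_Pi_def weqv_def dest: wle_wf)

lemma to_Sigma_Exists: "to_Sigma (Suc k) \<phi> \<Longrightarrow> to_Sigma (Suc k) (Exists \<phi>)"
proof -
  assume "to_Sigma (Suc k) \<phi>"
  then obtain \<phi>' where "\<phi>' \<in> Sigma_cls (Suc k)" "FV \<phi> = FV \<phi>'" "\<phi> \<approx> \<phi>'"
    by (auto simp: to_Sigma_def)
  then show ?thesis
    unfolding to_Sigma_def by (intro bexI[of _ "Exists \<phi>'"] conjI eqv_cong Exists_in_Sigma) auto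
qed

lemma to_Pi_Forall: "to_Pi (Suc k) \<phi> \<Longrightarrow> to_Pi (Suc k) (Forall \<phi>)"
proof -
  assume "to_Pi (Suc k) \<phi>"
  then obtain \<phi>' where "\<phi>' \<in> Pi_cls (Suc k)" "FV \<phi> = FV \<phi>'" "\<phi> \<approx> \<phi>'"
    by (auto simp: to_Pi_def)
  then show ?thesis
    unfolding to_Pi_def by (intro bexI[of _ "Forall \<phi>'"] conjI eqv_cong Forall_in_Pi) auto
qed

lemma wto_Sigma_Exists: "wto_Sigma (Suc k) \<phi> \<Longrightarrow> wto_Sigma (Suc k) (Exists \<phi>)"
proof -
  assume "wto_Sigma (Suc k) \<phi>"
  then obtain \<phi>' where "\<phi>' \<in> Sigma_cls (Suc k)" "FV \<phi> = FV \<phi>'" "\<phi> \<sim> \<phi>'"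
    by (auto simp: wto_Sigma_def)
  then show ?thesis
    unfolding wto_Sigma_def by (intro bexI[of _ "Exists \<phi>'"] conjI weqv_cong Exists_in_Sigma) auto
qed

text \<open>The existential quantifiers of the first formula are moved out, then those of the second
  after commuting; the first premise settles what remains.\<close>

lemma to_Sigma_Conj_Sigma_step:
  assumes "\<And>\<phi> \<psi>. \<phi> \<in> Pi_cls k \<Longrightarrow> \<psi> \<in> Pi_cls k \<Longrightarrow> to_Sigma (Suc k) (Conj \<phi> \<psi>)"
    and "\<phi> \<in> Sigma_cls (Suc k)" "\<psi> \<in> Sigma_cls (Suc k)"
  shows "to_Sigma (Suc k) (Conj \<phi> \<psi>)"
  using assms(2,3)
proof (induction arbitrary: \<psi> rule: Sigma_Suc_induct)
  case (Pi \<phi>)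
  from Pi(2,1) show ?case
  proof (induction arbitrary: \<phi> rule: Sigma_Suc_induct)
    case (Pi \<psi>)
    then show ?case using assms(1) by blast
  next
    case (Exists \<psi>)
    have wf: "wf_fm \<phi>" "wf_fm \<psi>" using Exists Sigma_wf Pi_wf by auto
    have "Conj \<phi> (Exists \<psi>) \<approx> Conj (Exists \<psi>) \<phi>" using wf by (simp add: Conj_commute)
    also have "\<dots> \<approx> Exists (Conj \<psi> (lift \<phi>))" using wf by (simp add: Exists_Conj_lift)
    also have "\<dots> \<approx> Exists (Conj (lift \<phi>) \<psi>)" using wf by (simp add: Conj_commute eqv_cong)
    finally show ?case
      by (rule to_Sigma_eqv[OF to_Sigma_Exists[OF Exists.IH[OF Pi_lift[OF Exists.prems]]]]) auto
  qed
next
  case (Exists \<phi>)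
  then have "wf_fm \<phi>" "wf_fm \<psi>" using Sigma_wf by auto
  from Exists_Conj_lift[OF this] show ?case
    by (rule to_Sigma_eqv[OF to_Sigma_Exists[OF Exists.IH[OF Sigma_lift[OF Exists.prems]]]]) auto
qed

lemma to_Sigma_Disj_Sigma_step:
  assumes "\<And>\<phi> \<psi>. \<phi> \<in> Pi_cls k \<Longrightarrow> \<psi> \<in> Pi_cls k \<Longrightarrow> to_Sigma (Suc k) (Disj \<phi> \<psi>)"
    and "\<phi> \<in> Sigma_cls (Suc k)" "\<psi> \<in> Sigma_cls (Suc k)"
  shows "to_Sigma (Suc k) (Disj \<phi> \<psi>)"
  using assms(2,3)
proof (induction arbitrary: \<psi> rule: Sigma_Suc_induct)
  case (Pi \<phi>)
  from Pi(2,1) show ?case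
  proof (induction arbitrary: \<phi> rule: Sigma_Suc_induct)
    case (Pi \<psi>)
    then show ?case using assms(1) by blast
  next
    case (Exists \<psi>)
    have wf: "wf_fm \<phi>" "wf_fm \<psi>" using Exists Sigma_wf Pi_wf by auto
    have "Disj \<phi> (Exists \<psi>) \<approx> Disj (Exists \<psi>) \<phi>" using wf by (simp add: Disj_commute)
    also have "\<dots> \<approx> Exists (Disj \<psi> (lift \<phi>))" using wf by (simp add: Exists_Disj_lift)
    also have "\<dots> \<approx> Exists (Disj (lift \<phi>) \<psi>)" using wf by (simp add: Disj_commute eqv_cong)
    finally show ?case
      by (rule to_Sigma_eqv[OF to_Sigma_Exists[OF Exists.IH[OF Pi_lift[OF Exists.prems]]]]) auto
  qed
next
  case (Exists \<phi>)
  then have "wf_fm \<phi>" "wf_fm \<psi>" using Sigma_wf by auto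
  from Exists_Disj_lift[OF this] show ?case
    by (rule to_Sigma_eqv[OF to_Sigma_Exists[OF Exists.IH[OF Sigma_lift[OF Exists.prems]]]]) auto
qed

lemma to_Pi_Conj_Pi_step:
  assumes "\<And>\<phi> \<psi>. \<phi> \<in> Sigma_cls k \<Longrightarrow> \<psi> \<in> Sigma_cls k \<Longrightarrow> to_Pi (Suc k) (Conj \<phi> \<psi>)"
    and "\<phi> \<in> Pi_cls (Suc k)" "\<psi> \<in> Pi_cls (Suc k)"
  shows "to_Pi (Suc k) (Conj \<phi> \<psi>)"
  using assms(2,3)
proof (induction arbitrary: \<psi> rule: Pi_Suc_induct)
  case (Sigma \<phi>)
  from Sigma(2,1) show ?case
  proof (induction arbitrary: \<phi> rule: Pi_Suc_induct)
    case (Sigma \<psi>)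
    then show ?case using assms(1) by blast
  next
    case (Forall \<psi>)
    have wf: "wf_fm \<phi>" "wf_fm \<psi>" using Forall Sigma_wf Pi_wf by auto
    have "Conj \<phi> (Forall \<psi>) \<approx> Conj (Forall \<psi>) \<phi>" using wf by (simp add: Conj_commute)
    also have "\<dots> \<approx> Forall (Conj \<psi> (lift \<phi>))" using wf by (simp add: Forall_Conj_lift)
    also have "\<dots> \<approx> Forall (Conj (lift \<phi>) \<psi>)" using wf by (simp add: Conj_commute eqv_cong)
    finally show ?case
      by (rule to_Pi_eqv[OF to_Pi_Forall[OF Forall.IH[OF Sigma_lift[OF Forall.prems]]]]) auto
  qed
next
  case (Forall \<phi>)
  then have "wf_fm \<phi>" "wf_fm \<psi>" using Pi_wf by auto
  from Forall_Conj_lift[OF this] show ?case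
    by (rule to_Pi_eqv[OF to_Pi_Forall[OF Forall.IH[OF Pi_lift[OF Forall.prems]]]]) auto
qed

text \<open>Both kinds of quantifier shift over a conjunction are intuitionistic equivalences, so
  this closure is exact in every theory.\<close>

lemma Conj_Sigma_Pi:
  "(\<phi> \<in> Sigma_cls k \<longrightarrow> \<psi> \<in> Sigma_cls k \<longrightarrow> to_Sigma k (Conj \<phi> \<psi>)) \<and>
   (\<phi> \<in> Pi_cls k \<longrightarrow> \<psi> \<in> Pi_cls k \<longrightarrow> to_Pi k (Conj \<phi> \<psi>))"
proof (induction k arbitrary: \<phi> \<psi>)
  case 0
  then show ?case by (auto intro!: to_Sigma_Sigma to_Pi_Pi)
next
  case (Suc k)
  then show ?case
    using to_Sigma_Conj_Sigma_step[of k \<phi> \<psi>] to_Pi_Conj_Pi_step[of k \<phi> \<psi>] to_Pi_imp_to_Sigma_Suc to_Sigma_imp_to_Pi_Suc by blast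
qed

lemma to_Sigma_Conj:
  assumes "to_Sigma k \<phi>" "to_Sigma k \<psi>"
  shows "to_Sigma k (Conj \<phi> \<psi>)"
proof -
  obtain \<phi>' \<psi>' where *: "\<phi>' \<in> Sigma_cls k" "FV \<phi> = FV \<phi>'" "\<phi> \<approx> \<phi>'"
    "\<psi>' \<in> Sigma_cls k" "FV \<psi> = FV \<psi>'" "\<psi> \<approx> \<psi>'"
    using assms by (auto simp: to_Sigma_def)
  then have "to_Sigma k (Conj \<phi>' \<psi>')" using Conj_Sigma_Pi by blast
  then show ?thesis by (rule to_Sigma_eqv[OF _ eqv_cong(1)]) (use * in simp_all)
qed

lemma to_Pi_Conj:
  assumes "to_Pi k \<phi>" "to_Pi k \<psi>"
  shows "to_Pi k (Conj \<phi> \<psi>)"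
proof -
  obtain \<phi>' \<psi>' where *: "\<phi>' \<in> Pi_cls k" "FV \<phi> = FV \<phi>'" "\<phi> \<approx> \<phi>'"
    "\<psi>' \<in> Pi_cls k" "FV \<psi> = FV \<psi>'" "\<psi> \<approx> \<psi>'"
    using assms by (auto simp: to_Pi_def)
  then have "to_Pi k (Conj \<phi>' \<psi>')" using Conj_Sigma_Pi by blast
  then show ?thesis by (rule to_Pi_eqv[OF _ eqv_cong(1)]) (use * in simp_all)
qed

lemma wto_Sigma_Conj:
  assumes "wto_Sigma k \<phi>" "wto_Sigma k \<psi>"
  shows "wto_Sigma k (Conj \<phi> \<psi>)"
proof -
  obtain \<phi>' \<psi>' where *: "\<phi>' \<in> Sigma_cls k" "FV \<phi> = FV \<phi>'" "\<phi> \<sim> \<phi>'"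
    "\<psi>' \<in> Sigma_cls k" "FV \<psi> = FV \<psi>'" "\<psi> \<sim> \<psi>'"
    using assms by (auto simp: wto_Sigma_def)
  then have "wto_Sigma k (Conj \<phi>' \<psi>')" using Conj_Sigma_Pi to_Sigma_imp_wto_Sigma by blast
  then show ?thesis by (rule wto_Sigma_weqv[OF _ weqv_cong(1)]) (use * in simp_all)
qed

lemma wto_Pi_Conj:
  assumes "wto_Pi k \<phi>" "wto_Pi k \<psi>"
  shows "wto_Pi k (Conj \<phi> \<psi>)"
proof -
  obtain \<phi>' \<psi>' where *: "\<phi>' \<in> Pi_cls k" "FV \<phi> = FV \<phi>'" "\<phi> \<sim> \<phi>'"
    "\<psi>' \<in> Pi_cls k" "FV \<psi> = FV \<psi>'" "\<psi> \<sim> \<psi>'"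
    using assms by (auto simp: wto_Pi_def)
  then have "wto_Pi k (Conj \<phi>' \<psi>')" using Conj_Sigma_Pi to_Pi_imp_wto_Pi by blast
  then show ?thesis by (rule wto_Pi_weqv[OF _ weqv_cong(1)]) (use * in simp_all)
qed

section \<open>Closure properties under double negation elimination\<close>

definition stab :: "nat \<Rightarrow> bool" where
  "stab k \<longleftrightarrow> (\<forall>\<phi>\<in>Sigma_cls k. stable \<phi>)"

lemma stab_le: "stab k \<Longrightarrow> j \<le> k \<Longrightarrow> stab j"
  by (rule inc_induct) (auto simp: stab_def intro: Sigma_mono)

text \<open>Universal quantification preserves stability, so DNE at level k reaches one level
  further on the universal side.\<close>

lemma stab_Pi_Suc: "stab k \<Longrightarrow> \<phi> \<in> Pi_cls (Suc k) \<Longrightarrow> stable \<phi>"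
  by (rotate_tac, induction rule: Pi_Suc_induct) (auto simp: stab_def stable_Forall)

lemma wto_Sigma_stable: "wto_Sigma k \<phi> \<Longrightarrow> stable \<phi> \<Longrightarrow> stab k \<Longrightarrow> to_Sigma k \<phi>"
  unfolding wto_Sigma_def to_Sigma_def stab_def using weqv_stable by blast

lemma wto_Pi_stable: "wto_Pi k \<phi> \<Longrightarrow> stable \<phi> \<Longrightarrow> (\<And>\<psi>. \<psi> \<in> Pi_cls k \<Longrightarrow> stable \<psi>) \<Longrightarrow> to_Pi k \<phi>"
  unfolding wto_Pi_def to_Pi_def using weqv_stable by blast

lemma Neg_Exists: "wf_fm \<phi> \<Longrightarrow> Neg (Exists \<phi>) \<approx> Forall (Neg \<phi>)"
proof -
  assume wf: "wf_fm \<phi>"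
  have "lift (Neg (Exists \<phi>)) \<sqsubseteq> Neg \<phi>" using le_lift_Exists[OF wf] by (simp add: Neg_antimono)
  moreover have "Exists \<phi> \<sqsubseteq> Neg (Forall (Neg \<phi>))"
    using lift_Forall_le[of "Neg \<phi>"] wf by (simp add: Exists_le_iff le_Neg_flip)
  ultimately show ?thesis using wf by (simp add: eqv_def le_Forall_iff le_Neg_flip)
qed

text \<open>Stability removes the double negation under the quantifier that
  \<open>Neg_Exists\<close> leaves behind.\<close>

lemma Neg_Forall: "stable \<phi> \<Longrightarrow> Neg (Forall \<phi>) \<sim> Exists (Neg \<phi>)"
proof -
  assume s: "stable \<phi>"
  note wf = stable_wf[OF s]
  have "Neg (Exists (Neg \<phi>)) \<sqsubseteq> Forall (Neg (Neg \<phi>))" using Neg_Exists[of "Neg \<phi>"] wf by (simp add: eqv_def)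
  also have "\<dots> \<sqsubseteq> Forall \<phi>" using s by (simp add: stable_def Forall_mono)
  finally have "Neg (Forall \<phi>) \<lesssim> Exists (Neg \<phi>)" by (simp add: wle_def Neg_antimono)
  moreover have "Exists (Neg \<phi>) \<sqsubseteq> Neg (Forall \<phi>)"
    using lift_Forall_le[OF wf] wf by (simp add: Exists_le_iff Neg_antimono)
  ultimately show ?thesis by (simp add: weqv_def le_imp_wle)
qed

lemma Neg_Sigma_Pi:
  assumes "\<And>j. j < k \<Longrightarrow> stab j"
  shows "(\<phi> \<in> Sigma_cls k \<longrightarrow> wto_Pi k (Neg \<phi>)) \<and> (\<phi> \<in> Pi_cls k \<longrightarrow> wto_Sigma k (Neg \<phi>))"
  using assms
proof (induction k arbitrary: \<phi>)
  case 0
  then show ?case by (auto intro!: to_Sigma_imp_wto_Sigma to_Pi_imp_wto_Pi to_Sigma_Sigma to_Pi_Pi)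
next
  case (Suc k)
  then have k: "stab k" by simp
  have IH: "\<And>\<phi>. (\<phi> \<in> Sigma_cls k \<longrightarrow> wto_Pi k (Neg \<phi>)) \<and> (\<phi> \<in> Pi_cls k \<longrightarrow> wto_Sigma k (Neg \<phi>))"
    using Suc by simp
  have "wto_Pi (Suc k) (Neg \<phi>)" if "\<phi> \<in> Sigma_cls (Suc k)"
    using that
  proof (induction rule: Sigma_Suc_induct)
    case (Pi \<phi>)
    then show ?case using IH wto_Sigma_imp_wto_Pi_Suc by blast
  next
    case (Exists \<phi>)
    have wf: "wf_fm \<phi>" using Exists Sigma_wf by blast
    \<comment> \<open>\<open>Forall\<close> is not a congruence for \<open>\<sim>\<close>. Since a
      negation and every \<open>Pi_cls (Suc k)\<close> formula are stable, the induction hypothesis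
      is first upgraded to \<open>\<approx>\<close>.\<close>
    have "to_Pi (Suc k) (Neg \<phi>)"
      by (rule wto_Pi_stable[OF Exists.IH stable_Neg[OF wf] stab_Pi_Suc[OF k]])
    then have "wto_Pi (Suc k) (Forall (Neg \<phi>))" by (intro to_Pi_imp_wto_Pi to_Pi_Forall)
    then show ?case by (rule wto_Pi_weqv[OF _ eqv_imp_weqv[OF Neg_Exists[OF wf]]]) simp
  qed
  moreover have "wto_Sigma (Suc k) (Neg \<phi>)" if "\<phi> \<in> Pi_cls (Suc k)"
    using that
  proof (induction rule: Pi_Suc_induct)
    case (Sigma \<phi>)
    then show ?case using IH wto_Pi_imp_wto_Sigma_Suc by blast
  next
    case (Forall \<phi>)
    then show ?case
      by (intro wto_Sigma_weqv[OF wto_Sigma_Exists[OF Forall.IH] Neg_Forall[OF stab_Pi_Suc[OF k Forall.hyps]]]) simp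
  qed
  ultimately show ?case by blast
qed

context
  fixes k :: nat
  assumes below: "\<And>j. j < k \<Longrightarrow> stab j"
begin

lemma wto_Pi_Neg: "wto_Sigma k \<phi> \<Longrightarrow> wto_Pi k (Neg \<phi>)"
proof -
  assume "wto_Sigma k \<phi>"
  then obtain \<phi>' where *: "\<phi>' \<in> Sigma_cls k" "FV \<phi> = FV \<phi>'" "\<phi> \<sim> \<phi>'" by (auto simp: wto_Sigma_def)
  then have "wto_Pi k (Neg \<phi>')" using Neg_Sigma_Pi[OF below] by blast
  then show ?thesis by (rule wto_Pi_weqv[OF _ weqv_Neg]) (use * in simp_all)
qed

lemma wto_Sigma_Neg: "wto_Pi k \<phi> \<Longrightarrow> wto_Sigma k (Neg \<phi>)"
proof -
  assume "wto_Pi k \<phi>"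
  then obtain \<phi>' where *: "\<phi>' \<in> Pi_cls k" "FV \<phi> = FV \<phi>'" "\<phi> \<sim> \<phi>'" by (auto simp: wto_Pi_def)
  then have "wto_Sigma k (Neg \<phi>')" using Neg_Sigma_Pi[OF below] by blast
  then show ?thesis by (rule wto_Sigma_weqv[OF _ weqv_Neg]) (use * in simp_all)
qed

lemma wto_Sigma_Disj: "wto_Sigma k \<phi> \<Longrightarrow> wto_Sigma k \<psi> \<Longrightarrow> wto_Sigma k (Disj \<phi> \<psi>)"
  by (rule wto_Sigma_weqv[OF wto_Sigma_Neg[OF wto_Pi_Conj[OF wto_Pi_Neg wto_Pi_Neg]] Disj_weqv]) (auto dest: wto_Sigma_wf)

lemma wto_Pi_Disj: "wto_Pi k \<phi> \<Longrightarrow> wto_Pi k \<psi> \<Longrightarrow> wto_Pi k (Disj \<phi> \<psi>)"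
  by (rule wto_Pi_weqv[OF wto_Pi_Neg[OF wto_Sigma_Conj[OF wto_Sigma_Neg wto_Sigma_Neg]] Disj_weqv]) (auto dest: wto_Pi_wf)

lemma wto_Sigma_Imp: "wto_Pi k \<phi> \<Longrightarrow> wto_Sigma k \<psi> \<Longrightarrow> wto_Sigma k (Imp \<phi> \<psi>)"
  by (rule wto_Sigma_weqv[OF wto_Sigma_Neg[OF wto_Pi_Conj[OF _ wto_Pi_Neg]] Imp_weqv]) (auto dest: wto_Sigma_wf wto_Pi_wf)

lemma wto_Pi_Imp: "wto_Sigma k \<phi> \<Longrightarrow> wto_Pi k \<psi> \<Longrightarrow> wto_Pi k (Imp \<phi> \<psi>)"
  by (rule wto_Pi_weqv[OF wto_Pi_Neg[OF wto_Sigma_Conj[OF _ wto_Sigma_Neg]] Imp_weqv]) (auto dest: wto_Sigma_wf wto_Pi_wf)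

end

section \<open>Exact conversion of disjunctions into existential formulas\<close>

lemma le_excluded_middle:
  assumes "stable (Disj \<phi> (Neg \<phi>))" "wf_fm \<chi>"
  shows "\<chi> \<sqsubseteq> Disj \<phi> (Neg \<phi>)"
proof -
  have wf: "wf_fm \<phi>" using stable_wf[OF assms(1)] by simp
  have "\<chi> \<sqsubseteq> Neg (Neg (Disj \<phi> (Neg \<phi>)))"
  proof (rule le_NegI)
    fix \<omega> assume \<omega>: "\<omega> \<sqsubseteq> Neg (Disj \<phi> (Neg \<phi>))"
    have "\<omega> \<sqsubseteq> Neg \<phi>"
      using le_trans[OF \<omega> Neg_antimono[OF le_Disj(1)]] wf by simp
    then have "\<omega> \<sqsubseteq> Disj \<phi> (Neg \<phi>)" using le_trans le_Disj(2)[of \<phi> "Neg \<phi>"] wf by simp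
    with \<omega> show "\<omega> \<sqsubseteq> Fls" by (rule le_ImpE)
  qed (use wf assms in auto)
  also have "\<dots> \<sqsubseteq> Disj \<phi> (Neg \<phi>)" using assms(1) by (simp add: stable_def)
  finally show ?thesis .
qed

text \<open>The witness names the disjunct: zero proves the formula from \<open>\<phi>\<close>, one
  proves it from \<open>\<psi>\<close>, and the implication for the other disjunct then has a
  refutable premise.\<close>

lemma Disj_eqv_Exists:
  assumes "stab k" "wf_fm \<phi>" "wf_fm \<psi>"
  shows "Disj \<phi> \<psi> \<approx> Exists (Conj (Imp (Eq (Var 0) zero) (lift \<phi>)) (Imp (Neg (Eq (Var 0) zero)) (lift \<psi>)))"
    (is "_ \<approx> Exists ?\<chi>")
proof -
  let ?z = "Eq (Var 0) zero"
  have wf: "wf_fm ?\<chi>" using assms by simp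
  \<comment> \<open>Reading the disjunct off a witness takes a decision of x = 0, here obtained from
    the stability of a quantifier-free disjunction.\<close>
  have "stable (Disj ?z (Neg ?z))"
    using assms(1) qf_in_Sigma_Pi[of "Disj ?z (Neg ?z)" k] by (simp add: stab_def)
  then have "?\<chi> \<sqsubseteq> Disj ?z (Neg ?z)" using wf by (rule le_excluded_middle)
  then have "?\<chi> \<sqsubseteq> lift (Disj \<phi> \<psi>)"
  proof (rule le_DisjE)
    have wf': "wf_fm (lift \<phi>)" "wf_fm (lift \<psi>)" using assms by simp_all
    fix \<omega> assume \<omega>: "\<omega> \<sqsubseteq> ?\<chi>"
    show "\<omega> \<sqsubseteq> lift (Disj \<phi> \<psi>)" if "\<omega> \<sqsubseteq> ?z"
    proof -
      have "\<omega> \<sqsubseteq> lift \<phi>" using le_ImpE[OF _ that] \<omega> by (simp add: le_Conj_iff)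
      then show ?thesis using le_trans[OF _ le_Disj(1)[OF wf']] by simp
    qed
    show "\<omega> \<sqsubseteq> lift (Disj \<phi> \<psi>)" if "\<omega> \<sqsubseteq> Neg ?z"
    proof -
      have "\<omega> \<sqsubseteq> lift \<psi>" using le_ImpE[OF _ that] \<omega> by (simp add: le_Conj_iff)
      then show ?thesis using le_trans[OF _ le_Disj(2)[OF wf']] by simp
    qed
  qed (use assms in simp)
  moreover have inst: "inst t ?\<chi> = Conj (Imp (Eq t zero) \<phi>) (Imp (Neg (Eq t zero)) \<psi>)" for t
    by simp (simp add: inst_def)
  have "\<phi> \<sqsubseteq> Exists ?\<chi>"
  proof -
    have "T \<turnstile> Eq zero zero" by (simp add: proves_def deriv.EqI)
    then have "\<omega> \<sqsubseteq> \<psi>" if "\<omega> \<sqsubseteq> Neg (Eq zero zero)" for \<omega>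
      using le_ImpE[OF that le_proves] le_wf(1)[OF that] le_trans Fls_le assms(3) by blast
    then have "\<phi> \<sqsubseteq> inst zero ?\<chi>"
      unfolding inst using assms le_wf by (auto simp: le_Conj_iff intro!: le_ImpI)
    moreover have "inst zero ?\<chi> \<sqsubseteq> Exists ?\<chi>" using wf by (intro inst_le_Exists) simp_all
    ultimately show ?thesis by (rule le_trans)
  qed
  moreover have "\<psi> \<sqsubseteq> Exists ?\<chi>"
  proof -
    have "Neg (Eq (succ zero) zero) \<in> HA" by (rule HA.Succ_not_zero) simp
    then have "T \<turnstile> Neg (Eq (succ zero) zero)" using HA_sub by (auto simp: proves_def intro: deriv.Ax)
    then have "\<omega> \<sqsubseteq> \<phi>" if "\<omega> \<sqsubseteq> Eq (succ zero) zero" for \<omega>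
      using le_ImpE[OF le_proves that] le_wf(1)[OF that] le_trans Fls_le assms(2) by blast
    then have "\<psi> \<sqsubseteq> inst (succ zero) ?\<chi>"
      unfolding inst using assms le_wf by (auto simp: le_Conj_iff intro!: le_ImpI)
    moreover have "inst (succ zero) ?\<chi> \<sqsubseteq> Exists ?\<chi>" using wf by (intro inst_le_Exists) simp_all
    ultimately show ?thesis by (rule le_trans)
  qed
  ultimately show ?thesis using assms by (simp add: eqv_def Exists_le_iff Disj_le_iff)
qed

text \<open>A quantifier-free premise does not raise the class of an implication, and the
  implication inherits stability from its conclusion, so the matrix stays in \<open>Pi_cls k\<close>
  up to \<open>\<approx>\<close>.\<close>

lemma to_Sigma_Disj_Pi:
  assumes "stab k" "\<phi> \<in> Pi_cls k" "\<psi> \<in> Pi_cls k"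
  shows "to_Sigma (Suc k) (Disj \<phi> \<psi>)"
proof -
  have below: "\<And>j. j < k \<Longrightarrow> stab j" using stab_le[OF assms(1)] by simp
  have Pi: "\<And>\<psi>. \<psi> \<in> Pi_cls k \<Longrightarrow> stable \<psi>" using stab_Pi_Suc[OF assms(1)] Pi_mono by blast
  have *: "to_Pi k (Imp q (lift \<chi>))" if "wf_fm q" "qf q" "\<chi> \<in> Pi_cls k" for q \<chi>
  proof (rule wto_Pi_stable[OF wto_Pi_Imp stable_Imp Pi])
    show "wto_Sigma k q" using that qf_in_Sigma_Pi by (blast intro: to_Sigma_imp_wto_Sigma to_Sigma_Sigma)
    show "wto_Pi k (lift \<chi>)" using that Pi_lift by (blast intro: to_Pi_imp_wto_Pi to_Pi_Pi)
    show "stable (lift \<chi>)" using that Pi_lift Pi by blast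
  qed (use that below in auto)
  have "to_Sigma (Suc k) (Exists (Conj (Imp (Eq (Var 0) zero) (lift \<phi>)) (Imp (Neg (Eq (Var 0) zero)) (lift \<psi>))))"
    by (intro to_Sigma_Exists to_Pi_imp_to_Sigma_Suc to_Pi_Conj *) (use assms in auto)
  then show ?thesis
    by (rule to_Sigma_eqv[OF _ Disj_eqv_Exists[OF assms(1)]]) (use assms Pi_wf in auto)
qed

lemma to_Sigma_Disj:
  assumes "stab k" "to_Sigma (Suc k) \<phi>" "to_Sigma (Suc k) \<psi>"
  shows "to_Sigma (Suc k) (Disj \<phi> \<psi>)"
proof -
  obtain \<phi>' \<psi>' where *: "\<phi>' \<in> Sigma_cls (Suc k)" "FV \<phi> = FV \<phi>'" "\<phi> \<approx> \<phi>'"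
    "\<psi>' \<in> Sigma_cls (Suc k)" "FV \<psi> = FV \<psi>'" "\<psi> \<approx> \<psi>'"
    using assms by (auto simp: to_Sigma_def)
  then have "to_Sigma (Suc k) (Disj \<phi>' \<psi>')" using to_Sigma_Disj_Sigma_step[OF to_Sigma_Disj_Pi[OF assms(1)]] by blast
  then show ?thesis by (rule to_Sigma_eqv[OF _ eqv_cong(2)]) (use * in simp_all)
qed

end

section \<open>Alternation paths\<close>

text \<open>\<open>E_plus\<close> and \<open>U_plus\<close> at once, with \<open>c\<close> the sign
  allowed at the front of a path of maximal length. Excluding the opposite sign, instead of
  demanding \<open>c\<close>, also covers k = 0, where the path is empty.\<close>

definition bounded :: "sign \<Rightarrow> nat \<Rightarrow> fm \<Rightarrow> bool" where
  "bounded c k \<phi> \<longleftrightarrow> (\<forall>s\<in>Alt \<phi>. length s \<le> k \<and> (length s = k \<longrightarrow> first s \<noteq> Some (flip c)))"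

lemma qf_Alt: "qf \<phi> \<Longrightarrow> Alt \<phi> = {[]}"
  by (cases \<phi>) auto

lemma Alt_nonempty: "Alt \<phi> \<noteq> {}"
  by (induction \<phi>) auto

lemma finite_Alt: "finite (Alt \<phi>)"
proof (induction \<phi>)
  case (Forall \<phi>)
  have "Alt (Forall \<phi>) \<subseteq> Alt \<phi> \<union> (#) Minus ` Alt \<phi>" by auto
  then show ?case using Forall by (meson finite_Un finite_imageI finite_subset)
next
  case (Exists \<phi>)
  have "Alt (Exists \<phi>) \<subseteq> Alt \<phi> \<union> (#) Plus ` Alt \<phi>" by auto
  then show ?case using Exists by (meson finite_Un finite_imageI finite_subset)
qed auto

lemma deg_le_iff: "deg \<phi> \<le> k \<longleftrightarrow> (\<forall>s\<in>Alt \<phi>. length s \<le> k)"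
  by (simp add: deg_def finite_Alt Alt_nonempty)

lemma flip_flip [simp]: "flip (flip c) = c"
  by (cases c) auto

lemma first_neq_flip: "s \<noteq> [] \<Longrightarrow> first s \<noteq> Some (flip c) \<longleftrightarrow> first s = Some c"
  by (cases c; cases "hd s") (auto simp: first_def)

lemma F_cls_Un: "(\<Union>i<Suc k. F_cls i) = {\<phi>. wf_fm \<phi> \<and> deg \<phi> \<le> k}"
  by (auto simp: F_cls_def)

lemma bounded_Suc_iff:
  "bounded c (Suc k) \<phi> \<longleftrightarrow> deg \<phi> \<le> k \<or>
    deg \<phi> = Suc k \<and> (\<forall>s\<in>Alt \<phi>. length s = Suc k \<longrightarrow> first s = Some c)"
proof -
  have "first s \<noteq> Some (flip c) \<longleftrightarrow> first s = Some c" if "length s = Suc k" for s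
    using that by (intro first_neq_flip) auto
  then have "bounded c (Suc k) \<phi> \<longleftrightarrow>
      deg \<phi> \<le> Suc k \<and> (\<forall>s\<in>Alt \<phi>. length s = Suc k \<longrightarrow> first s = Some c)"
    unfolding bounded_def deg_le_iff by blast
  moreover have "\<forall>s\<in>Alt \<phi>. length s \<noteq> Suc k" if "deg \<phi> \<le> k"
    using that by (auto simp: deg_le_iff)
  ultimately show ?thesis using le_Suc_eq by metis
qed

lemma bounded_0_iff: "bounded c 0 \<phi> \<longleftrightarrow> deg \<phi> = 0"
  using deg_le_iff[of \<phi> 0] by (auto simp: bounded_def first_def)

lemma U_plus_iff: "\<phi> \<in> U_plus k \<longleftrightarrow> wf_fm \<phi> \<and> bounded Minus k \<phi>"
proof (cases k)
  case (Suc j)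
  show ?thesis
    unfolding U_plus_def Suc Un_iff F_cls_Un bounded_Suc_iff by (auto simp: F_cls_def)
qed (auto simp: U_plus_def bounded_0_iff F_cls_def)

lemma E_plus_iff: "\<phi> \<in> E_plus k \<longleftrightarrow> wf_fm \<phi> \<and> bounded Plus k \<phi>"
proof (cases k)
  case (Suc j)
  show ?thesis
    unfolding E_plus_def Suc Un_iff F_cls_Un bounded_Suc_iff by (auto simp: F_cls_def)
qed (auto simp: E_plus_def bounded_0_iff F_cls_def)

lemma bounded_qf: "qf \<phi> \<Longrightarrow> bounded c k \<phi>"
  by (simp add: bounded_def qf_Alt first_def)

lemma bounded_Suc: "bounded c k \<phi> \<Longrightarrow> bounded c (Suc k) \<phi>"
  by (fastforce simp: bounded_def)

lemma bounded_Conj: "bounded c k (Conj \<phi> \<psi>) \<Longrightarrow> bounded c k \<phi> \<and> bounded c k \<psi>"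
  by (cases "qf (Conj \<phi> \<psi>)") (auto simp: bounded_qf, auto simp: bounded_def split: if_splits)

lemma bounded_Disj: "bounded c k (Disj \<phi> \<psi>) \<Longrightarrow> bounded c k \<phi> \<and> bounded c k \<psi>"
  by (cases "qf (Disj \<phi> \<psi>)") (auto simp: bounded_qf, auto simp: bounded_def split: if_splits)

lemma first_perp: "first (perp s) = map_option flip (first s)"
  by (cases s) (auto simp: first_def perp_def)

lemma bounded_Imp:
  assumes "bounded c k (Imp \<phi> \<psi>)"
  shows "bounded (flip c) k \<phi> \<and> bounded c k \<psi>"
proof (cases "qf (Imp \<phi> \<psi>)")
  case False
  then have sub: "perp ` Alt \<phi> \<subseteq> Alt (Imp \<phi> \<psi>)" "\<psi> \<noteq> Fls \<Longrightarrow> Alt \<psi> \<subseteq> Alt (Imp \<phi> \<psi>)"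
    by auto
  have "bounded (flip c) k \<phi>"
    unfolding bounded_def
  proof
    fix s assume "s \<in> Alt \<phi>"
    then have "length (perp s) \<le> k \<and> (length (perp s) = k \<longrightarrow> first (perp s) \<noteq> Some (flip c))"
      using assms sub(1) unfolding bounded_def by blast
    then show "length s \<le> k \<and> (length s = k \<longrightarrow> first s \<noteq> Some (flip (flip c)))"
      by (auto simp: first_perp) (simp_all add: perp_def)
  qed
  moreover have "bounded c k \<psi>"
    \<comment> \<open>\<open>Alt\<close> drops a conclusion \<open>Fls\<close>, but that formula is
      quantifier-free and hence bounded.\<close>
    by (cases "\<psi> = Fls") (use assms sub(2) in \<open>auto simp: bounded_qf, auto simp: bounded_def\<close>)
  ultimately show ?thesis ..
qed (auto simp: bounded_qf)

lemma bounded_Forall: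
  assumes "bounded Minus k (Forall \<phi>)"
  shows "bounded Minus k \<phi>"
  unfolding bounded_def
proof
  fix s assume s: "s \<in> Alt \<phi>"
  show "length s \<le> k \<and> (length s = k \<longrightarrow> first s \<noteq> Some (flip Minus))"
  proof (cases "first s = Some Minus")
    case True
    then have "s \<in> Alt (Forall \<phi>)" using s by simp
    then show ?thesis using True assms by (auto simp: bounded_def simp del: Alt.simps)
  next
    case False
    then have "Minus # s \<in> Alt (Forall \<phi>)" using s by simp
    then show ?thesis using assms by (force simp: bounded_def simp del: Alt.simps)
  qed
qed

lemma bounded_Exists:
  assumes "bounded Plus k (Exists \<phi>)"
  shows "bounded Plus k \<phi>"
  unfolding bounded_def
proof
  fix s assume s: "s \<in> Alt \<phi>"
  show "length s \<le> k \<and> (length s = k \<longrightarrow> first s \<noteq> Some (flip Plus))"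
  proof (cases "first s = Some Plus")
    case True
    then have "s \<in> Alt (Exists \<phi>)" using s by simp
    then show ?thesis using True assms by (auto simp: bounded_def simp del: Alt.simps)
  next
    case False
    then have "Plus # s \<in> Alt (Exists \<phi>)" using s by simp
    then show ?thesis using assms by (force simp: bounded_def simp del: Alt.simps)
  qed
qed

lemma first_Alt_Forall: "s \<in> Alt (Forall \<phi>) \<Longrightarrow> first s = Some Minus"
  by (auto simp: first_def)

lemma first_Alt_Exists: "s \<in> Alt (Exists \<phi>) \<Longrightarrow> first s = Some Plus"
  by (auto simp: first_def)

text \<open>Every path of a universal formula begins with \<open>Minus\<close>. The bound forbids
  this at length k + 1, so all lengths are at most k, and at length k the sign is the right one for
  \<open>Minus\<close>.\<close>

lemma bounded_Plus_Forall: "bounded Plus (Suc k) (Forall \<phi>) \<Longrightarrow> bounded Minus k (Forall \<phi>)"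
  unfolding bounded_def using first_Alt_Forall[of _ \<phi>] by (auto simp del: Alt.simps simp: le_Suc_eq)

lemma bounded_Minus_Exists: "bounded Minus (Suc k) (Exists \<phi>) \<Longrightarrow> bounded Plus k (Exists \<phi>)"
  unfolding bounded_def using first_Alt_Exists[of _ \<phi>] by (auto simp del: Alt.simps simp: le_Suc_eq)

text \<open>The paths of a quantified formula carry at least the sign of its quantifier.\<close>

lemma bounded_0: "bounded c 0 \<phi> \<Longrightarrow> qf \<phi>"
proof (induction \<phi> arbitrary: c)
  case (Forall \<phi>)
  obtain s where s: "s \<in> Alt (Forall \<phi>)" using Alt_nonempty by blast
  then have "s \<noteq> []" using first_Alt_Forall by (force simp: first_def)
  then show ?case using Forall.prems s by (auto simp: bounded_def simp del: Alt.simps)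
next
  case (Exists \<phi>)
  obtain s where s: "s \<in> Alt (Exists \<phi>)" using Alt_nonempty by blast
  then have "s \<noteq> []" using first_Alt_Exists by (force simp: first_def)
  then show ?case using Exists.prems s by (auto simp: bounded_def simp del: Alt.simps)
qed (simp, simp, (fastforce dest: bounded_Conj bounded_Disj bounded_Imp)+)

text \<open>The clause of \<open>Alt\<close> for \<open>Imp\<close> tests for the conclusion
  \<open>Fls\<close>, so invariance of \<open>Alt\<close> under substitution depends on
  this.\<close>

lemma subst_eq_Fls [simp]: "subst \<sigma> \<phi> = Fls \<longleftrightarrow> \<phi> = Fls"
  by (cases \<phi>) auto

lemma Alt_subst [simp]: "Alt (subst \<sigma> \<phi>) = Alt \<phi>"
  by (induction \<phi> arbitrary: \<sigma>) auto

lemma U_plus_subst: "\<phi> \<in> U_plus k \<Longrightarrow> (\<And>n. wf_tm (\<sigma> n)) \<Longrightarrow> subst \<sigma> \<phi> \<in> U_plus k"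
  by (simp add: U_plus_iff bounded_def wf_subst)

section \<open>Prenex normalization\<close>

context arith_theory
begin

lemma to_Sigma_stable: "to_Sigma k \<phi> \<Longrightarrow> stab k \<Longrightarrow> stable \<phi>"
  unfolding to_Sigma_def stab_def using stable_eqv by blast

lemma to_Pi_stable: "to_Pi (Suc k) \<phi> \<Longrightarrow> stab k \<Longrightarrow> stable \<phi>"
  unfolding to_Pi_def using stable_eqv stab_Pi_Suc by blast

text \<open>The normal form is stable, so passing to it under the quantifier is exact. The way back
  leads only to a double negation under the quantifier, and there the shift is applied.\<close>

lemma wto_Pi_Forall:
  assumes "wto_Pi (Suc k) \<phi>" "stab k" "Forall (Neg (Neg \<phi>)) \<sqsubseteq> Neg (Neg (Forall \<phi>))"
  shows "wto_Pi (Suc k) (Forall \<phi>)"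
proof -
  obtain \<phi>' where \<phi>': "\<phi>' \<in> Pi_cls (Suc k)" "FV \<phi> = FV \<phi>'" "\<phi> \<sim> \<phi>'"
    using assms(1) by (auto simp: wto_Pi_def)
  have "stable \<phi>'" using stab_Pi_Suc[OF assms(2) \<phi>'(1)] .
  then have "Forall \<phi> \<sqsubseteq> Forall \<phi>'"
    using \<phi>'(3) by (intro Forall_mono wle_stable) (simp_all add: weqv_def)
  moreover have "Forall \<phi>' \<sqsubseteq> Forall (Neg (Neg \<phi>))"
    using \<phi>'(3) by (intro Forall_mono) (simp add: weqv_def wle_def)
  then have "Forall \<phi>' \<lesssim> Forall \<phi>" unfolding wle_def using assms(3) by (rule le_trans)
  ultimately have "Forall \<phi> \<sim> Forall \<phi>'" by (simp add: weqv_def le_imp_wle)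
  then show ?thesis
    unfolding wto_Pi_def by (intro bexI[of _ "Forall \<phi>'"]) (simp_all add: \<phi>' Forall_in_Pi)
qed

lemma qf_classes:
  assumes "wf_fm \<phi>" "qf \<phi>"
  shows "to_Sigma k \<phi>" "to_Pi k \<phi>" "wto_Sigma k \<phi>" "wto_Pi k \<phi>"
  using qf_in_Sigma_Pi[OF assms, of k] by (simp_all add: to_Sigma_Sigma to_Pi_Pi to_Sigma_imp_wto_Sigma to_Pi_imp_wto_Pi)

text \<open>\<open>Disj\<close> needs the exact conversion on the existential side, and
  \<open>Forall\<close> needs DNS on the universal side. \<open>Imp\<close> is first put into weak
  form and then upgraded through the stability of its conclusion.\<close>

lemma Sigma_normal_form:
  assumes stab: "stab (Suc k)"
    and DNS: "\<And>\<phi>. wf_fm \<phi> \<Longrightarrow> bounded Minus (Suc k) \<phi> \<Longrightarrow>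
      Forall (Neg (Neg \<phi>)) \<sqsubseteq> Neg (Neg (Forall \<phi>))"
    and IHS: "\<And>\<phi>. wf_fm \<phi> \<Longrightarrow> bounded Plus k \<phi> \<Longrightarrow> to_Sigma k \<phi>"
    and IHP: "\<And>\<phi>. wf_fm \<phi> \<Longrightarrow> bounded Minus k \<phi> \<Longrightarrow> to_Pi k \<phi>"
  shows "wf_fm \<phi> \<Longrightarrow>
    (bounded Plus (Suc k) \<phi> \<longrightarrow> to_Sigma (Suc k) \<phi>) \<and> (bounded Minus (Suc k) \<phi> \<longrightarrow> wto_Pi (Suc k) \<phi>)"
proof (induction \<phi>)
  case (Eq s t)
  then show ?case by (simp add: qf_classes)
next
  case Fls
  then show ?case by (simp add: qf_classes)
next
  case (Conj \<phi> \<psi>)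
  then show ?case using bounded_Conj to_Sigma_Conj wto_Pi_Conj by (meson wf_fm.simps(3))
next
  case (Disj \<phi> \<psi>)
  have below: "\<And>j. j < Suc k \<Longrightarrow> stab j" using stab_le[OF stab] by simp
  from Disj show ?case
    using bounded_Disj to_Sigma_Disj[OF stab_le[OF stab]] wto_Pi_Disj[OF below]
    by (meson wf_fm.simps(4) le_SucI order_refl)
next
  case (Imp \<phi> \<psi>)
  have below: "\<And>j. j < Suc k \<Longrightarrow> stab j" using stab_le[OF stab] by simp
  have "to_Sigma (Suc k) (Imp \<phi> \<psi>)" if "bounded Plus (Suc k) (Imp \<phi> \<psi>)"
  proof -
    have "wto_Pi (Suc k) \<phi>" "to_Sigma (Suc k) \<psi>" using bounded_Imp[OF that] Imp by simp_all
    then have "wto_Sigma (Suc k) (Imp \<phi> \<psi>)" "stable (Imp \<phi> \<psi>)"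
      using wto_Sigma_Imp[OF below] to_Sigma_imp_wto_Sigma stable_Imp[OF to_Sigma_stable[OF _ stab]] Imp.prems by simp_all
    then show ?thesis using wto_Sigma_stable stab by blast
  qed
  moreover have "wto_Pi (Suc k) (Imp \<phi> \<psi>)" if "bounded Minus (Suc k) (Imp \<phi> \<psi>)"
    using bounded_Imp[OF that] Imp wto_Pi_Imp[OF below] to_Sigma_imp_wto_Sigma by simp
  ultimately show ?case by blast
next
  case (Forall \<phi>)
  have "to_Sigma (Suc k) (Forall \<phi>)" if "bounded Plus (Suc k) (Forall \<phi>)"
    using IHP[OF Forall.prems bounded_Plus_Forall[OF that]] by (rule to_Pi_imp_to_Sigma_Suc)
  moreover have "wto_Pi (Suc k) (Forall \<phi>)" if "bounded Minus (Suc k) (Forall \<phi>)"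
    using wto_Pi_Forall[OF _ stab_le[OF stab]] DNS bounded_Forall[OF that] Forall by simp
  ultimately show ?case by blast
next
  case (Exists \<phi>)
  have "wto_Pi (Suc k) (Exists \<phi>)" if "bounded Minus (Suc k) (Exists \<phi>)"
    using IHS[OF Exists.prems bounded_Minus_Exists[OF that]] by (intro to_Pi_imp_wto_Pi to_Sigma_imp_to_Pi_Suc)
  moreover have "to_Sigma (Suc k) (Exists \<phi>)" if "bounded Plus (Suc k) (Exists \<phi>)"
    using to_Sigma_Exists bounded_Exists[OF that] Exists by simp
  ultimately show ?case by blast
qed

text \<open>On the universal side normal forms are exact, so \<open>Forall\<close> is a plain
  congruence step; on the existential side they are weak, and \<open>Exists\<close> respects
  \<open>\<sim>\<close>.\<close>

lemma Pi_normal_form: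
  assumes stab: "stab k"
    and DNE: "\<And>\<phi> \<psi>. \<phi> \<in> Pi_cls (Suc k) \<Longrightarrow> \<psi> \<in> Pi_cls (Suc k) \<Longrightarrow> stable (Disj \<phi> \<psi>)"
    and IHS: "\<And>\<phi>. wf_fm \<phi> \<Longrightarrow> bounded Plus k \<phi> \<Longrightarrow> to_Sigma k \<phi>"
    and IHP: "\<And>\<phi>. wf_fm \<phi> \<Longrightarrow> bounded Minus k \<phi> \<Longrightarrow> to_Pi k \<phi>"
  shows "wf_fm \<phi> \<Longrightarrow>
    (bounded Plus (Suc k) \<phi> \<longrightarrow> wto_Sigma (Suc k) \<phi>) \<and> (bounded Minus (Suc k) \<phi> \<longrightarrow> to_Pi (Suc k) \<phi>)"
proof (induction \<phi>)
  case (Eq s t)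
  then show ?case by (simp add: qf_classes)
next
  case Fls
  then show ?case by (simp add: qf_classes)
next
  case (Conj \<phi> \<psi>)
  then show ?case using bounded_Conj wto_Sigma_Conj to_Pi_Conj by (meson wf_fm.simps(3))
next
  case (Disj \<phi> \<psi>)
  have below: "\<And>j. j < Suc k \<Longrightarrow> stab j" using stab_le[OF stab] by simp
  have "to_Pi (Suc k) (Disj \<phi> \<psi>)" if "bounded Minus (Suc k) (Disj \<phi> \<psi>)"
  proof -
    have *: "to_Pi (Suc k) \<phi>" "to_Pi (Suc k) \<psi>" using bounded_Disj[OF that] Disj by simp_all
    then obtain \<phi>' \<psi>' where "\<phi>' \<in> Pi_cls (Suc k)" "\<phi> \<approx> \<phi>'" "\<psi>' \<in> Pi_cls (Suc k)" "\<psi> \<approx> \<psi>'"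
      by (auto simp: to_Pi_def)
    \<comment> \<open>The disjunction inherits stability from the disjunction of the two normal
      forms, to which the principle applies.\<close>
    then have "stable (Disj \<phi> \<psi>)" using stable_eqv[OF eqv_cong(2)] DNE by blast
    moreover have "wto_Pi (Suc k) (Disj \<phi> \<psi>)" using * wto_Pi_Disj[OF below] to_Pi_imp_wto_Pi by simp
    ultimately show ?thesis using wto_Pi_stable stab_Pi_Suc[OF stab] by blast
  qed
  moreover have "wto_Sigma (Suc k) (Disj \<phi> \<psi>)" if "bounded Plus (Suc k) (Disj \<phi> \<psi>)"
    using bounded_Disj[OF that] Disj wto_Sigma_Disj[OF below] by simp
  ultimately show ?case by blast
next
  case (Imp \<phi> \<psi>)
  have below: "\<And>j. j < Suc k \<Longrightarrow> stab j" using stab_le[OF stab] by simp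
  have "to_Pi (Suc k) (Imp \<phi> \<psi>)" if "bounded Minus (Suc k) (Imp \<phi> \<psi>)"
  proof -
    have "wto_Sigma (Suc k) \<phi>" "to_Pi (Suc k) \<psi>" using bounded_Imp[OF that] Imp by simp_all
    then have "wto_Pi (Suc k) (Imp \<phi> \<psi>)" "stable (Imp \<phi> \<psi>)"
      using wto_Pi_Imp[OF below] to_Pi_imp_wto_Pi stable_Imp[OF to_Pi_stable[OF _ stab]] Imp.prems by simp_all
    then show ?thesis using wto_Pi_stable stab_Pi_Suc[OF stab] by blast
  qed
  moreover have "wto_Sigma (Suc k) (Imp \<phi> \<psi>)" if "bounded Plus (Suc k) (Imp \<phi> \<psi>)"
    using bounded_Imp[OF that] Imp wto_Sigma_Imp[OF below] to_Pi_imp_wto_Pi by simp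
  ultimately show ?case by blast
next
  case (Forall \<phi>)
  have "wto_Sigma (Suc k) (Forall \<phi>)" if "bounded Plus (Suc k) (Forall \<phi>)"
    using IHP[OF Forall.prems bounded_Plus_Forall[OF that]] by (intro to_Sigma_imp_wto_Sigma to_Pi_imp_to_Sigma_Suc)
  moreover have "to_Pi (Suc k) (Forall \<phi>)" if "bounded Minus (Suc k) (Forall \<phi>)"
    using to_Pi_Forall bounded_Forall[OF that] Forall by simp
  ultimately show ?case by blast
next
  case (Exists \<phi>)
  have "to_Pi (Suc k) (Exists \<phi>)" if "bounded Minus (Suc k) (Exists \<phi>)"
    using IHS[OF Exists.prems bounded_Minus_Exists[OF that]] by (rule to_Sigma_imp_to_Pi_Suc)
  moreover have "wto_Sigma (Suc k) (Exists \<phi>)" if "bounded Plus (Suc k) (Exists \<phi>)"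
    using wto_Sigma_Exists bounded_Exists[OF that] Exists by simp
  ultimately show ?case by blast
qed

lemma proves_DNE_iff: "T \<turnstile> Forall (Imp (Neg (Neg \<phi>)) \<phi>) \<longleftrightarrow> stable \<phi>"
  by (simp add: proves_Forall_iff proves_Imp_iff stable_def)

end

section \<open>The two theories and the induction on k\<close>

lemma arith_theory_Un:
  assumes "\<And>\<chi>. \<chi> \<in> S \<Longrightarrow> wf_fm \<chi> \<and> FV \<chi> = {}"
  shows "arith_theory (HA \<union> S)"
proof
  show "HA \<subseteq> HA \<union> S" by blast
  show "wf_fm \<phi>" if "\<phi> \<in> HA \<union> S" for \<phi>
    using that assms HA_wf by blast
  show "subst \<sigma> \<phi> \<in> HA \<union> S" if "\<phi> \<in> HA \<union> S" "\<And>n. wf_tm (\<sigma> n)" for \<phi> \<sigma>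
  proof (cases "\<phi> \<in> HA")
    case True
    have "subst \<sigma> \<phi> \<in> HA" by (rule HA_subst[OF that(2) True])
    then show ?thesis by (rule UnI1)
  next
    case False
    then have "\<phi> \<in> S" using that(1) by simp
    \<comment> \<open>The instances added to \<open>HA\<close> are closed, so substitution fixes
      them.\<close>
    moreover have "subst \<sigma> \<phi> = \<phi>" using assms[OF \<open>\<phi> \<in> S\<close>] by (intro subst_closed) simp
    ultimately show ?thesis by simp
  qed
qed

lemma arith_theory_transfer:
  assumes "arith_theory S" "arith_theory T" "\<And>\<chi>. \<chi> \<in> S \<Longrightarrow> T \<turnstile> \<chi>"
  shows "arith_theory.to_Sigma S k \<phi> \<Longrightarrow> arith_theory.to_Sigma T k \<phi>"
    and "arith_theory.to_Pi S k \<phi> \<Longrightarrow> arith_theory.to_Pi T k \<phi>"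
proof -
  interpret S: arith_theory S by fact
  interpret T: arith_theory T by fact
  have "T.eqv \<phi> \<psi>" if "S.eqv \<phi> \<psi>" for \<phi> \<psi>
    using that deriv_cut_axioms[OF assms(3)] by (auto simp: S.eqv_def T.eqv_def S.le_def T.le_def)
  then show "S.to_Sigma k \<phi> \<Longrightarrow> T.to_Sigma k \<phi>" "S.to_Pi k \<phi> \<Longrightarrow> T.to_Pi k \<phi>"
    unfolding S.to_Sigma_def T.to_Sigma_def S.to_Pi_def T.to_Pi_def by blast+
qed

abbreviation (input) "Sigma_theory k \<equiv> HA \<union> DNE (Sigma_cls k) \<union> DNS (U_plus k)"
abbreviation (input) "Pi_theory k \<equiv> HA \<union> DNE_disj (Pi_cls k) (Pi_cls k)"

lemma proves_axiom: "\<chi> \<in> T \<Longrightarrow> T \<turnstile> \<chi>"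
  by (simp add: proves_def deriv.Ax)

lemma arith_theory_Sigma: "arith_theory (Sigma_theory k)"
  unfolding Un_assoc by (rule arith_theory_Un) (auto simp: DNE_def DNS_def U_plus_iff dest: Sigma_wf)

lemma arith_theory_Pi: "arith_theory (Pi_theory k)"
  by (rule arith_theory_Un) (auto simp: DNE_disj_def dest: Pi_wf)

lemma normal_forms:
  "(\<forall>\<phi>. wf_fm \<phi> \<longrightarrow> bounded Plus k \<phi> \<longrightarrow> arith_theory.to_Sigma (Sigma_theory k) k \<phi>) \<and>
   (\<forall>\<phi>. wf_fm \<phi> \<longrightarrow> bounded Minus k \<phi> \<longrightarrow> arith_theory.to_Pi (Pi_theory k) k \<phi>)"
proof (induction k)
  case 0
  then show ?case
    using arith_theory.qf_classes[OF arith_theory_Sigma[of 0]]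
      arith_theory.qf_classes[OF arith_theory_Pi[of 0]] bounded_0 by blast
next
  case (Suc k)
  interpret S: arith_theory "Sigma_theory (Suc k)" by (rule arith_theory_Sigma)
  interpret P: arith_theory "Pi_theory (Suc k)" by (rule arith_theory_Pi)
  note IHS = Suc.IH[THEN conjunct1, rule_format] and IHP = Suc.IH[THEN conjunct2, rule_format]

  have stabS: "S.stab (Suc k)"
    unfolding S.stab_def
  proof
    fix \<phi> assume \<phi>: "\<phi> \<in> Sigma_cls (Suc k)"
    show "S.stable \<phi>"
      by (rule S.stable_of_DNE[of "Sigma_cls (Suc k)"])
        (use \<phi> in \<open>auto intro: proves_axiom Sigma_subst dest: Sigma_wf\<close>)
  qed
  have DNS: "S.le (Forall (Neg (Neg \<phi>))) (Neg (Neg (Forall \<phi>)))"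
    if "wf_fm \<phi>" "bounded Minus (Suc k) \<phi>" for \<phi>
    by (rule S.DNS_open[of "U_plus (Suc k)"])
      (use that in \<open>auto intro!: proves_axiom U_plus_subst wf_up simp: U_plus_iff[of \<phi>]\<close>)
  have "Sigma_theory (Suc k) \<turnstile> \<chi>" if "\<chi> \<in> Sigma_theory k" for \<chi>
    using that Sigma_mono bounded_Suc by (intro proves_axiom) (auto simp: DNE_def DNS_def U_plus_iff)
  then have IHS_S: "S.to_Sigma k \<phi>" if "wf_fm \<phi>" "bounded Plus k \<phi>" for \<phi>
    using arith_theory_transfer(1)[OF arith_theory_Sigma S.arith_theory_axioms] IHS that by blast
  have "Sigma_theory (Suc k) \<turnstile> \<chi>" if "\<chi> \<in> Pi_theory k" for \<chi>
  proof (cases "\<chi> \<in> HA")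
    case False
    then obtain \<phi> \<psi> where "\<chi> = Forall (Imp (Neg (Neg (Disj \<phi> \<psi>))) (Disj \<phi> \<psi>))"
      "\<phi> \<in> Pi_cls k" "\<psi> \<in> Pi_cls k"
      using \<open>\<chi> \<in> Pi_theory k\<close> by (auto simp: DNE_disj_def)
    then show ?thesis
      using S.to_Sigma_stable[OF S.to_Sigma_Disj_Pi[OF S.stab_le[OF stabS]] stabS] by (simp add: S.proves_DNE_iff)
  qed (simp add: proves_axiom)
  then have IHP_S: "S.to_Pi k \<phi>" if "wf_fm \<phi>" "bounded Minus k \<phi>" for \<phi>
    using arith_theory_transfer(2)[OF arith_theory_Pi S.arith_theory_axioms] IHP that by blast

  have DNE: "P.stable (Disj \<phi> \<psi>)" if "\<phi> \<in> Pi_cls (Suc k)" "\<psi> \<in> Pi_cls (Suc k)" for \<phi> \<psi>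
    by (rule P.stable_of_DNE_disj[of "Pi_cls (Suc k)" "Pi_cls (Suc k)"])
      (use that in \<open>auto intro: proves_axiom Pi_subst dest: Pi_wf\<close>)
  have stabP: "P.stab k"
    unfolding P.stab_def
  proof
    fix \<phi> assume \<phi>: "\<phi> \<in> Sigma_cls k"
    then have "P.eqv \<phi> (Disj \<phi> \<phi>)"
      using Sigma_wf P.le_refl by (simp add: P.eqv_def P.Disj_le_iff P.le_Disj)
    then show "P.stable \<phi>" using P.stable_eqv DNE \<phi> Sigma_sub_Pi by blast
  qed
  have "Pi_theory (Suc k) \<turnstile> \<chi>" if "\<chi> \<in> Pi_theory k" for \<chi>
    using that Pi_mono by (intro proves_axiom) (auto simp: DNE_disj_def)
  then have IHP_P: "P.to_Pi k \<phi>" if "wf_fm \<phi>" "bounded Minus k \<phi>" for \<phi>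
    using arith_theory_transfer(2)[OF arith_theory_Pi P.arith_theory_axioms] IHP that by blast
  have "Pi_theory (Suc k) \<turnstile> \<chi>" if \<chi>: "\<chi> \<in> Sigma_theory k" for \<chi>
  proof -
    consider "\<chi> \<in> HA" | \<phi> where "\<chi> = Forall (Imp (Neg (Neg \<phi>)) \<phi>)" "\<phi> \<in> Sigma_cls k"
      | \<phi> where "\<chi> = Forall (Imp (Forall (Neg (Neg \<phi>))) (Neg (Neg (Forall \<phi>))))" "\<phi> \<in> U_plus k"
      using \<chi> by (auto simp: DNE_def DNS_def)
    then show ?thesis
    proof cases
      case 1
      then show ?thesis by (simp add: proves_axiom)
    next
      case 2
      then show ?thesis using stabP by (simp add: P.proves_DNE_iff P.stab_def)
    next
      case 3
      then obtain \<phi>' where "\<phi>' \<in> Pi_cls k" "P.eqv \<phi> \<phi>'"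
        using IHP_P by (auto simp: U_plus_iff P.to_Pi_def)
      then have "P.stable \<phi>" using P.stable_eqv P.stab_Pi_Suc[OF stabP] Pi_mono by blast
      then have "P.le (Forall (Neg (Neg \<phi>))) (Forall \<phi>)" by (simp add: P.stable_def P.Forall_mono)
      moreover have "P.le (Forall \<phi>) (Neg (Neg (Forall \<phi>)))"
        using 3 by (intro P.le_NegNeg) (simp add: U_plus_iff)
      ultimately have "P.le (Forall (Neg (Neg \<phi>))) (Neg (Neg (Forall \<phi>)))" by (rule P.le_trans)
      then show ?thesis using 3 by (simp add: P.proves_Forall_iff P.proves_Imp_iff)
    qed
  qed
  then have IHS_P: "P.to_Sigma k \<phi>" if "wf_fm \<phi>" "bounded Plus k \<phi>" for \<phi>
    using arith_theory_transfer(1)[OF arith_theory_Sigma P.arith_theory_axioms] IHS that by blast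

  show ?case
    using S.Sigma_normal_form[OF stabS DNS IHS_S IHP_S] P.Pi_normal_form[OF stabP DNE IHS_P IHP_P] by blast
qed

theorem theorem5p3:
  fixes k :: nat and \<phi> :: fm
  assumes "wf_fm \<phi>"
  shows "(\<phi> \<in> E_plus k \<longrightarrow>
            (\<exists>\<phi>'\<in>Sigma_cls k. FV \<phi> = FV \<phi>' \<and>
               HA \<union> DNE (Sigma_cls k) \<union> DNS (U_plus k) \<turnstile> Iff \<phi> \<phi>'))
       \<and> (\<phi> \<in> U_plus k \<longrightarrow>
            (\<exists>\<phi>'\<in>Pi_cls k. FV \<phi> = FV \<phi>' \<and>
               HA \<union> DNE_disj (Pi_cls k) (Pi_cls k) \<turnstile> Iff \<phi> \<phi>'))"
proof -
  interpret S: arith_theory "Sigma_theory k" by (rule arith_theory_Sigma)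
  interpret P: arith_theory "Pi_theory k" by (rule arith_theory_Pi)
  show ?thesis
    using normal_forms[of k]
    by (simp add: E_plus_iff U_plus_iff S.to_Sigma_def P.to_Pi_def S.proves_Iff P.proves_Iff)
qed

end
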